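(* Let $U,V$ be real Banach spaces and let $\mathfrak{F}\in\mathcal{C}^1(\mathbb{R}\times U,V)$ satisfy: (F1) $\mathfrak{F}$ is orientable, i.e. $D_u\mathfrak{F}:\mathbb{R}\times U\to\Phi_0(U,V)$ is an orientable map; (F2) $\mathfrak{F}(\lambda,0)=0$ for all $\lambda\in\mathbb{R}$; (F3) $D_u\mathfrak{F}(\lambda,u)\in\Phi_0(U,V)$ for all $(\lambda,u)\in\mathbb{R}\times U$; (F4) $\mathfrak{F}$ is proper on bounded and closed subsets of $\mathbb{R}\times U$. Put $\mathfrak{L}(\lambda):=D_u\mathfrak{F}(\lambda,0)$ and let $\mathcal{J}=\{J_n\}_{n=r}^s$ be an admissible ordered family of intervals for $\Sigma(\mathfrak{L})$. Suppose there exists $n\in\mathbb{Z}\cap[r+1,s]$ such that, for sufficiently small $\delta>0$, with $\lambda_-=\inf I_n-\delta$ and $\lambda_+=\sup I_n+\delta$, the integer $\chi[\mathfrak{L}_\omega,[\lambda_-,\lambda_+]]$ is odd, where $\mathfrak{L}_\omega:[\lambda_-,\lambda_+]\to\Phi_0(U,V)$ is any analytic admissible curve $\mathcal{A}$-homotopic to $\mathfrak{L}(\lambda)$, $\lambda\in[\lambda_-,\lambda_+]$. Then there exists a component $\mathfrak{C}$ of the set of non-trivial solutions $\mathcal{S}_{\mathcal{J}}$ such that $\mathfrak{C}\cap(I_n\times\{0\})\neq\emptyset$. Moreover, one of the following non-excluding alternatives occurs: (i) $\mathfrak{C}$ is unbounded. (ii) There exists $m\in\mathbb{Z}\cap[r+1,s]$,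 $m\neq n$, such that $\mathfrak{C}\cap(I_m\times\{0\})\neq\emptyset$.
   Context: $\Phi_0(U,V)$: bounded linear Fredholm operators of index zero; $GL(U,V)$: topological isomorphisms; $\Sigma(\mathfrak{L})=\{\lambda:\mathfrak{L}(\lambda)\notin GL(U,V)\}$. Parity and orientability: for a continuous $\mathfrak{L}:[a,b]\to\Phi_0(U,V)$ with invertible endpoints (an admissible path), choose a continuous $\mathfrak{P}:[a,b]\to GL(V,U)$ with $\mathfrak{P}(\lambda)\mathfrak{L}(\lambda)-I_U$ compact for all $\lambda$ (it exists) and put $\sigma(\mathfrak{L},[a,b])=\deg_{LS}(\mathfrak{P}(a)\mathfrak{L}(a))\deg_{LS}(\mathfrak{P}(b)\mathfrak{L}(b))$, with $\deg_{LS}(T)$ the Leray--Schauder degree of $T$ on a small ball at $0$. A continuous $h:X\to\Phi_0(U,V)$, $X$ path-connected, is orientable if there is $\varepsilon:\{x:h(x)\in GL(U,V)\}\to\{-1,1\}$ with $\sigma(h\circ\gamma,[a,b])=\varepsilon(\gamma(a))\varepsilon(\gamma(b))$ for every continuous $\gamma:[a,b]\to X$ with $h(\gamma(a)),h(\gamma(b))\in GL(U,V)$. $\mathcal{A}$-homotopy: admissible paths $\mathfrak{L}_1,\mathfrak{L}_2$ on $[a,b]$ are $\mathcal{A}$-homotopic if there is a continuous $H:[0,1]\times[a,b]\to\Phi_0(U,V)$ with $H(t,a),H(t,b)\in GL(U,V)$ for all $t$, $H(0,\cdot)=\mathfrak{L}_1$, $H(1,\cdot)=\mathfrak{L}_2$.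 Every admissible path is $\mathcal{A}$-homotopic to an analytic one. Generalized algebraic multiplicity $\chi$: let $\mathfrak{L}$ be a $\mathcal{C}^r$ curve in $\Phi_0(U,V)$. $\lambda_0\in\Sigma(\mathfrak{L})$ is $\kappa$-algebraic ($1\leq\kappa\leq r$) if there are $\varepsilon,C>0$ with $\mathfrak{L}(\lambda)\in GL(U,V)$ and $\|\mathfrak{L}(\lambda)^{-1}\|<C|\lambda-\lambda_0|^{-\kappa}$ for $0<|\lambda-\lambda_0|<\varepsilon$, with $\kappa$ minimal. Put $\mathfrak{L}_j=\frac1{j!}\mathfrak{L}^{(j)}(\lambda_0)$. $\lambda_0$ is $\kappa$-transversal if $\bigoplus_{j=1}^{\kappa}\mathfrak{L}_j\big(\bigcap_{i=0}^{j-1}N[\mathfrak{L}_i]\big)\oplus R[\mathfrak{L}_0]=V$ with $\mathfrak{L}_\kappa\big(\bigcap_{i=0}^{\kappa-1}N[\mathfrak{L}_i]\big)\neq\{0\}$; then $\chi[\mathfrak{L},\lambda_0]:=\sum_{j=1}^{\kappa}j\dim\mathfrak{L}_j\big(\bigcap_{i=0}^{j-1}N[\mathfrak{L}_i]\big)$. For a general $\kappa$-algebraic $\lambda_0$ there is a polynomial $\Phi$ with values in $\mathcal{L}(U)$, $\Phi(\lambda_0)=I_U$, such that $\lambda_0$ is $\kappa$-transversal for $\mathfrak{L}^\Phi(\lambda):=\mathfrak{L}(\lambda)\Phi(\lambda)$, and $\chi[\mathfrak{L},\lambda_0]:=\chi[\mathfrak{L}^\Phi,\lambda_0]$, independently of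 $\Phi$. For analytic admissible $\mathfrak{L}_\omega$ on $[a,b]$, $\Sigma(\mathfrak{L}_\omega)$ is finite, consists of algebraic eigenvalues, and $\chi[\mathfrak{L}_\omega,[a,b]]:=\sum_{\lambda\in\Sigma(\mathfrak{L}_\omega)}\chi[\mathfrak{L}_\omega,\lambda]$. Admissible ordered family: a non-empty locally finite family $\mathcal{J}=\{J_n\}_{n=r}^s$ ($r\leq s$ in $\mathbb{Z}\cup\{\pm\infty\}$) of disjoint non-empty open intervals of $\mathbb{R}$ with $J_n\cap\Sigma(\mathfrak{L})=\emptyset$ for all $n$ and $J_{n-1}<J_n$ (each point of $J_{n-1}$ is less than each point of $J_n$). Set $I_n:=[\sup J_{n-1},\inf J_n]$, $n\in\mathbb{Z}\cap[r+1,s]$. The set of non-trivial solutions is $\mathcal{S}_{\mathcal{J}}:=\big(\mathfrak{F}^{-1}(0)\cap[\mathbb{R}\times(U\setminus\{0\})]\big)\cup\big[(\mathbb{R}\setminus\bigcup_{n=r}^sJ_n)\times\{0\}\big]$, and a component of it is a connected component. *)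

theory Defs
  imports
    "HOL-Analysis.Analysis"
    "HOL-Homology.Homology"
    "HOL-Library.Extended"
begin

subsection \<open>Isomorphisms, compact operators, Fredholm operators of index zero\<close>

definition GL :: "('u::real_normed_vector \<Rightarrow>\<^sub>L 'v::real_normed_vector) set" where
  "GL = {A. \<exists>B. A o\<^sub>L B = id_blinfun \<and> B o\<^sub>L A = id_blinfun}"

definition blinfun_inv ::
  "('u::real_normed_vector \<Rightarrow>\<^sub>L 'v::real_normed_vector) \<Rightarrow> 'v \<Rightarrow>\<^sub>L 'u" where
  "blinfun_inv A = (THE B. A o\<^sub>L B = id_blinfun \<and> B o\<^sub>L A = id_blinfun)"

definition compact_blinfun :: "('u::real_normed_vector \<Rightarrow>\<^sub>L 'v::real_normed_vector) \<Rightarrow> bool" where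
  "compact_blinfun K \<longleftrightarrow> (\<forall>S. bounded S \<longrightarrow> compact (closure (blinfun_apply K ` S)))"

definition finite_dim :: "'a::real_vector set \<Rightarrow> bool" where
  "finite_dim S \<longleftrightarrow> (\<exists>B. finite B \<and> S \<subseteq> span B)"

definition alg_complement :: "'a::real_vector set \<Rightarrow> 'a set \<Rightarrow> bool" where
  "alg_complement S W \<longleftrightarrow>
     subspace W \<and> S \<inter> W = {0} \<and> (\<forall>v. \<exists>x\<in>S. \<exists>w\<in>W. v = x + w)"

definition finite_codim :: "'a::real_vector set \<Rightarrow> bool" where
  "finite_codim S \<longleftrightarrow> (\<exists>W. alg_complement S W \<and> finite_dim W)"

definition codim :: "'a::real_vector set \<Rightarrow> nat" where
  "codim S = (THE d. \<exists>W. alg_complement S W \<and> finite_dim W \<and> d = dim W)"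

definition null_space :: "('u::real_normed_vector \<Rightarrow>\<^sub>L 'v::real_normed_vector) \<Rightarrow> 'u set" where
  "null_space A = {x. blinfun_apply A x = 0}"

definition fredholm :: "('u::real_normed_vector \<Rightarrow>\<^sub>L 'v::real_normed_vector) \<Rightarrow> bool" where
  "fredholm A \<longleftrightarrow> finite_dim (null_space A) \<and> finite_codim (range (blinfun_apply A))"

definition fredholm_index :: "('u::real_normed_vector \<Rightarrow>\<^sub>L 'v::real_normed_vector) \<Rightarrow> int" where
  "fredholm_index A = int (dim (null_space A)) - int (codim (range (blinfun_apply A)))"

definition Phi0 :: "('u::real_normed_vector \<Rightarrow>\<^sub>L 'v::real_normed_vector) set" where
  "Phi0 = {A. fredholm A \<and> fredholm_index A = 0}"

definition Sigma_on ::
  "real set \<Rightarrow> (real \<Rightarrow> 'u::real_normed_vector \<Rightarrow>\<^sub>L 'v::real_normed_vector) \<Rightarrow> real set" where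
  "Sigma_on S L = {t \<in> S. L t \<notin> GL}"


subsection \<open>Leray--Schauder degree on balls centred at the origin\<close>

text \<open>
  Let \<open>b 0, \<dots>, b p\<close> be a basis of a subspace \<open>E\<close>, and let \<open>g\<close> map the sphere of radius \<open>r\<close> of
  \<open>E\<close> into \<open>E - {0}\<close>. In the coordinates given by \<open>b\<close>, and after radial projection to the
  Euclidean unit sphere on both sides, \<open>g\<close> becomes a self-map of \<open>nsphere p\<close>.
\<close>

definition sphere_map ::
  "nat \<Rightarrow> (nat \<Rightarrow> 'a::real_normed_vector) \<Rightarrow> real \<Rightarrow> ('a \<Rightarrow> 'a) \<Rightarrow> (nat \<Rightarrow> real) \<Rightarrow> nat \<Rightarrow> real" where
  "sphere_map p b r g x =
     (let z = (\<Sum>i\<le>p. x i *\<^sub>R b i);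
          y = g ((r / norm z) *\<^sub>R z);
          c = (\<lambda>i. if i \<le> p then representation (b ` {..p}) y (b i) else 0)
      in (\<lambda>i. c i / sqrt (\<Sum>j\<le>p. (c j)\<^sup>2)))"

text \<open>
  The Brouwer degree with respect to \<open>0\<close> of a continuous \<open>g\<close> from the closed ball of radius \<open>r\<close> in
  the finite-dimensional space \<open>E\<close> to \<open>E\<close>, without zeros on the sphere. It does not depend on the
  basis, because the same basis is used for source and target.
\<close>

definition brouwer_degree_ball ::
  "'a::real_normed_vector set \<Rightarrow> real \<Rightarrow> ('a \<Rightarrow> 'a) \<Rightarrow> int" where
  "brouwer_degree_ball E r g =
     (if E = {0} then 1
      else (THE d. \<exists>p b. inj_on b {..p} \<and> independent (b ` {..p}) \<and> span (b ` {..p}) = E \<and>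
                         d = Brouwer_degree2 p (sphere_map p b r g)))"

text \<open>
  For \<open>f = id - K\<close> on \<open>cball 0 r\<close>, with \<open>K\<close> continuous and compact (not necessarily linear): choose a
  continuous \<open>k\<close> with values in a finite-dimensional subspace \<open>E\<close> whose uniform distance to \<open>K\<close> is
  less than the distance from \<open>0\<close> to \<open>f ` sphere 0 r\<close>, and take the Brouwer degree of \<open>id - k\<close>
  on the ball of \<open>E\<close>.
\<close>

definition leray_schauder_degree :: "real \<Rightarrow> ('a::real_normed_vector \<Rightarrow> 'a) \<Rightarrow> int" where
  "leray_schauder_degree r f =
     (THE d. \<exists>E k \<eta> \<mu>. subspace E \<and> finite_dim E \<and>
        continuous_on (cball 0 r) k \<and> k ` cball 0 r \<subseteq> E \<and>
        (\<forall>x\<in>cball 0 r. norm ((x - f x) - k x) \<le> \<eta>) \<and>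
        \<eta> < \<mu> \<and> (\<forall>x\<in>sphere 0 r. \<mu> \<le> norm (f x)) \<and>
        d = brouwer_degree_ball E r (\<lambda>x. x - k x))"

definition deg_LS :: "('a::real_normed_vector \<Rightarrow>\<^sub>L 'a) \<Rightarrow> int" where
  "deg_LS T = (THE d. \<forall>\<^sub>F r in at_right 0. leray_schauder_degree r (blinfun_apply T) = d)"


subsection \<open>Admissible paths, parity, orientability\<close>

definition admissible_path ::
  "(real \<Rightarrow> 'u::real_normed_vector \<Rightarrow>\<^sub>L 'v::real_normed_vector) \<Rightarrow> real \<Rightarrow> real \<Rightarrow> bool" where
  "admissible_path L a b \<longleftrightarrow>
     continuous_on {a..b} L \<and> L ` {a..b} \<subseteq> Phi0 \<and> L a \<in> GL \<and> L b \<in> GL"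

definition parametrix ::
  "(real \<Rightarrow> 'u::real_normed_vector \<Rightarrow>\<^sub>L 'v::real_normed_vector) \<Rightarrow> real \<Rightarrow> real \<Rightarrow>
   (real \<Rightarrow> 'v \<Rightarrow>\<^sub>L 'u) \<Rightarrow> bool" where
  "parametrix L a b P \<longleftrightarrow>
     continuous_on {a..b} P \<and> P ` {a..b} \<subseteq> GL \<and>
     (\<forall>t\<in>{a..b}. compact_blinfun ((P t o\<^sub>L L t) - id_blinfun))"

definition parity ::
  "(real \<Rightarrow> 'u::real_normed_vector \<Rightarrow>\<^sub>L 'v::real_normed_vector) \<Rightarrow> real \<Rightarrow> real \<Rightarrow> int" where
  "parity L a b =
     (let P = (SOME P. parametrix L a b P)
      in deg_LS (P a o\<^sub>L L a) * deg_LS (P b o\<^sub>L L b))"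

definition orientable_on ::
  "'x::topological_space set \<Rightarrow>
   ('x \<Rightarrow> 'u::real_normed_vector \<Rightarrow>\<^sub>L 'v::real_normed_vector) \<Rightarrow> bool" where
  "orientable_on X h \<longleftrightarrow>
     path_connected X \<and> continuous_on X h \<and> h ` X \<subseteq> Phi0 \<and>
     (\<exists>\<epsilon>::'x \<Rightarrow> int.
        (\<forall>x\<in>X. h x \<in> GL \<longrightarrow> \<epsilon> x \<in> {-1, 1}) \<and>
        (\<forall>a b \<gamma>. a < b \<and> continuous_on {a..b} \<gamma> \<and> \<gamma> ` {a..b} \<subseteq> X \<and>
                 h (\<gamma> a) \<in> GL \<and> h (\<gamma> b) \<in> GL \<longrightarrow>
                 parity (h \<circ> \<gamma>) a b = \<epsilon> (\<gamma> a) * \<epsilon> (\<gamma> b)))"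

definition A_homotopic ::
  "real \<Rightarrow> real \<Rightarrow> (real \<Rightarrow> 'u::real_normed_vector \<Rightarrow>\<^sub>L 'v::real_normed_vector) \<Rightarrow>
   (real \<Rightarrow> 'u \<Rightarrow>\<^sub>L 'v) \<Rightarrow> bool" where
  "A_homotopic a b L1 L2 \<longleftrightarrow>
     homotopic_with_canon (\<lambda>h. h a \<in> GL \<and> h b \<in> GL) {a..b} Phi0 L1 L2"

definition analytic_path ::
  "(real \<Rightarrow> 'u::real_normed_vector \<Rightarrow>\<^sub>L 'v::real_normed_vector) \<Rightarrow> real \<Rightarrow> real \<Rightarrow> bool" where
  "analytic_path L a b \<longleftrightarrow>
     (\<forall>t0\<in>{a..b}. \<exists>A \<rho>. \<rho> > 0 \<and>
        (\<forall>t\<in>{a..b}. \<bar>t - t0\<bar> < \<rho> \<longrightarrow> (\<lambda>k. (t - t0) ^ k *\<^sub>R A k) sums L t))"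


subsection \<open>Generalized algebraic multiplicity\<close>

definition algebraic_estimate ::
  "(real \<Rightarrow> 'u::real_normed_vector \<Rightarrow>\<^sub>L 'v::real_normed_vector) \<Rightarrow> real \<Rightarrow> nat \<Rightarrow> bool" where
  "algebraic_estimate L t0 \<kappa> \<longleftrightarrow>
     (\<exists>\<epsilon> C. \<epsilon> > 0 \<and> C > 0 \<and>
        (\<forall>t. 0 < \<bar>t - t0\<bar> \<and> \<bar>t - t0\<bar> < \<epsilon> \<longrightarrow>
             L t \<in> GL \<and> norm (blinfun_inv (L t)) < C / \<bar>t - t0\<bar> ^ \<kappa>))"

definition kappa_algebraic ::
  "(real \<Rightarrow> 'u::real_normed_vector \<Rightarrow>\<^sub>L 'v::real_normed_vector) \<Rightarrow> real \<Rightarrow> nat \<Rightarrow> bool" where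
  "kappa_algebraic L t0 \<kappa> \<longleftrightarrow>
     L t0 \<notin> GL \<and> 1 \<le> \<kappa> \<and> algebraic_estimate L t0 \<kappa> \<and>
     (\<forall>j. 1 \<le> j \<and> j < \<kappa> \<longrightarrow> \<not> algebraic_estimate L t0 j)"

definition taylor_coeff ::
  "(real \<Rightarrow> 'a::real_normed_vector) \<Rightarrow> real \<Rightarrow> nat \<Rightarrow> 'a" where
  "taylor_coeff L t0 j = (1 / fact j) *\<^sub>R ((\<lambda>f t. vector_derivative f (at t)) ^^ j) L t0"

definition trans_space ::
  "(real \<Rightarrow> 'u::real_normed_vector \<Rightarrow>\<^sub>L 'v::real_normed_vector) \<Rightarrow> real \<Rightarrow> nat \<Rightarrow> 'v set" where
  "trans_space L t0 j =
     blinfun_apply (taylor_coeff L t0 j) ` (\<Inter>i<j. null_space (taylor_coeff L t0 i))"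

text \<open>
  For \<open>j = 0\<close> the intersection is over the empty index set, so \<open>trans_space L t0 0\<close> is the range of
  \<open>L t0\<close>; the direct sum below therefore runs over \<open>{..\<kappa>}\<close>.
\<close>

definition kappa_transversal ::
  "(real \<Rightarrow> 'u::real_normed_vector \<Rightarrow>\<^sub>L 'v::real_normed_vector) \<Rightarrow> real \<Rightarrow> nat \<Rightarrow> bool" where
  "kappa_transversal L t0 \<kappa> \<longleftrightarrow>
     1 \<le> \<kappa> \<and>
     (\<forall>v. \<exists>!w. w \<in> (\<Pi>\<^sub>E j\<in>{..\<kappa>}. trans_space L t0 j) \<and> v = (\<Sum>j\<le>\<kappa>. w j)) \<and>
     trans_space L t0 \<kappa> \<noteq> {0}"

definition operator_polynomial :: "(real \<Rightarrow> 'a::real_normed_vector) \<Rightarrow> bool" where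
  "operator_polynomial \<Phi> \<longleftrightarrow> (\<exists>m A. \<forall>t. \<Phi> t = (\<Sum>k\<le>m. t ^ k *\<^sub>R A k))"

text \<open>Intended for curves that are smooth near \<open>t0\<close>; the transversal case is \<open>\<Phi> = id\<close>.\<close>

definition chi ::
  "(real \<Rightarrow> 'u::real_normed_vector \<Rightarrow>\<^sub>L 'v::real_normed_vector) \<Rightarrow> real \<Rightarrow> nat" where
  "chi L t0 =
     (THE m. \<exists>\<kappa> \<Phi>. kappa_algebraic L t0 \<kappa> \<and> operator_polynomial \<Phi> \<and> \<Phi> t0 = id_blinfun \<and>
        kappa_transversal (\<lambda>t. L t o\<^sub>L \<Phi> t) t0 \<kappa> \<and>
        m = (\<Sum>j=1..\<kappa>. j * dim (trans_space (\<lambda>t. L t o\<^sub>L \<Phi> t) t0 j)))"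

definition chi_total ::
  "(real \<Rightarrow> 'u::real_normed_vector \<Rightarrow>\<^sub>L 'v::real_normed_vector) \<Rightarrow> real \<Rightarrow> real \<Rightarrow> nat" where
  "chi_total L a b = (\<Sum>t\<in>Sigma_on {a..b} L. chi L t)"


subsection \<open>Nonlinear maps\<close>

definition C1_map :: "('a::real_normed_vector \<Rightarrow> 'b::real_normed_vector) \<Rightarrow> bool" where
  "C1_map F \<longleftrightarrow>
     (\<exists>D. (\<forall>z. (F has_derivative blinfun_apply (D z)) (at z)) \<and> continuous_on UNIV D)"

definition D_u ::
  "(real \<times> 'u::real_normed_vector \<Rightarrow> 'v::real_normed_vector) \<Rightarrow> real \<times> 'u \<Rightarrow> 'u \<Rightarrow>\<^sub>L 'v" where
  "D_u F z = Blinfun (frechet_derivative (\<lambda>u. F (fst z, u)) (at (snd z)))"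

definition proper_on_bounded_closed ::
  "('a::metric_space \<Rightarrow> 'b::topological_space) \<Rightarrow> bool" where
  "proper_on_bounded_closed F \<longleftrightarrow>
     (\<forall>B. bounded B \<and> closed B \<longrightarrow> (\<forall>K. compact K \<longrightarrow> compact (B \<inter> F -` K)))"


subsection \<open>Admissible ordered families of intervals and non-trivial solutions\<close>

definition family_index :: "int extended \<Rightarrow> int extended \<Rightarrow> int set" where
  "family_index r s = {n. r \<le> Fin n \<and> Fin n \<le> s}"

definition gap_index :: "int extended \<Rightarrow> int extended \<Rightarrow> int set" where
  "gap_index r s = {n. r + 1 \<le> Fin n \<and> Fin n \<le> s}"

definition admissible_family ::
  "real set \<Rightarrow> int extended \<Rightarrow> int extended \<Rightarrow> (int \<Rightarrow> real set) \<Rightarrow> bool" where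
  "admissible_family \<Sigma> r s J \<longleftrightarrow>
     r \<le> s \<and> family_index r s \<noteq> {} \<and>
     locally_finite_in euclidean (J ` family_index r s) \<and>
     disjoint_family_on J (family_index r s) \<and>
     (\<forall>n\<in>family_index r s. J n \<noteq> {} \<and> open (J n) \<and> is_interval (J n) \<and> J n \<inter> \<Sigma> = {}) \<and>
     (\<forall>n\<in>gap_index r s. \<forall>x\<in>J (n - 1). \<forall>y\<in>J n. x < y)"

definition gap :: "(int \<Rightarrow> real set) \<Rightarrow> int \<Rightarrow> real set" where
  "gap J n = {Sup (J (n - 1))..Inf (J n)}"

definition nontrivial_solutions ::
  "(real \<times> 'u::real_normed_vector \<Rightarrow> 'v::real_normed_vector) \<Rightarrow>
   int extended \<Rightarrow> int extended \<Rightarrow> (int \<Rightarrow> real set) \<Rightarrow> (real \<times> 'u) set" where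
  "nontrivial_solutions F r s J =
     (F -` {0} \<inter> UNIV \<times> (UNIV - {0})) \<union> (UNIV - (\<Union>n\<in>family_index r s. J n)) \<times> {0}"

end

theory Submission
  imports Defs
begin

text \<open>
  Suppose that every component of the non-trivial solutions meeting \<open>I\<^sub>n \<times> {0}\<close> is bounded and
  meets no other \<open>I\<^sub>m \<times> {0}\<close>. Properness and a separation argument give a compact set \<open>K\<close> of
  solutions, isolated among the non-trivial ones, which meets the trivial branch exactly in
  \<open>I\<^sub>n \<times> {0}\<close>. Near \<open>K\<close> and the trivial branch, the equation reduces to finitely many dimensions:
  there are a projection \<open>P\<close> of finite rank and a family \<open>T\<close> of isomorphisms, defined along \<open>K\<close>, such
  that \<open>T\<close> and \<open>D\<^sub>uF\<close> agree on \<open>ker P\<close>. Homotopy invariance of the degree of the reduced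
  equation shows that \<open>T\<inverse> D\<^sub>uF\<close> at \<open>(\<lambda>\<^sub>-, 0)\<close> and at \<open>(\<lambda>\<^sub>+, 0)\<close> have determinants of equal sign, so
  they lie in the same path component of the group of isomorphisms fixing \<open>ker P\<close>. Hence the
  linearization along the trivial branch is \<open>\<A>\<close>-homotopic to an analytic path of isomorphisms. Such a path has no
  eigenvalues, so its total multiplicity is \<open>0\<close>, contrary to the assumed oddness.
\<close>

subsection \<open>Functionals and projections\<close>

text \<open>The multiplicity never has to be computed: the parity hypothesis covers every admissible
  analytic curve A-homotopic to the linearization, so one curve without spectrum refutes it. The
  work is in producing that curve from the failure of both alternatives, and two obstacles shape it.
  The compact set \<open>K\<close> is an extended object, not a point, so the reduction to finite
  dimensions must hold along all of it at once; \<open>P\<close> must therefore control every kernel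
  over \<open>K\<close> and also be injective on each slice of \<open>K\<close> with fixed
  parameter, so that solutions can be followed through their images under \<open>P\<close>. And
  determinant and degree are needed only to tell two classes apart: the sign is replaced by the
  dichotomy between the path components of the identity and of one reflection, the degree by maps
  induced on relative homology, where these two act differently. The reduced equation has one
  unknown more than it has equations, namely the parameter, so an equation has to be added before a
  degree makes sense.\<close>

definition sublinear :: "('a::real_vector \<Rightarrow> real) \<Rightarrow> bool" where
  "sublinear p \<longleftrightarrow> (\<forall>x y. p (x + y) \<le> p x + p y) \<and> (\<forall>x t. 0 \<le> t \<longrightarrow> p (t *\<^sub>R x) = t * p x)"

lemma sublinear_ge: "sublinear p \<Longrightarrow> - p (- x) \<le> p x"
proof -
  assume p: "sublinear p"
  then have "p (x + - x) \<le> p x + p (- x)" unfolding sublinear_def by blast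
  moreover have "p (0 *\<^sub>R x) = 0 * p x" using p unfolding sublinear_def by blast
  ultimately show ?thesis by simp
qed

text \<open>The infimum of \<open>p (y + t *\<^sub>R x) - t * p x\<close> over
  \<open>t \<ge> 0\<close> pushes \<open>p\<close> down until it is as odd as possible at
  \<open>x\<close>. A minimal sublinear functional cannot be lowered this way, so it is odd and
  hence linear.\<close>

lemma sublinear_reduce:
  fixes p :: "'a::real_vector \<Rightarrow> real"
  assumes p: "sublinear p"
  obtains q where "sublinear q" "\<And>y. q y \<le> p y" "q (- x) \<le> - p x"
proof
  define q where "q y = (INF t\<in>{0..}. p (y + t *\<^sub>R x) - t * p x)" for y
  have p1: "p (a + b) \<le> p a + p b" for a b using p unfolding sublinear_def by blast
  have p2: "0 \<le> t \<Longrightarrow> p (t *\<^sub>R a) = t * p a" for a t using p unfolding sublinear_def by blast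
  \<comment> \<open>A lower bound that does not depend on \<open>t\<close>, so the infimum is
    finite.\<close>
  have low: "- p (- y) \<le> p (y + t *\<^sub>R x) - t * p x" if "0 \<le> t" for y t
    using p1[of "y + t *\<^sub>R x" "- y"] p2[OF that, of x] by simp
  have bdd: "bdd_below ((\<lambda>t. p (y + t *\<^sub>R x) - t * p x) ` {0..})" for y
    using low by (auto intro!: bdd_belowI2)
  have qle: "q y \<le> p (y + t *\<^sub>R x) - t * p x" if "0 \<le> t" for y t
    unfolding q_def using bdd that by (intro cINF_lower) auto
  have qge: "c \<le> q y" if "\<And>t. 0 \<le> t \<Longrightarrow> c \<le> p (y + t *\<^sub>R x) - t * p x" for c y
    unfolding q_def using that by (intro cINF_greatest) auto
  show "q y \<le> p y" for y using qle[of 0 y] by simp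
  show "q (- x) \<le> - p x" using qle[of 1 "- x"] p2[of 0 x] by simp
  have add: "q (y + z) \<le> q y + q z" for y z
  proof -
    have "q (y + z) - (p (y + t *\<^sub>R x) - t * p x) \<le> q z" if t: "0 \<le> t" for t
    proof (rule qge)
      fix s :: real assume s: "0 \<le> s"
      have "q (y + z) \<le> p (y + z + (t + s) *\<^sub>R x) - (t + s) * p x" using s t by (intro qle) auto
      also have "y + z + (t + s) *\<^sub>R x = (y + t *\<^sub>R x) + (z + s *\<^sub>R x)"
        by (simp add: algebra_simps)
      finally show "q (y + z) - (p (y + t *\<^sub>R x) - t * p x) \<le> p (z + s *\<^sub>R x) - s * p x"
        using p1[of "y + t *\<^sub>R x" "z + s *\<^sub>R x"] by (simp add: algebra_simps)
    qed
    then have "q (y + z) - q z \<le> q y" by (intro qge) (simp add: algebra_simps)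
    then show ?thesis by simp
  qed
  have half: "q (c *\<^sub>R y) \<le> c * q y" if c: "0 < c" for c y
  proof -
    have "q (c *\<^sub>R y) / c \<le> q y"
    proof (rule qge)
      fix t :: real assume t: "0 \<le> t"
      have "q (c *\<^sub>R y) \<le> p (c *\<^sub>R y + (c * t) *\<^sub>R x) - (c * t) * p x" using c t by (intro qle) auto
      also have "c *\<^sub>R y + (c * t) *\<^sub>R x = c *\<^sub>R (y + t *\<^sub>R x)" by (simp add: algebra_simps)
      finally show "q (c *\<^sub>R y) / c \<le> p (y + t *\<^sub>R x) - t * p x"
        using c p2[of c "y + t *\<^sub>R x"] by (simp add: field_simps)
    qed
    then show ?thesis using c by (simp add: field_simps)
  qed
  have q0: "q 0 = 0"
  proof (rule antisym)
    show "q 0 \<le> 0" using qle[of 0 0] p2[of 0 0] by simp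
    show "0 \<le> q 0" by (rule qge) (use p2 in auto)
  qed
  have "q (t *\<^sub>R y) = t * q y" if t: "0 \<le> t" for t y
  proof (cases "t = 0")
    case False
    then have t: "0 < t" using t by simp
    have "q (inverse t *\<^sub>R t *\<^sub>R y) \<le> inverse t * q (t *\<^sub>R y)" using t by (intro half) simp
    then have "t * q y \<le> q (t *\<^sub>R y)" using t by (simp add: field_simps)
    then show ?thesis using half[OF t, of y] by simp
  qed (simp add: q0)
  then show "sublinear q" unfolding sublinear_def using add by blast
qed

text \<open>Zorn's lemma yields a minimal sublinear functional below \<open>p0\<close>; by
  \<open>sublinear_reduce\<close> it is linear. Starting from the norm already lowered at
  \<open>u\<close> gives \<open>m (- u) \<le> - norm u\<close>, which keeps \<open>m u\<close> away
  from \<open>0\<close>.\<close>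

theorem Hahn_Banach_nonzero:
  fixes u :: "'a::real_normed_vector"
  assumes "u \<noteq> 0"
  obtains \<phi> :: "'a \<Rightarrow>\<^sub>L real" where "blinfun_apply \<phi> u \<noteq> 0"
proof -
  have "sublinear (norm :: 'a \<Rightarrow> real)" unfolding sublinear_def by (auto simp: norm_triangle_ineq)
  then obtain p0 where p0: "sublinear p0" "\<And>y. p0 y \<le> norm y" "p0 (- u) \<le> - norm u"
    using sublinear_reduce by blast
  define A where "A = {p. sublinear p \<and> p \<le> p0}"
  have "\<exists>m\<in>A. \<forall>a\<in>A. m \<ge> a \<longrightarrow> a = m"
  proof (rule predicate_Zorn)
    show "partial_order_on A (relation_of (\<ge>) A)"
      by (rule partial_order_on_relation_ofI) auto
    fix C assume "C \<in> Chains (relation_of (\<ge>) A)"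
    then have CA: "C \<subseteq> A" and Ch: "\<And>p q. p \<in> C \<Longrightarrow> q \<in> C \<Longrightarrow> p \<le> q \<or> q \<le> p"
      unfolding Chains_def relation_of_def by auto
    show "\<exists>v\<in>A. \<forall>a\<in>C. a \<ge> v"
    proof (cases "C = {}")
      case True then show ?thesis using p0(1) by (auto simp: A_def)
    next
      case False
      \<comment> \<open>The pointwise infimum bounds the chain from below. Subadditivity uses that
        of two members of a chain one is below both, so a single \<open>r\<close> serves both
        arguments.\<close>
      define i where "i x = (INF p\<in>C. p x)" for x
      have low: "- norm x \<le> p x" if "p \<in> C" for p x
      proof -
        have "sublinear p" "p (- x) \<le> p0 (- x)" using that CA by (auto simp: A_def le_fun_def)
        then show ?thesis using sublinear_ge[of p x] p0(2)[of "- x"] by simp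
      qed
      have bdd: "bdd_below ((\<lambda>p. p x) ` C)" for x using low by (auto intro!: bdd_belowI2)
      have ile: "i x \<le> p x" if "p \<in> C" for p x unfolding i_def using bdd that by (intro cINF_lower) auto
      have ige: "c \<le> i x" if "\<And>p. p \<in> C \<Longrightarrow> c \<le> p x" for c x
        unfolding i_def using that False by (intro cINF_greatest) auto
      have 1: "i (x + y) \<le> i x + i y" for x y
      proof -
        have "i (x + y) - p x \<le> i y" if p: "p \<in> C" for p
        proof (rule ige)
          fix q assume q: "q \<in> C"
          obtain r where r: "r \<in> C" "r \<le> p" "r \<le> q" using Ch[OF p q] p q by blast
          then have "r (x + y) \<le> r x + r y" using CA by (auto simp: A_def sublinear_def)
          then show "i (x + y) - p x \<le> q y"
            using ile[OF r(1), of "x + y"] r(2,3) by (auto simp: le_fun_def) (smt (verit))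
        qed
        then have "i (x + y) - i y \<le> i x" by (intro ige) (simp add: algebra_simps)
        then show ?thesis by simp
      qed
      have 2: "i (t *\<^sub>R x) = t * i x" if t: "0 \<le> t" for t x
      proof -
        have *: "p (t *\<^sub>R x) = t * p x" if "p \<in> C" for p using that CA t by (auto simp: A_def sublinear_def)
        have a: "t * i x \<le> i (t *\<^sub>R x)" by (rule ige) (metis * ile t mult_left_mono)
        show ?thesis
        proof (cases "t = 0")
          case True
          obtain p where "p \<in> C" using False by blast
          then show ?thesis using a *[of p] ile[of p "t *\<^sub>R x"] True by simp
        next
          case False
          have "i (t *\<^sub>R x) / t \<le> i x"
          proof (rule ige)
            fix p assume "p \<in> C"
            then show "i (t *\<^sub>R x) / t \<le> p x" using *[of p] ile[of p "t *\<^sub>R x"] t False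
              by (simp add: field_simps)
          qed
          then show ?thesis using a t False by (simp add: field_simps)
        qed
      qed
      obtain p where "p \<in> C" using False by blast
      then have "i \<le> p" "p \<le> p0" using ile CA by (auto simp: A_def intro: le_funI)
      then have "i \<le> p0" by (rule order_trans)
      then have "i \<in> A" using 1 2 by (auto simp: A_def sublinear_def)
      then show ?thesis using ile by (auto simp: le_fun_def)
    qed
  qed
  then obtain m where m: "sublinear m" "m \<le> p0" and min: "\<And>a. sublinear a \<Longrightarrow> a \<le> m \<Longrightarrow> a = m"
    unfolding A_def by (auto intro: order_trans)
  have odd: "m (- x) = - m x" for x
  proof -
    obtain q where "sublinear q" "\<And>y. q y \<le> m y" "q (- x) \<le> - m x"
      using sublinear_reduce[OF m(1)] by blast
    then have "m (- x) \<le> - m x" using min[of q] by (auto simp: le_fun_def)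
    then show ?thesis using sublinear_ge[OF m(1), of x] by simp
  qed
  have add: "m (x + y) = m x + m y" for x y
  proof -
    have "m (x + y) \<le> m x + m y" "m (- x + - y) \<le> m (- x) + m (- y)"
      using m(1) unfolding sublinear_def by blast+
    then show ?thesis using odd[of x] odd[of y] odd[of "x + y"] by simp
  qed
  have scl: "m (t *\<^sub>R x) = t * m x" for t x
  proof (cases "0 \<le> t")
    case False
    then have "m ((- t) *\<^sub>R x) = (- t) * m x" using m(1) unfolding sublinear_def by (meson neg_0_le_iff_le nle_le)
    then show ?thesis using odd[of "t *\<^sub>R x"] by simp
  qed (use m(1) in \<open>auto simp: sublinear_def\<close>)
  have "bounded_linear m"
  proof (rule bounded_linear_intro[where K = 1])
    fix x
    have "m x \<le> norm x" "m (- x) \<le> norm (- x)"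
      using m(2) p0(2) by (metis le_fun_def order_trans)+
    then show "norm (m x) \<le> norm x * 1" using odd[of x] by simp
  qed (auto simp: add scl)
  moreover have "m u \<noteq> 0"
  proof -
    have "m (- u) \<le> - norm u" using m(2) p0(3) by (metis le_fun_def order_trans)
    then show ?thesis using odd[of u] assms by auto
  qed
  ultimately show ?thesis using that[of "Blinfun m"] by (simp add: bounded_linear_Blinfun_apply)
qed

text \<open>Gram-Schmidt on functionals: a functional that does not vanish on
  \<open>b - p b\<close>, with \<open>p\<close> the projection to \<open>span B\<close>, becomes
  dual to \<open>b\<close> after composition with \<open>id - p\<close>; the old functionals are
  then corrected by its multiples.\<close>

lemma dual_basis:
  fixes B :: "'a::real_normed_vector set"
  assumes "finite B" "independent B"
  obtains \<phi> :: "'a \<Rightarrow> 'a \<Rightarrow>\<^sub>L real" where "\<And>b c. b \<in> B \<Longrightarrow> c \<in> B \<Longrightarrow> \<phi> b c = (if b = c then 1 else 0)"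
proof -
  have "\<exists>\<phi> :: 'a \<Rightarrow> 'a \<Rightarrow>\<^sub>L real. \<forall>b\<in>B. \<forall>c\<in>B. \<phi> b c = (if b = c then 1 else 0)"
    using assms
  proof (induction B)
    case (insert b B)
    then obtain \<phi> :: "'a \<Rightarrow> 'a \<Rightarrow>\<^sub>L real" where \<phi>: "\<And>c d. c \<in> B \<Longrightarrow> d \<in> B \<Longrightarrow> \<phi> c d = (if c = d then 1 else 0)"
      by (auto simp: independent_insert)
    define p where "p u = (\<Sum>c\<in>B. \<phi> c u *\<^sub>R c)" for u
    have pB: "p d = d" if "d \<in> B" for d
    proof -
      have "p d = (\<Sum>c\<in>B. if c = d then d else 0)" unfolding p_def using \<phi> that by (intro sum.cong) auto
      then show ?thesis using that insert.hyps by simp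
    qed
    have "p b \<in> span B" unfolding p_def by (intro span_sum span_scale span_base)
    then have nz: "b - p b \<noteq> 0" using insert.prems insert.hyps by (auto simp: independent_insert)
    then obtain \<psi> :: "'a \<Rightarrow>\<^sub>L real" where \<psi>: "\<psi> (b - p b) \<noteq> 0" by (rule Hahn_Banach_nonzero)
    have blp: "bounded_linear p" unfolding p_def
      by (intro bounded_linear_sum bounded_linear_scaleR_left bounded_linear_compose[OF bounded_linear_scaleR_left] blinfun.bounded_linear_right)
    define \<eta> :: "'a \<Rightarrow>\<^sub>L real" where "\<eta> = (1 / \<psi> (b - p b)) *\<^sub>R (\<psi> o\<^sub>L (id_blinfun - Blinfun p))"
    have chi: "\<eta> u = \<psi> (u - p u) / \<psi> (b - p b)" for u
      by (simp add: \<eta>_def blinfun.bilinear_simps bounded_linear_Blinfun_apply[OF blp])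
    have c1: "\<eta> b = 1" "\<And>d. d \<in> B \<Longrightarrow> \<eta> d = 0"
      using \<psi> by (simp_all add: chi pB blinfun.zero_right)
    define \<phi>' where "\<phi>' c = (if c = b then \<eta> else \<phi> c - (\<phi> c b) *\<^sub>R \<eta>)" for c
    have "\<phi>' c d = (if c = d then 1 else 0)" if "c \<in> insert b B" "d \<in> insert b B" for c d
      using that c1 \<phi> insert.hyps by (auto simp: \<phi>'_def blinfun.bilinear_simps)
    then show ?case by blast
  qed simp
  then show ?thesis using that by blast
qed

text \<open>Each functional that is not zero on the current kernel adds one dimension to the range,
  spanned by a kernel vector \<open>e\<close> with value \<open>1\<close>. All later demands on
  \<open>P\<close> are collected as finitely many functionals that have to vanish on its
  kernel.\<close>

lemma finite_codim_projection:
  fixes \<Psi> :: "('a::real_normed_vector \<Rightarrow>\<^sub>L real) set"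
  assumes "finite \<Psi>"
  obtains P :: "'a \<Rightarrow>\<^sub>L 'a" where "P o\<^sub>L P = P" "finite_dim (range P)"
    "\<And>u. P u = 0 \<longleftrightarrow> (\<forall>\<psi>\<in>\<Psi>. \<psi> u = 0)"
proof -
  have "\<exists>P::'a \<Rightarrow>\<^sub>L 'a. P o\<^sub>L P = P \<and> finite_dim (range P) \<and> (\<forall>u. P u = 0 \<longleftrightarrow> (\<forall>\<psi>\<in>\<Psi>. \<psi> u = 0))"
    using assms
  proof (induction \<Psi>)
    case empty
    show ?case by (intro exI[of _ 0]) (auto simp: finite_dim_def intro: exI[of _ "{}"])
  next
    case (insert \<psi> \<Psi>)
    then obtain P :: "'a \<Rightarrow>\<^sub>L 'a" where P: "P o\<^sub>L P = P" "finite_dim (range P)"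
      "\<And>u. P u = 0 \<longleftrightarrow> (\<forall>\<psi>\<in>\<Psi>. \<psi> u = 0)" by blast
    have PP: "P (P u) = P u" for u using P(1) by (metis blinfun_apply_blinfun_compose)
    show ?case
    proof (cases "\<forall>u. P u = 0 \<longrightarrow> \<psi> u = 0")
      case True
      then show ?thesis using P by (intro exI[of _ P]) auto
    next
      case False
      then obtain e0 where e0: "P e0 = 0" "\<psi> e0 \<noteq> 0" by blast
      define e where "e = (1 / \<psi> e0) *\<^sub>R e0"
      have e: "P e = 0" "\<psi> e = 1" using e0 by (auto simp: e_def blinfun.bilinear_simps)
      define Q where "Q = P + (blinfun_scaleR_left e o\<^sub>L (\<psi> o\<^sub>L (id_blinfun - P)))"
      have Q: "Q u = P u + (\<psi> u - \<psi> (P u)) *\<^sub>R e" for u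
        by (simp add: Q_def blinfun.bilinear_simps)
      have PQ: "P (Q u) = P u" for u by (simp add: Q blinfun.bilinear_simps PP e)
      have "Q o\<^sub>L Q = Q"
        by (rule blinfun_eqI) (simp add: Q blinfun.bilinear_simps PP e)
      moreover have "finite_dim (range Q)"
      proof -
        obtain B where "finite B" "range P \<subseteq> span B" using P(2) by (auto simp: finite_dim_def)
        then have "range Q \<subseteq> span (insert e B)"
          by (auto simp: Q) (meson rangeI span_add span_base span_mono span_scale subset_insertI insertI1 subset_iff)
        then show ?thesis using \<open>finite B\<close> unfolding finite_dim_def by blast
      qed
      moreover have "Q u = 0 \<longleftrightarrow> (\<forall>\<psi>\<in>insert \<psi> \<Psi>. \<psi> u = 0)" for u
      proof
        assume "Q u = 0"
        then have "P u = 0" using PQ[of u] by (simp add: blinfun.zero_right)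
        then have "\<psi> u *\<^sub>R e = 0" using \<open>Q u = 0\<close> by (simp add: Q blinfun.zero_right)
        then have "\<psi> u = 0" using e by (auto simp: blinfun.zero_right)
        then show "\<forall>\<psi>\<in>insert \<psi> \<Psi>. \<psi> u = 0" using \<open>P u = 0\<close> P(3) by auto
      next
        assume "\<forall>\<psi>\<in>insert \<psi> \<Psi>. \<psi> u = 0"
        moreover then have "P u = 0" using P(3) by auto
        ultimately show "Q u = 0" by (simp add: Q blinfun.zero_right)
      qed
      ultimately show ?thesis by blast
    qed
  qed
  then show ?thesis using that by blast
qed

subsection \<open>Isomorphisms\<close>

text \<open>Open mapping theorem in quantitative form. By Baire, the closure of the image of some
  ball contains a ball; approximate solutions with geometrically decreasing residuals then add up to
  an exact one.\<close>

lemma bounded_linear_bij_bounded_below: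
  fixes A :: "'u::banach \<Rightarrow>\<^sub>L 'v::banach"
  assumes bij: "bij (blinfun_apply A)"
  obtains c where "0 < c" "\<And>x. norm x \<le> c * norm (A x)"
proof -
  define T where "T n = closure (blinfun_apply A ` cball 0 (real n))" for n
  have "\<exists>n. interior (T n) \<noteq> {}"
  proof (rule ccontr)
    assume "\<not> ?thesis"
    then have "euclidean interior_of \<Union>(range T) = {}"
      by (intro Baire_category_alt) (auto simp: completely_metrizable_space_euclidean T_def)
    moreover have "\<Union>(range T) = (UNIV :: 'v set)"
    proof (rule equalityI[OF subset_UNIV], rule subsetI)
      fix v :: 'v
      obtain x where x: "A x = v" using bij by (metis bij_pointE)
      obtain n where "norm x \<le> real n" using real_arch_simple by blast
      then have "v \<in> T n" unfolding T_def using x by (intro subsetD[OF closure_subset]) auto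
      then show "v \<in> \<Union>(range T)" by blast
    qed
    ultimately show False by simp
  qed
  then obtain n v0 where "v0 \<in> interior (T n)" by blast
  then obtain \<rho> where \<rho>: "0 < \<rho>" "ball v0 \<rho> \<subseteq> T n" by (meson mem_interior)
  have near: "\<exists>x. norm x \<le> 2 * real n \<and> norm (v - A x) < e" if v: "norm v < \<rho>" and e: "0 < e" for v e
  proof -
    have vT: "v0 + v \<in> T n" "v0 \<in> T n" using \<rho> v by (auto simp: dist_norm)
    have ap: "\<exists>a. norm a \<le> real n \<and> dist (A a) w < e / 2" if "w \<in> T n" for w
    proof -
      have "0 < e / 2" using e by simp
      from that[unfolded T_def closure_approachable, rule_format, OF this]
      show ?thesis by (elim bexE imageE) (auto simp: mem_cball)
    qed
    \<comment> \<open>Subtracting two approximate preimages recentres the ball from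
      \<open>v0\<close> to \<open>0\<close>, at the price of the factor \<open>2\<close> in the
      norm.\<close>
    obtain a where a: "norm a \<le> real n" "dist (A a) (v0 + v) < e / 2" using ap[OF vT(1)] by (elim exE conjE) (rule that)
    obtain b where b: "norm b \<le> real n" "dist (A b) v0 < e / 2" using ap[OF vT(2)] by (elim exE conjE) (rule that)
    have "v - A (a - b) = (v0 + v - A a) + (A b - v0)" by (simp add: blinfun.bilinear_simps)
    then have "norm (v - A (a - b)) \<le> norm (v0 + v - A a) + norm (A b - v0)"
      by (simp only: norm_triangle_ineq)
    then show ?thesis using a b norm_triangle_ineq4[of a b]
      by (intro exI[of _ "a - b"]) (auto simp: dist_norm norm_minus_commute)
  qed
  \<comment> \<open>Rescaling \<open>v\<close> to norm \<open>\<rho> / 2\<close> costs the factor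
    \<open>2 * norm v / \<rho>\<close> on top of the bound \<open>2 * real n\<close>; the summand
    \<open>1\<close> keeps \<open>M\<close> positive when \<open>n = 0\<close>.\<close>
  define M where "M = 4 * (real n + 1) / \<rho>"
  have M: "0 < M" using \<rho> by (simp add: M_def)
  have step: "\<exists>x. norm x \<le> M * norm v \<and> norm (v - A x) \<le> norm v / 2" for v
  proof (cases "v = 0")
    case False
    define k where "k = \<rho> / (2 * norm v)"
    have k: "0 < k" using \<rho> False by (simp add: k_def)
    have "norm (k *\<^sub>R v) < \<rho>" using \<rho> False by (simp add: k_def)
    then obtain x where x: "norm x \<le> 2 * real n" "norm (k *\<^sub>R v - A x) < k * norm v / 2"
      using near[of "k *\<^sub>R v" "k * norm v / 2"] k False by auto
    have "v - A ((1 / k) *\<^sub>R x) = (1 / k) *\<^sub>R (k *\<^sub>R v - A x)" using k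
      by (simp add: blinfun.bilinear_simps algebra_simps)
    then have "norm (v - A ((1 / k) *\<^sub>R x)) = norm (k *\<^sub>R v - A x) / k" using k by simp
    also have "\<dots> \<le> norm v / 2" using x(2) k by (simp add: field_simps)
    finally have 2: "norm (v - A ((1 / k) *\<^sub>R x)) \<le> norm v / 2" .
    have "norm ((1 / k) *\<^sub>R x) = norm x / k" using k by simp
    also have "\<dots> \<le> 2 * (real n + 1) / k" using x(1) k by (intro divide_right_mono) auto
    also have "\<dots> = M * norm v" using False \<rho> by (simp add: k_def M_def field_simps)
    finally show ?thesis using 2 by blast
  qed (intro exI[of _ 0], simp add: blinfun.zero_right)
  then obtain g where g: "\<And>v. norm (g v) \<le> M * norm v" "\<And>v. norm (v - A (g v)) \<le> norm v / 2" by metis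
  have "norm x \<le> 2 * M * norm (A x)" for x
  proof -
    \<comment> \<open>\<open>w k\<close> is the residual after \<open>k\<close> corrections; it
      halves each time, so the corrections \<open>g (w k)\<close> are summable and their sum is
      mapped to \<open>A x\<close>.\<close>
    define w where "w = rec_nat (A x) (\<lambda>_ v. v - A (g v))"
    have w: "w 0 = A x" "\<And>k. w (Suc k) = w k - A (g (w k))" by (auto simp: w_def)
    have wn: "norm (w k) \<le> norm (A x) * (1 / 2) ^ k" for k
    proof (induction k)
      case (Suc k)
      then show ?case using g(2)[of "w k"] by (simp add: w)
    qed (simp add: w)
    have gn: "norm (g (w k)) \<le> M * norm (A x) * (1 / 2) ^ k" for k
    proof -
      have "norm (g (w k)) \<le> M * norm (w k)" by (rule g(1))
      also have "\<dots> \<le> M * (norm (A x) * (1 / 2) ^ k)" using wn M by (intro mult_left_mono) auto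
      finally show ?thesis by (simp add: mult.assoc)
    qed
    have geo: "summable (\<lambda>k. M * norm (A x) * (1 / 2) ^ k :: real)" by (intro summable_mult summable_geometric) simp
    have sm: "summable (\<lambda>k. g (w k))" by (rule summable_comparison_test'[OF geo, of 0]) (use gn in auto)
    define y where "y = suminf (\<lambda>k. g (w k))"
    have wsum: "w k = A x - A (\<Sum>j<k. g (w j))" for k
      by (induction k) (auto simp: w blinfun.bilinear_simps)
    have "(\<lambda>k. A x - A (\<Sum>j<k. g (w j))) \<longlonglongrightarrow> A x - A y"
      using summable_LIMSEQ[OF sm] unfolding y_def
      by (intro tendsto_diff tendsto_const bounded_linear.tendsto[OF blinfun.bounded_linear_right])
    moreover have "w \<longlonglongrightarrow> 0"
    proof (rule Lim_null_comparison)
      show "\<forall>\<^sub>F k in sequentially. norm (w k) \<le> norm (A x) * (1 / 2) ^ k" using wn by simp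
      show "(\<lambda>k. norm (A x) * (1 / 2) ^ k :: real) \<longlonglongrightarrow> 0"
        by (intro tendsto_mult_right_zero LIMSEQ_power_zero) simp
    qed
    moreover have "w = (\<lambda>k. A x - A (\<Sum>j<k. g (w j)))" using wsum by (rule ext)
    ultimately have "A x - A y = 0" using LIMSEQ_unique by metis
    then have "x = y" using bij by (simp add: bij_def inj_eq)
    also have "norm y \<le> suminf (\<lambda>k. M * norm (A x) * (1 / 2) ^ k)" unfolding y_def
      by (rule norm_suminf_le[OF gn geo])
    also have "\<dots> = M * norm (A x) * 2" by (subst suminf_mult) (auto simp: summable_geometric suminf_geometric)
    finally show ?thesis by (simp add: mult_ac)
  qed
  then show ?thesis using that[of "2 * M"] M by simp
qed

lemma GL_iff_bij:
  fixes A :: "'u::banach \<Rightarrow>\<^sub>L 'v::banach"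
  shows "A \<in> GL \<longleftrightarrow> bij (blinfun_apply A)"
proof
  assume "A \<in> GL"
  then obtain B where "A o\<^sub>L B = id_blinfun" "B o\<^sub>L A = id_blinfun" by (auto simp: GL_def)
  then have "\<And>x. A (B x) = x" "\<And>x. B (A x) = x"
    by (metis blinfun_apply_blinfun_compose blinfun_apply_id_blinfun)+
  then show "bij (blinfun_apply A)" by (intro bijI injI surjI[where f = "blinfun_apply B"]) metis+
next
  assume bij: "bij (blinfun_apply A)"
  obtain c where c: "0 < c" "\<And>x. norm x \<le> c * norm (A x)"
    using bounded_linear_bij_bounded_below[OF bij] by blast
  define g where "g = inv_into UNIV (blinfun_apply A)"
  have Ag: "A (g v) = v" and gA: "g (A x) = x" for v x
    using bij by (auto simp: g_def bij_def surj_f_inv_f)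
  have Ainj: "x = y" if "A x = A y" for x y using bij that by (auto simp: bij_def inj_def)
  have "bounded_linear g"
  proof (rule bounded_linear_intro[where K = c])
    show "g (v + w) = g v + g w" for v w by (rule Ainj) (simp add: Ag blinfun.add_right)
    show "g (t *\<^sub>R v) = t *\<^sub>R g v" for t v by (rule Ainj) (simp add: Ag blinfun.scaleR_right)
    show "norm (g v) \<le> norm v * c" for v using c(2)[of "g v"] by (simp add: Ag mult.commute)
  qed
  then show "A \<in> GL" unfolding GL_def
    by (intro CollectI exI[of _ "Blinfun g"] conjI blinfun_eqI) (simp_all add: bounded_linear_Blinfun_apply Ag gA)
qed

lemma
  assumes "A \<in> GL"
  shows blinfun_inv_right [simp]: "A (blinfun_inv A v) = v"
    and blinfun_inv_left [simp]: "blinfun_inv A (A u) = u"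
    and blinfun_inv_compose_right: "A o\<^sub>L blinfun_inv A = id_blinfun"
    and blinfun_inv_compose_left: "blinfun_inv A o\<^sub>L A = id_blinfun"
proof -
  obtain B where B: "A o\<^sub>L B = id_blinfun" "B o\<^sub>L A = id_blinfun" using assms by (auto simp: GL_def)
  have "blinfun_inv A = B" unfolding blinfun_inv_def
  proof (rule the_equality)
    fix C assume C: "A o\<^sub>L C = id_blinfun \<and> C o\<^sub>L A = id_blinfun"
    show "C = B"
    proof (rule blinfun_eqI)
      fix v
      have "C v = B (A (C v))" using B(2) by (metis blinfun_apply_blinfun_compose blinfun_apply_id_blinfun)
      also have "A (C v) = v" using C by (metis blinfun_apply_blinfun_compose blinfun_apply_id_blinfun)
      finally show "C v = B v" .
    qed
  qed (use B in simp)
  then show a: "A o\<^sub>L blinfun_inv A = id_blinfun" and b: "blinfun_inv A o\<^sub>L A = id_blinfun" using B by auto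
  show "A (blinfun_inv A v) = v" using a by (metis blinfun_apply_blinfun_compose blinfun_apply_id_blinfun)
  show "blinfun_inv A (A u) = u" using b by (metis blinfun_apply_blinfun_compose blinfun_apply_id_blinfun)
qed

lemma blinfun_inv_GL: "A \<in> GL \<Longrightarrow> blinfun_inv A \<in> GL"
  unfolding GL_def
  using blinfun_inv_compose_left blinfun_inv_compose_right GL_def by blast

lemma GL_compose:
  assumes "A \<in> GL" "B \<in> GL"
  shows "A o\<^sub>L B \<in> GL"
  unfolding GL_def using assms
  by (intro CollectI exI[of _ "blinfun_inv B o\<^sub>L blinfun_inv A"] conjI blinfun_eqI) simp_all

text \<open>\<open>B x = v\<close> is the fixed point equation of
  \<open>x \<mapsto> A\<inverse> v - A\<inverse> ((B - A) x)\<close>, a contraction under the stated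
  bound.\<close>

lemma GL_perturb:
  fixes A B :: "'u::banach \<Rightarrow>\<^sub>L 'v::banach"
  assumes A: "A \<in> GL" and lt: "norm (B - A) * norm (blinfun_inv A) < 1"
  shows "B \<in> GL"
proof -
  let ?C = "blinfun_inv A"
  have "\<exists>!x. B x = v" for v
  proof -
    define f where "f x = ?C v - ?C ((B - A) x)" for x
    have eq: "f x = x \<longleftrightarrow> B x = v" for x
    proof
      assume "f x = x"
      then have "A (f x) = A x" by simp
      then show "B x = v" using A by (simp add: f_def blinfun.bilinear_simps)
    next
      assume "B x = v"
      then show "f x = x" using A by (auto simp: f_def blinfun.bilinear_simps)
    qed
    have "\<exists>!x. f x = x"
    proof (rule banach_fix_type[where c = "norm (B - A) * norm ?C"])
      show "\<forall>x y. dist (f x) (f y) \<le> norm (B - A) * norm ?C * dist x y"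
      proof (intro allI)
        fix x y
        have "f x - f y = ?C ((B - A) (y - x))" by (simp add: f_def blinfun.bilinear_simps)
        then have "norm (f x - f y) \<le> norm ?C * (norm (B - A) * norm (y - x))"
          using norm_blinfun[of ?C "(B - A) (y - x)"] mult_left_mono[OF norm_blinfun[of "B - A" "y - x"] norm_ge_zero[of ?C]]
          by simp
        then show "dist (f x) (f y) \<le> norm (B - A) * norm ?C * dist x y"
          by (simp add: dist_norm norm_minus_commute mult_ac)
      qed
    qed (use lt in auto)
    then show ?thesis unfolding eq .
  qed
  then have "bij (blinfun_apply B)" by (simp add: bij_iff)
  then show ?thesis by (simp add: GL_iff_bij)
qed

lemma open_GL: "open (GL :: ('u::banach \<Rightarrow>\<^sub>L 'v::banach) set)"
  unfolding open_dist
proof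
  fix A :: "'u \<Rightarrow>\<^sub>L 'v" assume A: "A \<in> GL"
  show "\<exists>e>0. \<forall>B. dist B A < e \<longrightarrow> B \<in> GL"
  proof (intro exI conjI allI impI)
    show "0 < 1 / (norm (blinfun_inv A) + 1)" by (simp add: add_nonneg_pos)
    fix B assume d: "dist B A < 1 / (norm (blinfun_inv A) + 1)"
    then have "norm (B - A) * (norm (blinfun_inv A) + 1) < 1"
      using norm_ge_zero[of "blinfun_inv A"] by (simp add: dist_norm field_simps)
    moreover have "norm (B - A) * norm (blinfun_inv A) \<le> norm (B - A) * (norm (blinfun_inv A) + 1)"
      by (intro mult_left_mono) auto
    ultimately show "B \<in> GL" by (intro GL_perturb[OF A]) linarith
  qed
qed

lemma continuous_on_blinfun_inv:
  "continuous_on GL (blinfun_inv :: ('u::banach \<Rightarrow>\<^sub>L 'v::banach) \<Rightarrow> _)"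
  unfolding continuous_on_def
proof
  fix A :: "'u \<Rightarrow>\<^sub>L 'v" assume A: "A \<in> GL"
  let ?C = "blinfun_inv A"
  define c where "c = norm ?C"
  have est: "norm (blinfun_inv B - ?C) \<le> 2 * c * c * norm (B - A)" if B: "B \<in> GL" and s: "norm (B - A) * c \<le> 1 / 2" for B
  proof -
    let ?D = "blinfun_inv B"
    \<comment> \<open>Resolvent identity. Together with \<open>s\<close> it first bounds the norm of
      \<open>?D\<close> by \<open>2 * c\<close> and then gives a Lipschitz estimate.\<close>
    have id: "?D - ?C = ?D o\<^sub>L (A - B) o\<^sub>L ?C" using A B
      by (intro blinfun_eqI) (simp add: blinfun.bilinear_simps)
    have le: "norm (?D - ?C) \<le> norm ?D * (norm (B - A) * c)"
    proof -
      have "norm (?D o\<^sub>L (A - B) o\<^sub>L ?C) \<le> norm (?D o\<^sub>L (A - B)) * c" unfolding c_def by (rule norm_blinfun_compose)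
      also have "\<dots> \<le> norm ?D * norm (A - B) * c"
        by (intro mult_right_mono norm_blinfun_compose) (simp add: c_def)
      finally show ?thesis unfolding id by (simp add: norm_minus_commute mult.assoc)
    qed
    also have "\<dots> \<le> norm ?D * (1 / 2)" using s by (intro mult_left_mono) auto
    finally have "norm ?D \<le> 2 * c" using norm_triangle_ineq2[of ?D ?C] by (simp add: c_def)
    then have "norm ?D * (norm (B - A) * c) \<le> 2 * c * (norm (B - A) * c)"
      by (intro mult_right_mono) (auto simp: c_def)
    then show ?thesis using le by (simp add: mult_ac)
  qed
  have lim0: "((\<lambda>B. norm (B - A)) \<longlongrightarrow> 0) (at A within GL)"
    by (rule tendsto_norm_zero) (intro LIM_zero tendsto_ident_at)
  have "((\<lambda>B. norm (B - A) * c) \<longlongrightarrow> 0) (at A within GL)" using lim0 by (rule tendsto_mult_left_zero)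
  then have "\<forall>\<^sub>F B in at A within GL. norm (B - A) * c < 1 / 2" by (rule order_tendstoD) simp
  moreover have "\<forall>\<^sub>F B in at A within GL. B \<in> GL" by (simp add: eventually_at_filter)
  ultimately have "\<forall>\<^sub>F B in at A within GL. norm (blinfun_inv B - ?C) \<le> 2 * c * c * norm (B - A)"
    by eventually_elim (use est in auto)
  then have "((\<lambda>B. blinfun_inv B - ?C) \<longlongrightarrow> 0) (at A within GL)"
    by (rule Lim_null_comparison) (use lim0 in \<open>rule tendsto_mult_right_zero\<close>)
  then show "(blinfun_inv \<longlongrightarrow> ?C) (at A within GL)" by (rule LIM_zero_cancel)
qed

lemma continuous_on_inv_comp:
  fixes T :: "'x::topological_space \<Rightarrow> ('u::banach \<Rightarrow>\<^sub>L 'v::banach)"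
  assumes "continuous_on S T" "T ` S \<subseteq> GL"
  shows "continuous_on S (\<lambda>z. blinfun_inv (T z))"
  using continuous_on_compose2[OF continuous_on_blinfun_inv assms] .

lemma linear_blinfun [simp]: "linear (blinfun_apply A)"
  by (simp add: bounded_linear.linear blinfun.bounded_linear_right)

subsection \<open>Fredholm operators of index zero\<close>

lemma finite_dim_basis:
  assumes "finite_dim W"
  obtains B where "B \<subseteq> W" "finite B" "independent B" "W \<subseteq> span B" "card B = dim W"
proof -
  obtain B where B: "B \<subseteq> W" "independent B" "W \<subseteq> span B" "card B = dim W" by (rule basis_exists)
  obtain D where "finite D" "W \<subseteq> span D" using assms by (auto simp: finite_dim_def)
  then have "finite B" using independent_span_bound[of D B] B by blast
  then show ?thesis using that B by blast
qed

lemma finite_independent_spans: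
  assumes "finite B" "independent C" "C \<subseteq> span B" "card B \<le> card C"
  shows "span B \<subseteq> span C"
proof
  fix x assume x: "x \<in> span B"
  show "x \<in> span C"
  proof (rule ccontr)
    assume "x \<notin> span C"
    then have "independent (insert x C)" "x \<notin> C" using assms(2) by (auto simp: independent_insert span_base)
    moreover have "finite C" using independent_span_bound assms by blast
    moreover have "insert x C \<subseteq> span B" using x assms(3) by blast
    ultimately have "card (insert x C) \<le> card B" "card (insert x C) = Suc (card C)"
      using independent_span_bound[OF assms(1), of "insert x C"] by auto
    then show False using assms(4) by simp
  qed
qed

lemma dual_basis_expand:
  fixes \<phi> :: "'a::real_normed_vector \<Rightarrow> 'a \<Rightarrow>\<^sub>L real"
  assumes "finite B" "\<And>b c. b \<in> B \<Longrightarrow> c \<in> B \<Longrightarrow> \<phi> b c = (if b = c then 1 else 0)" "x \<in> span B"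
  shows "x = (\<Sum>b\<in>B. \<phi> b x *\<^sub>R b)"
  using assms(3)
proof (induction rule: span_induct_alt)
  case (step c b y)
  have "(\<Sum>d\<in>B. \<phi> d (c *\<^sub>R b + y) *\<^sub>R d) = (\<Sum>d\<in>B. (if d = b then c *\<^sub>R b else 0) + \<phi> d y *\<^sub>R d)"
    using assms(2) step(1) by (intro sum.cong) (auto simp: blinfun.bilinear_simps algebra_simps)
  also have "\<dots> = c *\<^sub>R b + y" using step assms(1) by (simp add: sum.distrib)
  finally show ?case by simp
qed (simp add: blinfun.zero_right)

lemma independent_span_Int_Diff:
  fixes C :: "'a::real_normed_vector set"
  assumes "finite C" "independent C" "D \<subseteq> C" "y \<in> span D" "y \<in> span (C - D)"
  shows "y = 0"
proof -
  obtain \<phi> :: "'a \<Rightarrow> 'a \<Rightarrow>\<^sub>L real" where \<phi>: "\<And>b c. b \<in> C \<Longrightarrow> c \<in> C \<Longrightarrow> \<phi> b c = (if b = c then 1 else 0)"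
    using dual_basis[OF assms(1,2)] by blast
  have van: "\<phi> c z = 0" if "c \<in> C" "c \<notin> E" "E \<subseteq> C" "z \<in> span E" for c z E
    using that(4)
  proof (induction rule: span_induct_alt)
    case (step a b y)
    then have "\<phi> c b = 0" using \<phi>[of c b] that by auto
    then show ?case using step by (simp add: blinfun.bilinear_simps)
  qed (simp add: blinfun.zero_right)
  have "\<phi> c y = 0" if "c \<in> C" for c
    using van[OF that, of D y] van[OF that, of "C - D" y] assms that by (cases "c \<in> D") auto
  moreover have "y \<in> span C" using assms span_mono by blast
  ultimately show ?thesis using dual_basis_expand[of C \<phi> y] \<phi> assms(1) by simp
qed

lemma independent_linear_image:
  assumes "linear g" "independent B" "\<And>x. x \<in> span B \<Longrightarrow> g x = 0 \<Longrightarrow> x = 0"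
  shows "independent (g ` B)" "inj_on g B"
proof -
  have inj: "inj_on g (span B)"
  proof (rule inj_onI)
    fix x y assume "x \<in> span B" "y \<in> span B" "g x = g y"
    then have "x - y = 0" using assms(3)[of "x - y"] linear_diff[OF assms(1), of x y] by (auto simp: span_diff)
    then show "x = y" by simp
  qed
  show "inj_on g B" using inj by (rule inj_on_subset) (simp add: span_superset)
  show "independent (g ` B)" using assms(1,2) inj by (rule linear_independent_injective_image)
qed

lemma alg_complement_sum: "alg_complement S W \<Longrightarrow> \<exists>x\<in>S. \<exists>w\<in>W. v = x + w"
  by (simp add: alg_complement_def)

lemma alg_complement_Int: "alg_complement S W \<Longrightarrow> x \<in> S \<Longrightarrow> x \<in> W \<Longrightarrow> x = 0"
  by (auto simp: alg_complement_def)

text \<open>The projection \<open>g\<close> onto \<open>W2\<close> along \<open>S\<close> is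
  injective on \<open>W1\<close>, because its kernel lies in \<open>S\<close> and \<open>S\<close>
  meets \<open>W1\<close> only in \<open>0\<close>. Used in both directions it makes
  \<open>codim\<close> well defined.\<close>

lemma alg_complement_dim_le:
  fixes S :: "'a::real_vector set"
  assumes S: "subspace S" and 1: "alg_complement S W1" and 2: "alg_complement S W2"
    and fin: "finite_dim W1" "finite_dim W2"
  shows "dim W1 \<le> dim W2"
proof -
  have sub: "subspace W1" "subspace W2" using 1 2 by (auto simp: alg_complement_def)
  have uni: "w = w'" if "w \<in> W2" "w' \<in> W2" "v - w \<in> S" "v - w' \<in> S" for v w w'
  proof -
    have "(v - w') - (v - w) \<in> S" using that S subspace_diff by blast
    moreover have "w - w' \<in> W2" using that sub subspace_diff by blast
    ultimately have "w - w' = 0" using alg_complement_Int[OF 2, of "w - w'"] by simp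
    then show ?thesis by simp
  qed
  have ex: "\<exists>w. w \<in> W2 \<and> v - w \<in> S" for v
  proof -
    obtain x w where "x \<in> S" "w \<in> W2" "v = x + w" using alg_complement_sum[OF 2, of v] by (elim bexE) (rule that)
    then show ?thesis by (intro exI[of _ w]) auto
  qed
  then obtain g where g: "\<And>v. g v \<in> W2" "\<And>v. v - g v \<in> S" by metis
  have lin: "linear g"
  proof
    fix a b :: 'a and c :: real
    show "g (a + b) = g a + g b"
    proof (rule uni[of _ _ "a + b"])
      show "g a + g b \<in> W2" using g sub subspace_add by blast
      have "(a - g a) + (b - g b) \<in> S" using g S subspace_add by blast
      then show "a + b - (g a + g b) \<in> S" by (simp add: algebra_simps)
    qed (use g in auto)
    show "g (c *\<^sub>R a) = c *\<^sub>R g a"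
    proof (rule uni[of _ _ "c *\<^sub>R a"])
      show "c *\<^sub>R g a \<in> W2" using g sub subspace_scale by blast
      have "c *\<^sub>R (a - g a) \<in> S" using g S subspace_scale by blast
      then show "c *\<^sub>R a - c *\<^sub>R g a \<in> S" by (simp add: algebra_simps)
    qed (use g in auto)
  qed
  obtain B1 where B1: "B1 \<subseteq> W1" "finite B1" "independent B1" "W1 \<subseteq> span B1" "card B1 = dim W1"
    using finite_dim_basis[OF fin(1)] .
  obtain B2 where B2: "B2 \<subseteq> W2" "finite B2" "independent B2" "W2 \<subseteq> span B2" "card B2 = dim W2"
    using finite_dim_basis[OF fin(2)] .
  have "x = 0" if "x \<in> span B1" "g x = 0" for x
  proof -
    have "x \<in> W1" using that B1 sub span_minimal by blast
    moreover have "x \<in> S" using g(2)[of x] that by simp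
    ultimately show ?thesis using alg_complement_Int[OF 1] by simp
  qed
  note im = independent_linear_image[OF lin B1(3) this]
  have "card (g ` B1) \<le> card B2" using independent_span_bound[OF B2(2) im(1)] g B2 by blast
  then show ?thesis using im(2) B1 B2 by (simp add: card_image)
qed

lemma codim_eq:
  assumes "subspace S" "alg_complement S W" "finite_dim W"
  shows "codim S = dim W"
  unfolding codim_def
proof (rule the_equality)
  fix d assume "\<exists>W'. alg_complement S W' \<and> finite_dim W' \<and> d = dim W'"
  then show "d = dim W" using alg_complement_dim_le assms by (metis le_antisym)
qed (use assms in blast)

section \<open>Operators of index zero and finite-rank perturbations\<close>

lemma Phi0_I:
  fixes A :: "'u::real_normed_vector \<Rightarrow>\<^sub>L 'v::real_normed_vector"
  assumes "finite_dim (null_space A)" "alg_complement (range A) W" "finite_dim W" "dim W = dim (null_space A)"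
  shows "A \<in> Phi0"
proof -
  have "subspace (range A)" by (simp add: linear_subspace_image)
  then have "codim (range A) = dim W" using codim_eq assms by blast
  then show ?thesis using assms by (auto simp: Phi0_def fredholm_def fredholm_index_def finite_codim_def)
qed

lemma Phi0_E:
  fixes A :: "'u::real_normed_vector \<Rightarrow>\<^sub>L 'v::real_normed_vector"
  assumes "A \<in> Phi0"
  obtains W where "finite_dim (null_space A)" "alg_complement (range A) W" "finite_dim W" "dim W = dim (null_space A)"
proof -
  have "subspace (range A)" by (simp add: linear_subspace_image)
  moreover obtain W where W: "alg_complement (range A) W" "finite_dim W"
    using assms by (auto simp: Phi0_def fredholm_def finite_codim_def)
  ultimately have "codim (range A) = dim W" using codim_eq by blast
  then show ?thesis using that[OF _ W] assms by (auto simp: Phi0_def fredholm_def fredholm_index_def)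
qed

text \<open>A basis of the kernel is sent to a basis of a complement of the range, of equal size by
  index zero. The perturbation vanishes wherever finitely many functionals do, so it disappears on
  the kernel of a suitable projection.\<close>

lemma Phi0_finite_rank_perturb_GL:
  fixes A :: "'u::banach \<Rightarrow>\<^sub>L 'v::banach"
  assumes "A \<in> Phi0"
  obtains f \<Psi> where "finite \<Psi>" "\<forall>u. (\<forall>\<psi>\<in>\<Psi>. blinfun_apply \<psi> u = (0::real)) \<longrightarrow> blinfun_apply f u = 0" "A + f \<in> GL"
proof -
  obtain W where W: "finite_dim (null_space A)" "alg_complement (range A) W" "finite_dim W"
    "dim W = dim (null_space A)" using assms by (rule Phi0_E)
  obtain B where B: "B \<subseteq> null_space A" "finite B" "independent B" "null_space A \<subseteq> span B"
    "card B = dim (null_space A)" using finite_dim_basis[OF W(1)] .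
  obtain C where C: "C \<subseteq> W" "finite C" "independent C" "W \<subseteq> span C" "card C = dim W"
    using finite_dim_basis[OF W(3)] .
  obtain w where w: "bij_betw w B C" using finite_same_card_bij[OF B(2) C(2)] B(5) C(5) W(4) by auto
  obtain \<phi> :: "'u \<Rightarrow> 'u \<Rightarrow>\<^sub>L real" where \<phi>: "\<And>b c. b \<in> B \<Longrightarrow> c \<in> B \<Longrightarrow> \<phi> b c = (if b = c then 1 else 0)"
    using dual_basis[OF B(2,3)] by blast
  define f where "f = (\<Sum>b\<in>B. blinfun_scaleR_left (w b) o\<^sub>L \<phi> b)"
  have f: "f u = (\<Sum>b\<in>B. \<phi> b u *\<^sub>R w b)" for u by (simp add: f_def blinfun.sum_left)
  have Wsub: "subspace W" using W by (simp add: alg_complement_def)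
  have wW: "w b \<in> W" if "b \<in> B" for b using w C that by (auto simp: bij_betw_def)
  have fW: "f u \<in> W" for u unfolding f using Wsub wW by (intro subspace_sum subspace_scale)
  have Ab: "A b = 0" if "b \<in> B" for b using B that by (auto simp: null_space_def)
  have "u = 0" if "(A + f) u = 0" for u
  proof -
    have s: "A u + f u = 0" using that by (simp add: blinfun.add_left)
    then have "f u = A (- u)" by (simp add: blinfun.minus_right add_eq_0_iff)
    then have "f u \<in> range A" by simp
    then have f0: "f u = 0" using alg_complement_Int[OF W(2) _ fW] by simp
    have wi: "inv_into B w (w b) = b" if "b \<in> B" for b using w that by (simp add: bij_betw_def inv_into_f_f)
    have "(\<Sum>c\<in>C. \<phi> (inv_into B w c) u *\<^sub>R c) = (\<Sum>b\<in>B. \<phi> (inv_into B w (w b)) u *\<^sub>R w b)"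
      by (rule sum.reindex_bij_betw[OF w, symmetric])
    also have "\<dots> = f u" unfolding f by (intro sum.cong refl) (simp add: wi)
    finally have "(\<Sum>c\<in>C. \<phi> (inv_into B w c) u *\<^sub>R c) = 0" using f0 by simp
    from independentD[OF C(3,2) subset_refl this]
    have "\<phi> (inv_into B w c) u = 0" if "c \<in> C" for c using that .
    then have z: "\<phi> b u = 0" if "b \<in> B" for b
      using that wi[OF that] w bij_betwE by metis
    have "A u = 0" using s f0 by simp
    then have "u \<in> span B" using B(4) by (auto simp: null_space_def)
    from dual_basis_expand[OF B(2) \<phi> this] show "u = 0" using z by simp
  qed
  then have inj: "inj (A + f)" by (simp add: linear_injective_0)
  have "\<exists>u. (A + f) u = v" for v
  proof -
    obtain r y where r: "r \<in> range A" "y \<in> W" "v = r + y"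
      using alg_complement_sum[OF W(2), of v] by (elim bexE) (rule that)
    obtain u' where u': "r = A u'" using r(1) by (rule rangeE)
    have "y \<in> range (\<lambda>d. \<Sum>c\<in>C. d c *\<^sub>R c)" using r(2) C(4) span_finite[OF C(2)] by blast
    then obtain d where d: "y = (\<Sum>c\<in>C. d c *\<^sub>R c)" by (rule rangeE)
    \<comment> \<open>Adding kernel vectors does not change \<open>A u'\<close> and allows the
      coefficients \<open>\<phi> b u\<close>, hence \<open>f u\<close>, to be prescribed.\<close>
    define u where "u = u' + (\<Sum>b\<in>B. (d (w b) - \<phi> b u') *\<^sub>R b)"
    have Au: "A u = A u'" by (simp add: u_def blinfun.add_right blinfun.sum_right blinfun.scaleR_right Ab)
    have "\<phi> b u = d (w b)" if b: "b \<in> B" for b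
    proof -
      have "\<phi> b (\<Sum>c\<in>B. (d (w c) - \<phi> c u') *\<^sub>R c) = (\<Sum>c\<in>B. if c = b then d (w b) - \<phi> b u' else 0)"
        unfolding blinfun.sum_right using \<phi> b by (intro sum.cong) (auto simp: blinfun.scaleR_right)
      then show ?thesis using b B(2) by (simp add: u_def blinfun.add_right)
    qed
    then have "f u = (\<Sum>b\<in>B. d (w b) *\<^sub>R w b)" unfolding f by (intro sum.cong) auto
    also have "\<dots> = y" unfolding d by (rule sum.reindex_bij_betw[OF w])
    finally show ?thesis using Au u' r(3) by (intro exI[of _ u]) (simp add: blinfun.add_left)
  qed
  then have "surj (A + f)" by (metis surjI)
  then have "A + f \<in> GL" using inj by (simp add: GL_iff_bij bij_def)
  moreover have "finite (\<phi> ` B)" using B by simp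
  moreover have "\<forall>u. (\<forall>\<psi>\<in>\<phi> ` B. \<psi> u = 0) \<longrightarrow> f u = 0" by (simp add: f)
  ultimately show ?thesis using that by blast
qed

text \<open>Modulo the kernel of \<open>P\<close>, where it is the identity, \<open>N\<close> is an
  endomorphism of the finite-dimensional range of \<open>P\<close>; there injectivity gives
  surjectivity.\<close>

lemma finite_rank_inj_GL:
  fixes N P :: "'u::banach \<Rightarrow>\<^sub>L 'u"
  assumes PP: "\<And>u. P (P u) = P u" and fin: "finite_dim (range P)"
    and N: "\<And>u. P u = 0 \<Longrightarrow> N u = u" and inj: "\<And>u. N u = 0 \<Longrightarrow> u = 0"
  shows "N \<in> GL"
proof -
  obtain B where B: "B \<subseteq> range P" "finite B" "independent B" "range P \<subseteq> span B" "card B = dim (range P)"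
    using finite_dim_basis[OF fin] .
  define g where "g u = P (N u)" for u
  have lin: "linear g" unfolding g_def
    by (intro linear_compose[OF linear_blinfun[of N] linear_blinfun[of P], unfolded o_def])
  have sp: "span B = range P" using B by (metis span_eq_iff span_mono subset_antisym linear_subspace_image linear_blinfun subspace_UNIV)
  have "x = 0" if x: "x \<in> span B" "g x = 0" for x
  proof -
    have "N (x - N x) = 0" using N[of "N x"] x(2) by (simp add: g_def blinfun.diff_right)
    then have "N x = x" using inj by fastforce
    then have "P x = 0" using x(2) by (simp add: g_def)
    moreover have "P x = x" using x(1) sp PP by auto
    ultimately show ?thesis by simp
  qed
  note im = independent_linear_image[OF lin B(3) this]
  have "g ` B \<subseteq> span B" using sp by (auto simp: g_def)
  then have "span B \<subseteq> span (g ` B)"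
    using im B(2) by (intro finite_independent_spans) (auto simp: card_image)
  then have surj: "\<exists>x. g x = P v" for v
    using linear_span_image[OF lin, of B] sp by (metis imageE rangeI subsetD)
  have "\<exists>u. N u = v" for v
  proof -
    obtain x where x: "g x = P v" using surj by blast
    then have "P (v - N x) = 0" by (simp add: g_def blinfun.diff_right)
    then have "N (v - N x) = v - N x" by (rule N)
    then have "N (x + (v - N x)) = v" by (simp add: blinfun.add_right)
    then show ?thesis by blast
  qed
  moreover have "inj N" using inj by (simp add: linear_injective_0)
  moreover have "surj N" using calculation(1) by (metis surjI)
  ultimately show ?thesis by (simp add: GL_iff_bij bij_def)
qed

text \<open>Rank-nullity for the endomorphism \<open>P N\<close> of the range of \<open>P\<close>:
  its kernel is isomorphic to that of \<open>N\<close>, and a complement of its image within the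
  range of \<open>P\<close> is also one of the range of \<open>N\<close>. This keeps straight-line
  homotopies between operators that agree on the kernel of \<open>P\<close> inside
  \<open>Phi0\<close>.\<close>

lemma finite_rank_Phi0:
  fixes N P :: "'u::real_normed_vector \<Rightarrow>\<^sub>L 'u" and T :: "'u \<Rightarrow>\<^sub>L 'v::real_normed_vector"
  assumes PP: "\<And>u. P (P u) = P u" and fin: "finite_dim (range P)"
    and N: "\<And>u. P u = 0 \<Longrightarrow> N u = u" and T: "T \<in> GL"
  shows "T o\<^sub>L N \<in> Phi0"
proof -
  have subP: "subspace (range P)" by (simp add: linear_subspace_image)
  define g where "g u = P (N u)" for u
  have lin: "linear g" unfolding g_def
    by (intro linear_compose[OF linear_blinfun[of N] linear_blinfun[of P], unfolded o_def])
  define KD where "KD = {x \<in> range P. g x = 0}"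
  have KDP: "KD \<subseteq> range P" by (auto simp: KD_def)
  obtain D where D: "finite D" "range P \<subseteq> span D" using fin by (auto simp: finite_dim_def)
  have finb: "finite X" if "independent X" "X \<subseteq> range P" for X
    using independent_span_bound[OF D(1) that(1)] that(2) D(2) by blast
  obtain B0 where B0: "B0 \<subseteq> KD" "independent B0" "KD \<subseteq> span B0" by (rule basis_exists)
  obtain B where B: "B0 \<subseteq> B" "B \<subseteq> range P" "independent B" "range P \<subseteq> span B"
    using maximal_independent_subset_extend[OF subset_trans[OF B0(1) KDP] B0(2)] .
  have finB: "finite B" "finite B0" using finb B B0 KDP by (blast intro: finite_subset)+
  have subKD: "subspace KD" unfolding KD_def using subP linear_subspace_kernel[OF lin]
    by (auto simp: subspace_def linear_0[OF lin] linear_add[OF lin] linear_scale[OF lin])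
  have spP: "span X \<subseteq> range P" if "X \<subseteq> range P" for X using that subP span_minimal by blast
  have kz: "x = 0" if "x \<in> span (B - B0)" "g x = 0" for x
  proof -
    have "x \<in> range P" using that(1) spP[of "B - B0"] B by blast
    then have "x \<in> span B0" using that B0 by (auto simp: KD_def)
    then show ?thesis using independent_span_Int_Diff[OF finB(1) B(3) B(1)] that by blast
  qed
  have "independent (B - B0)" using B(3) independent_mono by blast
  note im = independent_linear_image[OF lin this kz]
  define C1 where "C1 = g ` (B - B0)"
  have C1: "independent C1" "C1 \<subseteq> range P" using im(1) by (auto simp: C1_def g_def)
  have cC1: "card C1 = card B - card B0"
    using im(2) finB B(1) by (simp add: C1_def card_image card_Diff_subset)
  obtain C where C: "C1 \<subseteq> C" "C \<subseteq> range P" "independent C" "range P \<subseteq> span C"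
    using maximal_independent_subset_extend[OF C1(2,1)] .
  have finC: "finite C" using finb C by blast
  have "card C = card B"
    using independent_span_bound[OF finB(1) C(3) subset_trans[OF C(2) B(4)]]
      independent_span_bound[OF finC B(3) subset_trans[OF B(2) C(4)]] by simp
  then have cW0: "card (C - C1) = card B0"
    using cC1 C(1) finC finB card_mono[OF finB(1) B(1)] by (simp add: card_Diff_subset finite_subset)
  have gP: "g x \<in> span C1" if "x \<in> range P" for x
  proof -
    have "g x \<in> span (g ` B)" using that B(4) linear_span_image[OF lin, of B] by blast
    moreover have "g ` B \<subseteq> span C1"
    proof
      fix y assume "y \<in> g ` B"
      then obtain b where b: "b \<in> B" "y = g b" by blast
      show "y \<in> span C1"
      proof (cases "b \<in> B0")
        case True then show ?thesis using b B0 by (auto simp: KD_def span_0)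
      qed (use b in \<open>auto simp: C1_def intro: span_base\<close>)
    qed
    ultimately show ?thesis using span_minimal subspace_span by blast
  qed
  have NP: "P (N u) = g (P u)" for u
  proof -
    have "N (u - P u) = u - P u" by (rule N) (simp add: blinfun.diff_right PP)
    then have "N u = (u - P u) + N (P u)" by (simp add: blinfun.diff_right algebra_simps)
    then show ?thesis by (simp add: g_def blinfun.diff_right blinfun.add_right PP)
  qed
  have Tz: "T x = 0 \<longleftrightarrow> x = 0" for x
    using blinfun_inv_left[OF T, of x] by (auto simp: blinfun.zero_right)
  then have nullTN: "null_space (T o\<^sub>L N) = null_space N" by (simp add: null_space_def)
  \<comment> \<open>For \<open>x\<close> in \<open>KD\<close> the vector \<open>N x\<close> lies in
    the kernel of \<open>P\<close> and is fixed by \<open>N\<close>, so \<open>x - N x\<close> is a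
    null vector; \<open>P\<close> recovers \<open>x\<close> from it.\<close>
  define h where "h x = x - N x" for x
  have linh: "linear h" unfolding h_def by (intro linear_compose_sub linear_id[unfolded id_def] linear_blinfun)
  have "x = 0" if "x \<in> span B0" "h x = 0" for x
  proof -
    have "x \<in> KD" using that(1) span_minimal[OF B0(1) subKD] by blast
    then have "P (h x) = x" using PP by (auto simp: h_def KD_def g_def blinfun.diff_right)
    then show ?thesis using that by (simp add: blinfun.zero_right)
  qed
  note ih = independent_linear_image[OF linh B0(2) this]
  have hnull: "h ` B0 \<subseteq> null_space N"
  proof
    fix y assume "y \<in> h ` B0"
    then obtain b where b: "b \<in> B0" "y = h b" by blast
    then have "P (N b) = 0" using B0 by (auto simp: KD_def g_def)
    then have "N (N b) = N b" by (rule N)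
    then show "y \<in> null_space N" using b by (simp add: h_def null_space_def blinfun.diff_right)
  qed
  have nullsp: "null_space N \<subseteq> span (h ` B0)"
  proof
    fix u assume "u \<in> null_space N"
    then have u: "N u = 0" by (simp add: null_space_def)
    have "N (u - P u) = u - P u" by (rule N) (simp add: blinfun.diff_right PP)
    then have "h (P u) = u" using u by (simp add: h_def blinfun.diff_right algebra_simps)
    moreover have "P u \<in> KD" using NP[of u] u by (auto simp: KD_def blinfun.zero_right)
    ultimately show "u \<in> span (h ` B0)" using B0(3) linear_span_image[OF linh, of B0] by (metis image_eqI subsetD)
  qed
  have dimnull: "dim (null_space N) = card B0"
    using basis_card_eq_dim[OF hnull nullsp ih(1)] ih(2) by (simp add: card_image)
  define W where "W = blinfun_apply T ` span (C - C1)"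
  have dimW: "dim W = card (C - C1)"
  proof -
    have "independent (C - C1)" using C(3) independent_mono by blast
    then have iT: "independent (T ` (C - C1))" "inj_on T (C - C1)"
      using independent_linear_image[OF linear_blinfun[of T], of "C - C1"] Tz by auto
    have "W = span (T ` (C - C1))" unfolding W_def by (simp add: linear_span_image)
    then show ?thesis using iT by (simp add: dim_eq_card_independent card_image)
  qed
  show ?thesis
  proof (rule Phi0_I[where W = W])
    show "finite_dim (null_space (T o\<^sub>L N))" unfolding nullTN finite_dim_def
      using nullsp finB by (intro exI[of _ "h ` B0"]) auto
    show "finite_dim W" unfolding finite_dim_def W_def using finC
      by (intro exI[of _ "T ` (C - C1)"]) (simp add: linear_span_image)
    show "dim W = dim (null_space (T o\<^sub>L N))" using dimW dimnull cW0 nullTN by simp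
    show "alg_complement (range (T o\<^sub>L N)) W" unfolding alg_complement_def
    proof (intro conjI allI)
      show "subspace W" unfolding W_def by (simp add: linear_subspace_image)
      show "range (T o\<^sub>L N) \<inter> W = {0}"
      proof (intro equalityI subsetI)
        fix y assume "y \<in> range (T o\<^sub>L N) \<inter> W"
        then obtain u w where uw: "y = T (N u)" "y = T w" "w \<in> span (C - C1)"
          unfolding W_def by (metis IntE blinfun_apply_blinfun_compose imageE)
        then have "N u = w" using T by (metis blinfun_inv_left)
        moreover have "w \<in> range P" using uw(3) spP[of "C - C1"] C by blast
        then have "P w = w" using PP by auto
        ultimately have "w \<in> span C1" using NP[of u] gP[of "P u"] by simp
        then have "w = 0" using independent_span_Int_Diff[OF finC C(3,1)] uw by blast
        then show "y \<in> {0}" using uw by (simp add: blinfun.zero_right)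
      next
        fix y :: 'v assume "y \<in> {0}"
        moreover have "T (N 0) = 0" by (simp add: blinfun.zero_right)
        then have "0 \<in> range (T o\<^sub>L N)" by (metis blinfun_apply_blinfun_compose rangeI)
        moreover have "0 \<in> W" unfolding W_def by (metis blinfun.zero_right image_eqI span_0)
        ultimately show "y \<in> range (T o\<^sub>L N) \<inter> W" by simp
      qed
      fix v
      define v' where "v' = blinfun_inv T v"
      have "P v' \<in> span (C1 \<union> (C - C1))" using C(1,4) by (simp add: Un_absorb1 subset_iff)
      then obtain a w where aw: "P v' = a + w" "a \<in> span C1" "w \<in> span (C - C1)" unfolding span_Un by blast
      have "span C1 \<subseteq> g ` range P"
        unfolding C1_def linear_span_image[OF lin] using spP[of "B - B0"] B by blast
      then obtain x where x: "a = g x" using aw by blast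
      have "w \<in> range P" using aw(3) spP[of "C - C1"] C by blast
      then have Pw: "P w = w" using PP by auto
      \<comment> \<open>Once \<open>w\<close> and \<open>N x\<close> are removed, the rest lies in
        the kernel of \<open>P\<close>, where \<open>N\<close> is the identity, and so it is its own
        preimage.\<close>
      have "P (v' - w - N x) = 0" using aw(1) x Pw by (simp add: blinfun.diff_right g_def)
      then have "N (v' - w - N x) = v' - w - N x" by (rule N)
      then have "N (x + (v' - w - N x)) = v' - w" by (simp add: blinfun.add_right)
      then have "v = (T o\<^sub>L N) (x + (v' - w - N x)) + T w"
        using T by (simp add: v'_def blinfun.diff_right)
      moreover have "T w \<in> W" using aw by (simp add: W_def)
      ultimately show "\<exists>x\<in>range (T o\<^sub>L N). \<exists>w\<in>W. v = x + w" by blast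
    qed
  qed
qed

lemma GL_imp_Phi0: "T \<in> GL \<Longrightarrow> T \<in> Phi0"
proof -
  assume T: "T \<in> GL"
  have "T o\<^sub>L id_blinfun \<in> Phi0"
    by (rule finite_rank_Phi0[where P = 0]) (use T in \<open>auto simp: finite_dim_def intro: exI[of _ "{}"]\<close>)
  moreover have "T o\<^sub>L id_blinfun = T" by (rule blinfun_eqI) simp
  ultimately show ?thesis by simp
qed

subsection \<open>Local degree\<close>

lemma homotopic_with_canonI:
  assumes "continuous_on ({0..1::real} \<times> X) h" "\<And>t x. t \<in> {0..1} \<Longrightarrow> x \<in> X \<Longrightarrow> h (t, x) \<in> Y"
    "\<And>x. h (0, x) = f x" "\<And>x. h (1, x) = g x" "\<And>t. t \<in> {0..1} \<Longrightarrow> P (\<lambda>x. h (t, x))"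
  shows "homotopic_with_canon P X Y f g"
  unfolding homotopic_with_def
  using assms by (intro exI[of _ h]) auto

text \<open>What is cut out is \<open>E - \<Omega>\<close>, closed in \<open>E\<close> and contained
  in the open set \<open>E - Z\<close>; being equal to their closure and interior, the two sets
  satisfy the excision axiom.\<close>

lemma excision_open_compact:
  fixes E \<Omega> Z :: "'e::real_normed_vector set"
  assumes "open \<Omega>" "compact Z" "Z \<subseteq> \<Omega> \<inter> E"
  shows "hom_induced n (top_of_set (\<Omega> \<inter> E)) (\<Omega> \<inter> E - Z) (top_of_set E) (E - Z) id
    \<in> iso (relative_homology_group n (top_of_set (\<Omega> \<inter> E)) (\<Omega> \<inter> E - Z))
          (relative_homology_group n (top_of_set E) (E - Z))"
proof -
  let ?X = "top_of_set E" and ?U = "E - \<Omega>" and ?T = "E - Z"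
  have "?U = E \<inter> - \<Omega>" by blast
  then have "closedin ?X ?U" using assms(1) by (simp add: closedin_closed_Int closed_Compl)
  then have "?X closure_of ?U = ?U" by (simp add: closure_of_closedin)
  moreover have "openin ?X ?T"
  proof -
    have "?T = E \<inter> - Z" by blast
    then show ?thesis using compact_imp_closed[OF assms(2)] by (simp add: openin_open_Int open_Compl)
  qed
  then have "?X interior_of ?T = ?T" by (simp add: interior_of_openin)
  ultimately have sub: "?X closure_of ?U \<subseteq> ?X interior_of ?T" using assms(3) by blast
  have "E - ?U = \<Omega> \<inter> E" "?T - ?U = \<Omega> \<inter> E - Z" using assms(3) by blast+
  moreover have "subtopology ?X (E - ?U) = top_of_set (\<Omega> \<inter> E)"
    by (simp add: subtopology_subtopology Diff_Diff_Int Int_commute)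
  moreover have "subtopology ?X E = ?X" by (simp add: subtopology_subtopology)
  ultimately show ?thesis using homology_excision_axiom[OF sub, of E n] by simp
qed

lemma continuous_map_id_top_of_set:
  "S \<subseteq> T \<Longrightarrow> continuous_map (top_of_set S) (top_of_set T) id"
  by (auto simp: continuous_map_in_subtopology)

text \<open>
  The local degree of a map \<open>f\<close> on \<open>\<Omega> \<inter> E\<close> with zero set in the compact set \<open>Z\<close> is encoded by the
  image under \<open>f\<close> of the class obtained from \<open>x\<close> by excision; it depends on \<open>f\<close> only near its zeros.
\<close>

lemma excision_class_localize:
  fixes E \<Omega> \<Omega>' Z Z' Q :: "'e::real_normed_vector set"
  assumes \<Omega>: "open \<Omega>" "open \<Omega>'" "\<Omega>' \<subseteq> \<Omega>" and Z: "compact Z" "Z \<subseteq> \<Omega> \<inter> E"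
    and Z': "compact Z'" "Z' \<subseteq> \<Omega>' \<inter> E" "Z' \<subseteq> Z" and Q: "Q \<subseteq> E" "Q \<inter> Z = {}"
    and f: "continuous_on (\<Omega> \<inter> E) f" "\<And>p. p \<in> \<Omega> \<inter> E \<Longrightarrow> f p \<in> E" "\<And>p. p \<in> \<Omega> \<inter> E \<Longrightarrow> f p = 0 \<Longrightarrow> p \<in> Z'"
    and a: "a \<in> carrier (relative_homology_group n (top_of_set (\<Omega> \<inter> E)) (\<Omega> \<inter> E - Z))"
      "hom_induced n (top_of_set (\<Omega> \<inter> E)) (\<Omega> \<inter> E - Z) (top_of_set E) (E - Z) id a
       = hom_induced n (top_of_set E) Q (top_of_set E) (E - Z) id x"
    and a': "a' \<in> carrier (relative_homology_group n (top_of_set (\<Omega>' \<inter> E)) (\<Omega>' \<inter> E - Z'))"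
      "hom_induced n (top_of_set (\<Omega>' \<inter> E)) (\<Omega>' \<inter> E - Z') (top_of_set E) (E - Z') id a'
       = hom_induced n (top_of_set E) Q (top_of_set E) (E - Z') id x"
  shows "hom_induced n (top_of_set (\<Omega> \<inter> E)) (\<Omega> \<inter> E - Z) (top_of_set E) (E - {0}) f a
       = hom_induced n (top_of_set (\<Omega>' \<inter> E)) (\<Omega>' \<inter> E - Z') (top_of_set E) (E - {0}) f a'"
proof -
  let ?X = "top_of_set E" and ?O = "top_of_set (\<Omega> \<inter> E)" and ?O' = "top_of_set (\<Omega>' \<inter> E)"
  define a1 where "a1 = hom_induced n ?O (\<Omega> \<inter> E - Z) ?O (\<Omega> \<inter> E - Z') id a"
  define a2 where "a2 = hom_induced n ?O' (\<Omega>' \<inter> E - Z') ?O (\<Omega> \<inter> E - Z') id a'"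
  have c1: "continuous_map ?O ?X id" "continuous_map ?O ?O id" "continuous_map ?O' ?O id" "continuous_map ?X ?X id"
    using \<Omega>(3) by (auto intro!: continuous_map_id_top_of_set)
  have cf: "continuous_map ?O ?X f" using f(1,2) by (auto simp: continuous_map_in_subtopology)
  have f0: "f \<in> (\<Omega> \<inter> E - Z') \<rightarrow> E - {0}" using f(2,3) by auto
  have "Z' \<subseteq> \<Omega> \<inter> E" using Z(2) Z'(3) by blast
  note iso = excision_open_compact[OF \<Omega>(1) Z'(1) this, of n]
  have "hom_induced n ?O (\<Omega> \<inter> E - Z') ?X (E - Z') id a1
      = hom_induced n ?O (\<Omega> \<inter> E - Z) ?X (E - Z') (id \<circ> id) a"
    unfolding a1_def by (rule hom_induced_compose') (use c1 Z' in auto)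
  also have "\<dots> = hom_induced n ?X (E - Z) ?X (E - Z') id (hom_induced n ?O (\<Omega> \<inter> E - Z) ?X (E - Z) id a)"
    by (rule hom_induced_compose'[symmetric]) (use c1 Z' in auto)
  also have "\<dots> = hom_induced n ?X Q ?X (E - Z') (id \<circ> id) x" unfolding a(2)
    by (rule hom_induced_compose') (use c1 Z' Q in auto)
  finally have e1: "hom_induced n ?O (\<Omega> \<inter> E - Z') ?X (E - Z') id a1 = hom_induced n ?X Q ?X (E - Z') id x" by simp
  have "hom_induced n ?O (\<Omega> \<inter> E - Z') ?X (E - Z') id a2
      = hom_induced n ?O' (\<Omega>' \<inter> E - Z') ?X (E - Z') (id \<circ> id) a'"
    unfolding a2_def by (rule hom_induced_compose') (use c1 \<Omega>(3) in auto)
  then have e2: "hom_induced n ?O (\<Omega> \<inter> E - Z') ?X (E - Z') id a2 = hom_induced n ?X Q ?X (E - Z') id x"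
    using a'(2) by simp
  \<comment> \<open>Both classes are sent to the image of \<open>x\<close> in the homology of
    \<open>(E, E - Z')\<close>, and excision for \<open>Z'\<close> is injective.\<close>
  have "a1 = a2"
  proof (rule inj_onD)
    show "inj_on (hom_induced n ?O (\<Omega> \<inter> E - Z') ?X (E - Z') id)
      (carrier (relative_homology_group n ?O (\<Omega> \<inter> E - Z')))" using iso by (simp add: iso_def bij_betw_def)
    show "hom_induced n ?O (\<Omega> \<inter> E - Z') ?X (E - Z') id a1 = hom_induced n ?O (\<Omega> \<inter> E - Z') ?X (E - Z') id a2"
      using e1 e2 by simp
  qed (simp_all add: a1_def a2_def hom_induced_carrier)
  moreover have "hom_induced n ?O (\<Omega> \<inter> E - Z') ?X (E - {0}) f a1
      = hom_induced n ?O (\<Omega> \<inter> E - Z) ?X (E - {0}) (f \<circ> id) a"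
    unfolding a1_def by (rule hom_induced_compose') (use c1 cf f0 Z' in auto)
  moreover have "hom_induced n ?O (\<Omega> \<inter> E - Z') ?X (E - {0}) f a2
      = hom_induced n ?O' (\<Omega>' \<inter> E - Z') ?X (E - {0}) (f \<circ> id) a'"
    unfolding a2_def by (rule hom_induced_compose') (use c1 cf f0 \<Omega>(3) in auto)
  ultimately show ?thesis by simp
qed

text \<open>Surjectivity of excision. In the application \<open>Q\<close> is the outside of a large
  ball, and \<open>x\<close> stands in for a fundamental class without a generator being singled
  out.\<close>

lemma excision_class_exists:
  fixes E \<Omega> Z Q :: "'e::real_normed_vector set"
  assumes "open \<Omega>" "compact Z" "Z \<subseteq> \<Omega> \<inter> E"
  obtains a where "a \<in> carrier (relative_homology_group n (top_of_set (\<Omega> \<inter> E)) (\<Omega> \<inter> E - Z))"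
      "hom_induced n (top_of_set (\<Omega> \<inter> E)) (\<Omega> \<inter> E - Z) (top_of_set E) (E - Z) id a
       = hom_induced n (top_of_set E) Q (top_of_set E) (E - Z) id x"
proof -
  have "hom_induced n (top_of_set E) Q (top_of_set E) (E - Z) id x
    \<in> carrier (relative_homology_group n (top_of_set E) (E - Z))" by (rule hom_induced_carrier)
  also have "\<dots> = hom_induced n (top_of_set (\<Omega> \<inter> E)) (\<Omega> \<inter> E - Z) (top_of_set E) (E - Z) id
     ` carrier (relative_homology_group n (top_of_set (\<Omega> \<inter> E)) (\<Omega> \<inter> E - Z))"
    using excision_open_compact[OF assms, of n] by (simp add: iso_def bij_betw_def)
  finally show ?thesis
  proof (rule imageE)
    fix a
    assume "hom_induced n (top_of_set E) Q (top_of_set E) (E - Z) id x =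
      hom_induced n (top_of_set (\<Omega> \<inter> E)) (\<Omega> \<inter> E - Z) (top_of_set E) (E - Z) id a"
      "a \<in> carrier (relative_homology_group n (top_of_set (\<Omega> \<inter> E)) (\<Omega> \<inter> E - Z))"
    from that[OF this(2) this(1)[symmetric]] show thesis .
  qed
qed

text \<open>Excision shrinks to a small ball around the only zero, where \<open>f\<close> is
  deformed into the model \<open>p \<mapsto> M (p - z)\<close>. The model is defined on all of
  \<open>E\<close>, so excision can be undone with \<open>UNIV\<close> in place of
  \<open>\<Omega>\<close> and \<open>z\<close> can be moved to \<open>0\<close>.\<close>

lemma local_degree_linearization:
  fixes E \<Omega> Z Q :: "'e::real_normed_vector set"
  assumes E: "subspace E" and \<Omega>: "open \<Omega>" and Z: "compact Z" "Z \<subseteq> \<Omega> \<inter> E" and Q: "Q \<subseteq> E" "Q \<inter> Z = {}"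
    and f: "continuous_on (\<Omega> \<inter> E) f" "\<And>p. p \<in> \<Omega> \<inter> E \<Longrightarrow> f p \<in> E"
    and z: "z \<in> Z" "0 < d" "ball z d \<subseteq> \<Omega>" "\<And>p. p \<in> \<Omega> \<inter> E \<Longrightarrow> f p = 0 \<Longrightarrow> p = z"
    and M: "continuous_on E M" "\<And>p. p \<in> E \<Longrightarrow> M p \<in> E" "\<And>p. p \<in> E \<Longrightarrow> M p = 0 \<Longrightarrow> p = 0"
    and lin: "\<And>p s. p \<in> ball z d \<inter> E \<Longrightarrow> s \<in> {0..1} \<Longrightarrow> (1 - s) *\<^sub>R f p + s *\<^sub>R M (p - z) = 0 \<Longrightarrow> p = z"
    and Qz: "\<And>t. t \<in> {0..1} \<Longrightarrow> t *\<^sub>R z \<notin> Q"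
    and a: "a \<in> carrier (relative_homology_group n (top_of_set (\<Omega> \<inter> E)) (\<Omega> \<inter> E - Z))"
      "hom_induced n (top_of_set (\<Omega> \<inter> E)) (\<Omega> \<inter> E - Z) (top_of_set E) (E - Z) id a
       = hom_induced n (top_of_set E) Q (top_of_set E) (E - Z) id x"
  shows "hom_induced n (top_of_set (\<Omega> \<inter> E)) (\<Omega> \<inter> E - Z) (top_of_set E) (E - {0}) f a
       = hom_induced n (top_of_set E) Q (top_of_set E) (E - {0}) M x"
proof -
  let ?X = "top_of_set E" and ?O = "top_of_set (\<Omega> \<inter> E)" and ?B = "top_of_set (ball z d \<inter> E)"
  have zE: "z \<in> E" using z(1) Z(2) by blast
  have zb: "{z} \<subseteq> ball z d \<inter> E" using z zE by auto
  obtain b where b: "b \<in> carrier (relative_homology_group n ?B (ball z d \<inter> E - {z}))"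
      "hom_induced n ?B (ball z d \<inter> E - {z}) ?X (E - {z}) id b = hom_induced n ?X Q ?X (E - {z}) id x"
    using excision_class_exists[OF open_ball compact_sing zb, of n Q x] .
  define g where "g p = M (p - z)" for p
  have pz: "p - z \<in> E" if "p \<in> E" for p using that zE E subspace_diff by blast
  have cg: "continuous_on E g" unfolding g_def
    by (rule continuous_on_compose2[OF M(1)]) (auto intro!: continuous_intros simp: pz)
  have gE: "g p \<in> E" "g p = 0 \<Longrightarrow> p = z" if "p \<in> E" for p
    using M(2,3)[OF pz[OF that]] by (auto simp: g_def)
  have "hom_induced n ?O (\<Omega> \<inter> E - Z) ?X (E - {0}) f a = hom_induced n ?B (ball z d \<inter> E - {z}) ?X (E - {0}) f b"
    by (rule excision_class_localize[OF \<Omega> open_ball z(3) Z _ zb _ Q f _ a b]) (use z in auto)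
  also have "\<dots> = hom_induced n ?B (ball z d \<inter> E - {z}) ?X (E - {0}) g b"
  proof -
    have cf: "continuous_on ({0..1::real} \<times> (ball z d \<inter> E)) (\<lambda>y. f (snd y))"
      by (rule continuous_on_compose2[OF f(1)]) (use z(3) in \<open>auto intro!: continuous_intros\<close>)
    have cg': "continuous_on ({0..1::real} \<times> (ball z d \<inter> E)) (\<lambda>y. g (snd y))"
      by (rule continuous_on_compose2[OF cg]) (auto intro!: continuous_intros)
    have inE: "(1 - t) *\<^sub>R f p + t *\<^sub>R g p \<in> E" if "p \<in> ball z d \<inter> E" for t p
      using E f(2) gE(1) that z(3) by (intro subspace_add subspace_scale) auto
    have "homotopic_with_canon (\<lambda>h. h \<in> (ball z d \<inter> E - {z}) \<rightarrow> E - {0}) (ball z d \<inter> E) E f g"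
      by (rule homotopic_with_canonI[where h = "\<lambda>y. (1 - fst y) *\<^sub>R f (snd y) + fst y *\<^sub>R g (snd y)"])
        (use cf cg' inE lin in \<open>auto intro!: continuous_intros simp: g_def\<close>)
    then show ?thesis by (simp add: homology_homotopy_axiom[of _ _ _ _ f g])
  qed
  also have "\<dots> = hom_induced n ?X (E - {z}) ?X (E - {0}) g (hom_induced n ?X Q ?X (E - {z}) id x)"
  proof -
    have 1: "hom_induced n ?X Q ?X (E - {z}) id x \<in> carrier (relative_homology_group n (top_of_set (UNIV \<inter> E)) (UNIV \<inter> E - {z}))"
      by (simp add: hom_induced_carrier)
    have 2: "hom_induced n (top_of_set (UNIV \<inter> E)) (UNIV \<inter> E - {z}) ?X (E - {z}) id (hom_induced n ?X Q ?X (E - {z}) id x)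
      = hom_induced n ?X Q ?X (E - {z}) id x" by (simp add: hom_induced_id hom_induced_carrier)
    have "hom_induced n (top_of_set (UNIV \<inter> E)) (UNIV \<inter> E - {z}) ?X (E - {0}) g (hom_induced n ?X Q ?X (E - {z}) id x)
      = hom_induced n ?B (ball z d \<inter> E - {z}) ?X (E - {0}) g b"
      by (rule excision_class_localize[OF open_UNIV open_ball _ _ _ _ zb _ Q(1) _ _ _ _ 1 2 b])
        (use zE cg gE Q z(1) in auto)
    then show ?thesis by simp
  qed
  also have "\<dots> = hom_induced n ?X Q ?X (E - {0}) (g \<circ> id) x"
    by (rule hom_induced_compose')
      (use cg gE Q z(1) in \<open>auto simp: continuous_map_in_subtopology image_subset_iff\<close>)
  also have "\<dots> = hom_induced n ?X Q ?X (E - {0}) M x"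
  proof -
    have ptz: "p - t *\<^sub>R z \<in> E" if "p \<in> E" for p and t :: real
      using that zE E by (intro subspace_diff subspace_scale)
    \<comment> \<open>The zero is translated along the segment from \<open>z\<close> to
      \<open>0\<close>, which avoids \<open>Q\<close> by \<open>Qz\<close>.\<close>
    have "homotopic_with_canon (\<lambda>h. h \<in> Q \<rightarrow> E - {0}) E E g M"
    proof (rule homotopic_with_canonI[where h = "\<lambda>y. M (snd y - (1 - fst y) *\<^sub>R z)"])
      show "continuous_on ({0..1::real} \<times> E) (\<lambda>y. M (snd y - (1 - fst y) *\<^sub>R z))"
        by (rule continuous_on_compose2[OF M(1)]) (auto intro!: continuous_intros simp: ptz)
      fix t :: real assume t: "t \<in> {0..1}"
      show "(\<lambda>p. M (snd (t, p) - (1 - fst (t, p)) *\<^sub>R z)) \<in> Q \<rightarrow> E - {0}"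
      proof
        fix p assume p: "p \<in> Q"
        then have "p - (1 - t) *\<^sub>R z \<noteq> 0" using Qz[of "1 - t"] t by auto
        then show "M (snd (t, p) - (1 - fst (t, p)) *\<^sub>R z) \<in> E - {0}"
          using M(2,3)[OF ptz] p Q(1) by auto
      qed
    qed (use M ptz in \<open>auto simp: g_def\<close>)
    then show ?thesis by (simp add: homology_homotopy_axiom[of _ _ _ _ g M])
  qed
  finally show ?thesis .
qed

text \<open>The slices of \<open>H\<close> have their zeros in the fixed compact set
  \<open>Z\<close>, so all of them act alike on the class obtained from \<open>x\<close> by
  excision; at the two ends this action is given by
  \<open>local_degree_linearization\<close>.\<close>

lemma degree_homotopy_invariance:
  fixes E \<Omega> Z Q :: "'e::real_normed_vector set"
  assumes E: "subspace E" and \<Omega>: "open \<Omega>" and Z: "compact Z" "Z \<subseteq> \<Omega> \<inter> E" and Q: "Q \<subseteq> E" "Q \<inter> Z = {}"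
    and H: "continuous_on ({0..1::real} \<times> (\<Omega> \<inter> E)) H" "\<And>c p. c \<in> {0..1} \<Longrightarrow> p \<in> \<Omega> \<inter> E \<Longrightarrow> H (c, p) \<in> E"
      "\<And>c p. c \<in> {0..1} \<Longrightarrow> p \<in> \<Omega> \<inter> E \<Longrightarrow> H (c, p) = 0 \<Longrightarrow> p \<in> Z"
    and z: "\<And>i. i \<in> {0, 1} \<Longrightarrow> z i \<in> Z" "0 < d" "\<And>i. i \<in> {0, 1} \<Longrightarrow> ball (z i) d \<subseteq> \<Omega>"
      "\<And>i p. i \<in> {0, 1} \<Longrightarrow> p \<in> \<Omega> \<inter> E \<Longrightarrow> H (i, p) = 0 \<Longrightarrow> p = z i"
    and M: "\<And>i. i \<in> {0, 1} \<Longrightarrow> continuous_on E (M i)" "\<And>i p. i \<in> {0, 1} \<Longrightarrow> p \<in> E \<Longrightarrow> M i p \<in> E"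
      "\<And>i p. i \<in> {0, 1} \<Longrightarrow> p \<in> E \<Longrightarrow> M i p = 0 \<Longrightarrow> p = 0"
    and lin: "\<And>i p s. i \<in> {0, 1} \<Longrightarrow> p \<in> ball (z i) d \<inter> E \<Longrightarrow> s \<in> {0..1} \<Longrightarrow>
      (1 - s) *\<^sub>R H (i, p) + s *\<^sub>R M i (p - z i) = 0 \<Longrightarrow> p = z i"
    and Qz: "\<And>i t. i \<in> {0, 1} \<Longrightarrow> t \<in> {0..1} \<Longrightarrow> t *\<^sub>R z i \<notin> Q"
  shows "hom_induced n (top_of_set E) Q (top_of_set E) (E - {0}) (M 0) x
       = hom_induced n (top_of_set E) Q (top_of_set E) (E - {0}) (M (1::real)) x"
proof -
  let ?X = "top_of_set E" and ?O = "top_of_set (\<Omega> \<inter> E)"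
  obtain a where a: "a \<in> carrier (relative_homology_group n ?O (\<Omega> \<inter> E - Z))"
      "hom_induced n ?O (\<Omega> \<inter> E - Z) ?X (E - Z) id a = hom_induced n ?X Q ?X (E - Z) id x"
    by (rule excision_class_exists[OF \<Omega> Z])
  have ci: "continuous_on (\<Omega> \<inter> E) (\<lambda>p. H (c, p))" if "c \<in> {0..1}" for c
    by (rule continuous_on_compose2[OF H(1)]) (use that in \<open>auto intro!: continuous_intros\<close>)
  have l: "hom_induced n ?O (\<Omega> \<inter> E - Z) ?X (E - {0}) (\<lambda>p. H (i, p)) a = hom_induced n ?X Q ?X (E - {0}) (M i) x"
    if i: "i \<in> {0, 1}" for i
    by (rule local_degree_linearization[where z = "z i" and d = d])
      (use i E \<Omega> Z Q ci[of i] H(2)[of i] z(1)[OF i] z(2) z(3)[OF i] z(4)[OF i] M(1)[OF i] M(2)[OF i] M(3)[OF i] lin[OF i] Qz[OF i] a in auto)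
  have "homotopic_with_canon (\<lambda>h. h \<in> (\<Omega> \<inter> E - Z) \<rightarrow> E - {0}) (\<Omega> \<inter> E) E (\<lambda>p. H (0, p)) (\<lambda>p. H (1, p))"
    by (rule homotopic_with_canonI[where h = H]) (use H in auto)
  then have "hom_induced n ?O (\<Omega> \<inter> E - Z) ?X (E - {0}) (\<lambda>p. H (0, p))
    = hom_induced n ?O (\<Omega> \<inter> E - Z) ?X (E - {0}) (\<lambda>p. H (1, p))" by (rule homology_homotopy_axiom)
  then show ?thesis using l[of 0] l[of 1] by simp
qed

text \<open>\<open>k\<close> gives coordinates on \<open>E\<close> with indices \<open>0..N\<close>,
  and \<open>J\<close> is their inverse on the unit sphere. As \<open>E\<close> is contractible, the
  boundary map identifies the homology of \<open>(E, Q)\<close> in degree \<open>N + 1\<close> with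
  the reduced homology of \<open>Q\<close> in degree \<open>N\<close>; equality would then make a
  reflection of the sphere act like the identity.\<close>

lemma reflection_homology_distinct:
  fixes E :: "'e::real_normed_vector set" and k :: "'e \<Rightarrow> nat \<Rightarrow> real" and N :: nat
  assumes E: "subspace E"
    and kcont: "\<And>i. continuous_on E (\<lambda>p. k p i)"
    and kN: "\<And>p i. p \<in> E \<Longrightarrow> N < i \<Longrightarrow> k p i = 0"
    and khom: "\<And>p t i. p \<in> E \<Longrightarrow> k (t *\<^sub>R p) i = t * k p i"
    and k0: "\<And>p. p \<in> E \<Longrightarrow> (\<And>i. i \<le> N \<Longrightarrow> k p i = 0) \<Longrightarrow> p = 0"
    and J: "continuous_map (nsphere N) (top_of_set E) J" "\<And>s. s \<in> topspace (nsphere N) \<Longrightarrow> k (J s) = s"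
    and r: "continuous_on E r" "\<And>p. p \<in> E \<Longrightarrow> r p \<in> E" "\<And>p i. p \<in> E \<Longrightarrow> k (r p) i = (if i = 0 then - k p i else k p i)"
    and R: "0 < R" and Q: "Q = {p \<in> E. R \<le> sqrt (\<Sum>i\<le>N. (k p i)\<^sup>2)}"
  shows "\<exists>x. hom_induced (1 + int N) (top_of_set E) Q (top_of_set E) (E - {0}) id x
       \<noteq> hom_induced (1 + int N) (top_of_set E) Q (top_of_set E) (E - {0}) r x"
proof (rule ccontr)
  let ?X = "top_of_set E" and ?S = "nsphere N" and ?m = "1 + int N"
  let ?G = "reduced_homology_group (int N) ?S"
  let ?refl = "\<lambda>x i. if i = 0 then - x i else (x i :: real)"
  assume "\<not> ?thesis"
  then have eq: "hom_induced ?m ?X Q ?X (E - {0}) id x = hom_induced ?m ?X Q ?X (E - {0}) r x" for x by blast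
  define nk where "nk p = sqrt (\<Sum>i\<le>N. (k p i)\<^sup>2)" for p
  have topS: "topspace ?S = {x. (\<Sum>i\<le>N. x i ^ 2) = 1 \<and> (\<forall>i>N. x i = 0)}" by (simp add: nsphere)
  have nk0: "nk p \<noteq> 0" if "p \<in> E" "p \<noteq> 0" for p
  proof
    assume "nk p = 0"
    then have "(\<Sum>i\<le>N. (k p i)\<^sup>2) = 0" by (simp add: nk_def)
    then have "k p i = 0" if "i \<le> N" for i using that by (simp add: sum_nonneg_eq_0_iff)
    then show False using k0 that by blast
  qed
  have k_zero: "k 0 i = 0" for i using khom[of 0 0 i] E by (simp add: subspace_0)
  \<comment> \<open>\<open>\<sigma>\<close> places the unit sphere on the inner boundary of
    \<open>Q\<close>; \<open>\<rho>\<close> below projects back radially, so that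
    \<open>\<rho> \<circ> \<sigma>\<close> is the identity of the sphere.\<close>
  define \<sigma> where "\<sigma> s = R *\<^sub>R J s" for s
  have JE: "J s \<in> E" if "s \<in> topspace ?S" for s
    using J(1) that by (auto simp: continuous_map_def Pi_iff)
  have k\<sigma>: "\<sigma> s \<in> E" "k (\<sigma> s) i = R * s i" if "s \<in> topspace ?S" for s i
    using JE[OF that] J(2)[OF that] khom E by (auto simp: \<sigma>_def subspace_scale)
  have nk\<sigma>: "nk (\<sigma> s) = R" if s: "s \<in> topspace ?S" for s
  proof -
    have "(\<Sum>i\<le>N. (k (\<sigma> s) i)\<^sup>2) = R\<^sup>2 * (\<Sum>i\<le>N. (s i)\<^sup>2)"
      by (simp add: k\<sigma>[OF s] power_mult_distrib sum_distrib_left)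
    then show ?thesis using s R by (simp add: nk_def topS)
  qed
  have c\<sigma>X: "continuous_map ?S ?X \<sigma>"
  proof -
    have "continuous_map ?S euclidean J" using J(1) by (simp add: continuous_map_in_subtopology)
    moreover have "continuous_map euclidean euclidean ((*\<^sub>R) R :: 'e \<Rightarrow> 'e)"
      by (simp add: continuous_on_scaleR)
    ultimately have "continuous_map ?S euclidean ((*\<^sub>R) R \<circ> J)" by (rule continuous_map_compose)
    then have "continuous_map ?S euclidean \<sigma>" by (simp add: \<sigma>_def[abs_def] o_def)
    then show ?thesis using k\<sigma>(1) by (auto simp: continuous_map_in_subtopology)
  qed
  have \<sigma>Q: "\<sigma> s \<in> Q" if "s \<in> topspace ?S" for s
    using nk\<sigma>[OF that] k\<sigma>(1)[OF that] by (simp add: Q nk_def)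
  have c\<sigma>: "continuous_map ?S (subtopology ?X Q) \<sigma>"
    using c\<sigma>X \<sigma>Q by (auto simp: continuous_map_in_subtopology)
  have QE: "Q \<subseteq> E - {0}" using R by (auto simp: Q k_zero)
  have rE: "r p \<noteq> 0" if "p \<in> E" "p \<noteq> 0" for p
  proof
    assume r0: "r p = 0"
    have "k p i = 0" for i
      using r(3)[OF that(1), of i] k_zero[of i] unfolding r0 by (simp split: if_splits)
    then show False using k0 that by blast
  qed
  define \<rho> where "\<rho> p i = k p i / nk p" for p i
  have cnk: "continuous_on E nk" unfolding nk_def by (intro continuous_intros kcont)
  have c\<rho>: "continuous_map (subtopology ?X (E - {0})) ?S \<rho>"
  proof -
    have "(\<Sum>i\<le>N. (\<rho> p i)\<^sup>2) = 1" if "p \<in> E" "p \<noteq> 0" for p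
    proof -
      have "(\<Sum>i\<le>N. (\<rho> p i)\<^sup>2) = (\<Sum>i\<le>N. (k p i)\<^sup>2) / (nk p)\<^sup>2"
        by (simp add: \<rho>_def power_divide sum_divide_distrib)
      also have "(\<Sum>i\<le>N. (k p i)\<^sup>2) = (nk p)\<^sup>2" by (simp add: nk_def sum_nonneg)
      finally show ?thesis using nk0[OF that] by simp
    qed
    moreover have "continuous_on (E - {0}) (\<lambda>p. \<rho> p i)" for i
      unfolding \<rho>_def using nk0
      by (intro continuous_on_divide continuous_on_subset[OF kcont] continuous_on_subset[OF cnk]) auto
    moreover have "\<rho> p i = 0" if "p \<in> E" "N < i" for p i using kN[OF that] by (simp add: \<rho>_def)
    ultimately show ?thesis unfolding nsphere
      by (auto simp: continuous_map_in_subtopology continuous_map_componentwise_UNIV subtopology_subtopology Int_absorb1)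
  qed
  have cr: "continuous_map ?X ?X r" using r(1,2) by (auto simp: continuous_map_in_subtopology)
  have crQ: "continuous_map (subtopology ?X Q) (subtopology ?X (E - {0})) r"
    using continuous_map_from_subtopology[OF cr, of Q] QE rE r(2) by (auto simp: continuous_map_in_subtopology)
  have ciQ: "continuous_map (subtopology ?X Q) (subtopology ?X (E - {0})) id"
    using continuous_map_from_subtopology[OF continuous_map_id[of ?X], of Q] QE
    by (auto simp: continuous_map_in_subtopology)
  have "contractible E" using E convex_imp_contractible subspace_imp_convex by blast
  moreover have "topspace ?X \<inter> Q \<noteq> {}" using \<sigma>Q[OF in_topspace_nsphere] QE by auto
  ultimately have iso: "hom_boundary ?m ?X Q \<in> iso (relative_homology_group ?m ?X Q) (reduced_homology_group (int N) (subtopology ?X Q))"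
    using iso_relative_homology_of_contractible[of ?X Q ?m] by simp
  have triv: "g = \<one>\<^bsub>?G\<^esub>" if g: "g \<in> carrier ?G" for g
  proof -
    have "hom_induced (int N) ?S {} (subtopology ?X Q) {} \<sigma> g \<in> carrier (reduced_homology_group (int N) (subtopology ?X Q))"
      using g by (rule hom_induced_reduced)
    also have "\<dots> = hom_boundary ?m ?X Q ` carrier (relative_homology_group ?m ?X Q)"
      using iso by (simp add: iso_def bij_betw_def)
    finally obtain x where x: "hom_induced (int N) ?S {} (subtopology ?X Q) {} \<sigma> g = hom_boundary ?m ?X Q x"
      by (rule imageE)
    \<comment> \<open>Naturality of the boundary moves the comparison to the sphere, where
      \<open>h\<close> becomes \<open>\<rho> \<circ> (h \<circ> \<sigma>)\<close>.\<close>
    have step: "hom_induced (int N) (subtopology ?X (E - {0})) {} ?S {} \<rho> (hom_boundary ?m ?X (E - {0}) (hom_induced ?m ?X Q ?X (E - {0}) h x))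
      = hom_induced (int N) ?S {} ?S {} (\<rho> \<circ> (h \<circ> \<sigma>)) g"
      if h: "continuous_map ?X ?X h" "h \<in> Q \<rightarrow> E - {0}" "continuous_map (subtopology ?X Q) (subtopology ?X (E - {0})) h" for h
    proof -
      have "hom_boundary ?m ?X (E - {0}) (hom_induced ?m ?X Q ?X (E - {0}) h x)
        = hom_induced (int N) (subtopology ?X Q) {} (subtopology ?X (E - {0})) {} h (hom_boundary ?m ?X Q x)"
        using fun_cong[OF naturality_hom_induced[OF h(1,2), of ?m], of x] by simp
      also have "\<dots> = hom_induced (int N) ?S {} (subtopology ?X (E - {0})) {} (h \<circ> \<sigma>) g"
        unfolding x[symmetric] by (rule hom_induced_compose') (use c\<sigma> h(3) in auto)
      also have "hom_induced (int N) (subtopology ?X (E - {0})) {} ?S {} \<rho> \<dots> = hom_induced (int N) ?S {} ?S {} (\<rho> \<circ> (h \<circ> \<sigma>)) g"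
        by (rule hom_induced_compose') (use c\<rho> continuous_map_compose[OF c\<sigma> h(3)] in auto)
      finally show ?thesis .
    qed
    have "hom_induced (int N) ?S {} ?S {} (\<rho> \<circ> (id \<circ> \<sigma>)) g = hom_induced (int N) ?S {} ?S {} (\<rho> \<circ> (r \<circ> \<sigma>)) g"
    proof -
      have "r \<in> Q \<rightarrow> E - {0}" "id \<in> Q \<rightarrow> E - {0}" using QE rE r(2) by auto
      then show ?thesis using step[OF cr _ crQ] step[of id, OF _ _ ciQ] eq[of x] by simp
    qed
    moreover have "hom_induced (int N) ?S {} ?S {} (\<rho> \<circ> (id \<circ> \<sigma>)) = hom_induced (int N) ?S {} ?S {} id"
      by (rule hom_induced_eq) (use R in \<open>auto simp: \<rho>_def nk\<sigma> k\<sigma> fun_eq_iff\<close>)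
    moreover have "hom_induced (int N) ?S {} ?S {} (\<rho> \<circ> (r \<circ> \<sigma>)) = hom_induced (int N) ?S {} ?S {} ?refl"
    proof (rule hom_induced_eq)
      fix s assume s: "s \<in> topspace ?S"
      have "nk (r (\<sigma> s)) = nk (\<sigma> s)" unfolding nk_def
        by (intro arg_cong[where f = sqrt] sum.cong refl) (simp add: r(3)[OF k\<sigma>(1)[OF s]])
      then show "(\<rho> \<circ> (r \<circ> \<sigma>)) s = ?refl s"
        using R s by (auto simp: \<rho>_def nk\<sigma> k\<sigma> r(3)[OF k\<sigma>(1)[OF s]] fun_eq_iff)
    qed
    ultimately have "hom_induced (int N) ?S {} ?S {} id g = hom_induced (int N) ?S {} ?S {} ?refl g" by simp
    also have "\<dots> = g [^]\<^bsub>?G\<^esub> (- 1 :: int)"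
      using Brouwer_degree2[OF g, of ?refl] by (simp only: Brouwer_degree2_reflection)
    \<comment> \<open>The identity acts as the exponent \<open>- 1\<close> only on a trivial
      element, since its degree is \<open>1\<close>.\<close>
    finally have "g = \<one>\<^bsub>?G\<^esub> \<or> Brouwer_degree2 N id = - 1"
      using Brouwer_degree2_iff[of N id g "- 1"] g by simp
    then show ?thesis by simp
  qed
  interpret group ?G by simp
  have "trivial_group ?G" unfolding trivial_group_def using triv by auto
  then show False by (simp add: trivial_reduced_homology_group_nsphere)
qed

text \<open>The homotopy \<open>H\<close> forces the models at its two ends to have the same degree,
  while \<open>G\<close> deforms one of them into the identity and the other into the reflection
  \<open>r\<close>; hence the conclusion \<open>False\<close>.\<close>

lemma linear_isos_same_degree:
  fixes E \<Omega> Z :: "'e::real_normed_vector set" and k :: "'e \<Rightarrow> nat \<Rightarrow> real" and N :: nat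
  assumes E: "subspace E" and \<Omega>: "open \<Omega>" and Z: "compact Z" "Z \<subseteq> \<Omega> \<inter> E"
    and H: "continuous_on ({0..1::real} \<times> (\<Omega> \<inter> E)) H" "\<And>c p. c \<in> {0..1} \<Longrightarrow> p \<in> \<Omega> \<inter> E \<Longrightarrow> H (c, p) \<in> E"
      "\<And>c p. c \<in> {0..1} \<Longrightarrow> p \<in> \<Omega> \<inter> E \<Longrightarrow> H (c, p) = 0 \<Longrightarrow> p \<in> Z"
    and z: "\<And>i. i \<in> {0, 1} \<Longrightarrow> z i \<in> Z" "0 < d" "\<And>i. i \<in> {0, 1} \<Longrightarrow> ball (z i) d \<subseteq> \<Omega>"
      "\<And>i p. i \<in> {0, 1} \<Longrightarrow> p \<in> \<Omega> \<inter> E \<Longrightarrow> H (i, p) = 0 \<Longrightarrow> p = z i"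
    and lin: "\<And>i p s. i \<in> {0, 1} \<Longrightarrow> p \<in> ball (z i) d \<inter> E \<Longrightarrow> s \<in> {0..1} \<Longrightarrow>
      (1 - s) *\<^sub>R H (i, p) + s *\<^sub>R G i (0, p - z i) = 0 \<Longrightarrow> p = z i"
    and G: "\<And>i. i \<in> {0, 1} \<Longrightarrow> continuous_on ({0..1::real} \<times> E) (G i)"
      "\<And>i t p. i \<in> {0, 1} \<Longrightarrow> t \<in> {0..1} \<Longrightarrow> p \<in> E \<Longrightarrow> G i (t, p) \<in> E"
      "\<And>i t p. i \<in> {0, 1} \<Longrightarrow> t \<in> {0..1} \<Longrightarrow> p \<in> E \<Longrightarrow> G i (t, p) = 0 \<Longrightarrow> p = 0"
      "{\<lambda>p. G 0 (1, p), \<lambda>p. G (1::real) (1, p)} = {id, r}"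
    and kcont: "\<And>i. continuous_on E (\<lambda>p. k p i)"
    and kN: "\<And>p i. p \<in> E \<Longrightarrow> N < i \<Longrightarrow> k p i = 0"
    and khom: "\<And>p t i. p \<in> E \<Longrightarrow> k (t *\<^sub>R p) i = t * k p i"
    and k0: "\<And>p. p \<in> E \<Longrightarrow> (\<And>i. i \<le> N \<Longrightarrow> k p i = 0) \<Longrightarrow> p = 0"
    and J: "continuous_map (nsphere N) (top_of_set E) J" "\<And>s. s \<in> topspace (nsphere N) \<Longrightarrow> k (J s) = s"
    and r: "continuous_on E r" "\<And>p. p \<in> E \<Longrightarrow> r p \<in> E" "\<And>p i. p \<in> E \<Longrightarrow> k (r p) i = (if i = 0 then - k p i else k p i)"
  shows False
proof -
  define nk where "nk p = sqrt (\<Sum>i\<le>N. (k p i)\<^sup>2)" for p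
  have cnk: "continuous_on E nk" unfolding nk_def by (intro continuous_intros kcont)
  have "compact (nk ` Z)" using Z by (intro compact_continuous_image continuous_on_subset[OF cnk]) auto
  then obtain b where b: "\<And>p. p \<in> Z \<Longrightarrow> nk p \<le> b" by (meson bounded_imp_bdd_above compact_imp_bounded bdd_above_def imageI)
  \<comment> \<open>Positive and strictly larger than \<open>nk\<close> on \<open>Z\<close>, so that
    \<open>Q\<close> misses both the origin and \<open>Z\<close>.\<close>
  define R where "R = \<bar>b\<bar> + 1"
  define Q where "Q = {p \<in> E. R \<le> nk p}"
  have R: "0 < R" by (simp add: R_def)
  have QZ: "Q \<subseteq> E" "Q \<inter> Z = {}" using b by (force simp: Q_def R_def)+
  have Qz: "t *\<^sub>R z i \<notin> Q" if i: "i \<in> {0, 1}" and t: "t \<in> {0..1}" for i t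
  proof -
    have zE: "z i \<in> E" using z(1)[OF i] Z by blast
    have "(\<Sum>j\<le>N. (k (t *\<^sub>R z i) j)\<^sup>2) = t\<^sup>2 * (\<Sum>j\<le>N. (k (z i) j)\<^sup>2)"
      by (simp add: khom[OF zE] power_mult_distrib sum_distrib_left)
    then have "nk (t *\<^sub>R z i) = t * nk (z i)" using t by (simp add: nk_def real_sqrt_mult)
    also have "\<dots> \<le> 1 * nk (z i)" using t by (intro mult_right_mono) (auto simp: nk_def sum_nonneg)
    also have "\<dots> < R" using b[OF z(1)[OF i]] by (simp add: R_def)
    finally show ?thesis by (simp add: Q_def)
  qed
  let ?X = "top_of_set E" and ?m = "1 + int N"
  have Mc: "continuous_on E (\<lambda>p. G i (0, p))" if "i \<in> {0, 1}" for i
    by (rule continuous_on_compose2[OF G(1)[OF that]]) (auto intro!: continuous_intros)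
  have ME: "G i (0, p) \<in> E" if "i \<in> {0, 1}" "p \<in> E" for i p using G(2)[OF that(1) _ that(2), of 0] by simp
  have M0: "p = 0" if "i \<in> {0, 1}" "p \<in> E" "G i (0, p) = 0" for i p
    using G(3)[OF that(1) _ that(2,3)] by simp
  have eq: "hom_induced ?m ?X Q ?X (E - {0}) (\<lambda>p. G 0 (0, p)) x = hom_induced ?m ?X Q ?X (E - {0}) (\<lambda>p. G 1 (0, p)) x" for x
    by (rule degree_homotopy_invariance[where M = "\<lambda>i p. G i (0, p)" and H = H and z = z and d = d and Z = Z and \<Omega> = \<Omega>];
      fact E \<Omega> Z QZ H z Mc ME M0 lin Qz)
  have hG: "hom_induced ?m ?X Q ?X (E - {0}) (\<lambda>p. G i (0, p)) = hom_induced ?m ?X Q ?X (E - {0}) (\<lambda>p. G i (1, p))"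
    if i: "i \<in> {0, 1}" for i
  proof (rule homology_homotopy_axiom, rule homotopic_with_canonI[where h = "G i"])
    have "k 0 j = 0" for j using khom[of 0 0 j] E by (simp add: subspace_0)
    then have "nk 0 = 0" by (simp add: nk_def)
    then have "0 \<notin> Q" using R by (simp add: Q_def)
    then show "(\<lambda>x. G i (t, x)) \<in> Q \<rightarrow> E - {0}" if "t \<in> {0..1}" for t
      using G(2,3)[OF i that] QZ(1) by auto
  qed (use G(1-3)[OF i] in auto)
  have "hom_induced ?m ?X Q ?X (E - {0}) id x = hom_induced ?m ?X Q ?X (E - {0}) r x" for x
  proof -
    have e: "hom_induced ?m ?X Q ?X (E - {0}) (\<lambda>p. G 0 (1, p)) x = hom_induced ?m ?X Q ?X (E - {0}) (\<lambda>p. G 1 (1, p)) x"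
      using eq[of x] hG[of 0] hG[of 1] by simp
    consider "(\<lambda>p. G 0 (1, p)) = id" "(\<lambda>p. G 1 (1, p)) = r" | "(\<lambda>p. G 0 (1, p)) = r" "(\<lambda>p. G 1 (1, p)) = id"
      using G(4) unfolding doubleton_eq_iff by blast
    then show ?thesis using e by cases (simp_all only:)
  qed
  moreover have Qeq: "Q = {p \<in> E. R \<le> sqrt (\<Sum>i\<le>N. (k p i)\<^sup>2)}" by (simp add: Q_def nk_def)
  have "\<exists>x. hom_induced ?m ?X Q ?X (E - {0}) id x \<noteq> hom_induced ?m ?X Q ?X (E - {0}) r x"
    by (rule reflection_homology_distinct[where k = k and J = J and R = R]; fact E kcont kN khom k0 J r R Qeq)
  ultimately show False by blast
qed

subsection \<open>Families of Fredholm operators\<close>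

text \<open>Continuity of \<open>g\<close> is known only in the ball of radius \<open>r\<close>; the
  factor vanishes on the open set beyond \<open>r / 2\<close>, and these two open sets cover
  \<open>C\<close>.\<close>

lemma continuous_on_cutoff_scaleR:
  fixes g :: "'x::metric_space \<Rightarrow> 'b::real_normed_vector"
  assumes r: "0 < r" and g: "continuous_on (C \<inter> ball d r) g"
  shows "continuous_on C (\<lambda>z. max 0 (r / 2 - dist z d) *\<^sub>R g z)"
proof -
  let ?h = "\<lambda>z. max 0 (r / 2 - dist z d) *\<^sub>R g z"
  have C: "C = (C \<inter> ball d r) \<union> (C - cball d (r / 2))" using r by (auto simp: dist_commute)
  have "continuous_on ((C \<inter> ball d r) \<union> (C - cball d (r / 2))) ?h"
  proof (rule continuous_on_Un_local_open)
    show "openin (top_of_set (C \<inter> ball d r \<union> (C - cball d (r / 2)))) (C \<inter> ball d r)"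
      unfolding C[symmetric] by (simp add: openin_open_Int)
    have "C - cball d (r / 2) = C \<inter> - cball d (r / 2)" by blast
    then show "openin (top_of_set (C \<inter> ball d r \<union> (C - cball d (r / 2)))) (C - cball d (r / 2))"
      unfolding C[symmetric] by (simp add: openin_open_Int open_Compl)
    show "continuous_on (C \<inter> ball d r) ?h" by (intro continuous_intros g)
    have "continuous_on (C - cball d (r / 2)) (\<lambda>z. 0 :: 'b)" by simp
    then show "continuous_on (C - cball d (r / 2)) ?h"
      by (rule continuous_on_eq) (auto simp: dist_commute max_def)
  qed
  then show ?thesis using C by simp
qed

text \<open>
  The quotients of \<open>V\<close> by the images of \<open>ker P\<close> form a vector bundle over \<open>C\<close>; transporting a frame
  along the rays from the origin trivializes it because \<open>C\<close> is star-shaped.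
\<close>

lemma fredholm_trivialization:
  fixes A :: "'x::real_normed_vector \<Rightarrow> 'u::banach \<Rightarrow>\<^sub>L 'v::banach"
  assumes C: "compact C" "0 \<in> C" "\<And>z t. z \<in> C \<Longrightarrow> t \<in> {0..1} \<Longrightarrow> t *\<^sub>R z \<in> C"
    and contA: "continuous_on C A" and Phi0: "A ` C \<subseteq> Phi0"
  obtains \<Psi> :: "('u \<Rightarrow>\<^sub>L real) set" where "finite \<Psi>"
    "\<And>P :: 'u \<Rightarrow>\<^sub>L 'u. (\<And>u. P (P u) = P u) \<Longrightarrow> finite_dim (range P) \<Longrightarrow>
      (\<And>u \<psi>. P u = 0 \<Longrightarrow> \<psi> \<in> \<Psi> \<Longrightarrow> \<psi> u = 0) \<Longrightarrow>
      \<exists>T. continuous_on C T \<and> T ` C \<subseteq> GL \<and> (\<forall>z\<in>C. \<forall>u. P u = 0 \<longrightarrow> T z u = A z u)"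
proof -
  define good where "good z f \<Psi> \<rho> \<longleftrightarrow> finite (\<Psi> :: ('u \<Rightarrow>\<^sub>L real) set) \<and>
      (\<forall>u. (\<forall>\<psi>\<in>\<Psi>. \<psi> u = 0) \<longrightarrow> blinfun_apply f u = 0) \<and>
      0 < \<rho> \<and> (\<forall>z'\<in>C. dist z' z < \<rho> \<longrightarrow> A z' + f \<in> GL)" for z f \<Psi> and \<rho> :: real
  have "\<exists>f \<Psi> \<rho>. good z f \<Psi> \<rho>" if z: "z \<in> C" for z
  proof -
    have "A z \<in> Phi0" using Phi0 z by blast
    then obtain f and \<Psi> :: "('u \<Rightarrow>\<^sub>L real) set" where f: "finite \<Psi>"
      "\<forall>u. (\<forall>\<psi>\<in>\<Psi>. \<psi> u = 0) \<longrightarrow> blinfun_apply f u = 0" "A z + f \<in> GL"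
      by (rule Phi0_finite_rank_perturb_GL) (rule that)
    have "\<exists>e>0. \<forall>B. dist B (A z + f) < e \<longrightarrow> B \<in> GL"
      using open_GL f(3) unfolding open_dist by (rule bspec)
    then obtain e where e: "0 < e" "\<And>B. dist B (A z + f) < e \<Longrightarrow> B \<in> GL" by auto
    obtain \<rho> where \<rho>: "0 < \<rho>" "\<And>z'. z' \<in> C \<Longrightarrow> dist z' z < \<rho> \<Longrightarrow> dist (A z') (A z) < e"
      using contA[unfolded continuous_on_iff, rule_format, OF z e(1)] by auto
    have "A z' + f \<in> GL" if "z' \<in> C" "dist z' z < \<rho>" for z'
      by (rule e(2)) (use \<rho>(2)[OF that] in \<open>simp add: dist_norm\<close>)
    then have "good z f \<Psi> \<rho>" unfolding good_def using f(1,2) \<rho>(1) by auto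
    then show ?thesis by blast
  qed
  then obtain f \<Psi> \<rho> where good: "\<And>z. z \<in> C \<Longrightarrow> good z (f z) (\<Psi> z) (\<rho> z)" by metis
  have fin\<Psi>: "finite (\<Psi> z)" and \<rho>: "0 < \<rho> z" if "z \<in> C" for z using good[OF that] by (auto simp: good_def)
  have f0: "f z u = 0" if "z \<in> C" "\<And>\<psi>. \<psi> \<in> \<Psi> z \<Longrightarrow> \<psi> u = 0" for z u
    using good[OF that(1)] that(2) by (auto simp: good_def)
  have fGL: "A z' + f z \<in> GL" if "z \<in> C" "z' \<in> C" "dist z' z < \<rho> z" for z z'
    using good[OF that(1)] that(2,3) by (auto simp: good_def)
  have "C \<subseteq> (\<Union>z\<in>C. ball z (\<rho> z / 2))" using \<rho> by force
  then obtain D where D: "D \<subseteq> C" "finite D" "C \<subseteq> (\<Union>z\<in>D. ball z (\<rho> z / 2))"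
    by (rule compactE_image[where S = C and C = C and f = "\<lambda>z. ball z (\<rho> z / 2)", rotated 2])
      (use C(1) in auto)
  show ?thesis
  proof (rule that[of "\<Union>(\<Psi> ` D)"])
    show "finite (\<Union>(\<Psi> ` D))" using D fin\<Psi> by blast
    fix P :: "'u \<Rightarrow>\<^sub>L 'u"
    assume PP: "\<And>u. P (P u) = P u" and finP: "finite_dim (range P)"
      and kerP: "\<And>u \<psi>. P u = 0 \<Longrightarrow> \<psi> \<in> \<Union>(\<Psi> ` D) \<Longrightarrow> \<psi> u = 0"
    have fP: "f d u = 0" if "d \<in> D" "P u = 0" for d u
      using that kerP D(1) by (intro f0) auto
    define \<beta> where "\<beta> d z = max 0 (\<rho> d / 2 - dist z d)" for d z
    define s where "s z = (\<Sum>d\<in>D. \<beta> d z)" for z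
    have s: "0 < s z" if z: "z \<in> C" for z
    proof -
      obtain d where "d \<in> D" "dist d z < \<rho> d / 2" using D(3) z by auto
      then show ?thesis unfolding s_def using D(2)
        by (intro sum_pos2[of _ d]) (auto simp: \<beta>_def dist_commute)
    qed
    have conts: "continuous_on C s" unfolding s_def \<beta>_def by (intro continuous_intros)
    \<comment> \<open>On the kernel of \<open>P\<close> all \<open>A z + f d\<close> agree with
      \<open>A z\<close>, so each of their inverses is a left inverse of \<open>A z\<close> there,
      and a weighted mean of left inverses is again one.\<close>
    define l where "l z = (1 / s z) *\<^sub>R (\<Sum>d\<in>D. \<beta> d z *\<^sub>R blinfun_inv (A z + f d))" for z
    have ct: "continuous_on C (\<lambda>z. \<beta> d z *\<^sub>R blinfun_inv (A z + f d))" if d: "d \<in> D" for d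
      unfolding \<beta>_def
    proof (rule continuous_on_cutoff_scaleR)
      show "0 < \<rho> d" using \<rho> D d by blast
      show "continuous_on (C \<inter> ball d (\<rho> d)) (\<lambda>z. blinfun_inv (A z + f d))"
      proof (rule continuous_on_inv_comp)
        show "continuous_on (C \<inter> ball d (\<rho> d)) (\<lambda>z. A z + f d)"
          by (intro continuous_on_add continuous_on_const continuous_on_subset[OF contA]) auto
        show "(\<lambda>z. A z + f d) ` (C \<inter> ball d (\<rho> d)) \<subseteq> GL" using fGL d D(1) by (auto simp: dist_commute)
      qed
    qed
    have contl: "continuous_on C l" unfolding l_def
    proof (rule continuous_on_scaleR)
      show "continuous_on C (\<lambda>z. 1 / s z)" using s by (intro continuous_on_divide continuous_on_const conts) force
      show "continuous_on C (\<lambda>z. \<Sum>d\<in>D. \<beta> d z *\<^sub>R blinfun_inv (A z + f d))"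
        by (rule continuous_on_sum) (rule ct)
    qed
    have lA: "l z (A z u) = u" if z: "z \<in> C" and u: "P u = 0" for z u
    proof -
      have "\<beta> d z *\<^sub>R blinfun_inv (A z + f d) (A z u) = \<beta> d z *\<^sub>R u" if d: "d \<in> D" for d
      proof (cases "dist z d < \<rho> d")
        case True
        have "A z u = (A z + f d) u" using fP[OF d u] by (simp add: blinfun.add_left)
        then show ?thesis using fGL[of d z] d D(1) z True by auto
      next
        case False
        then show ?thesis using \<rho>[of d] d D(1) by (auto simp: \<beta>_def)
      qed
      then have "(\<Sum>d\<in>D. \<beta> d z *\<^sub>R blinfun_inv (A z + f d) (A z u)) = (\<Sum>d\<in>D. \<beta> d z *\<^sub>R u)"
        by (rule sum.cong[OF refl])
      then have "l z (A z u) = (1 / s z) *\<^sub>R (\<Sum>d\<in>D. \<beta> d z *\<^sub>R u)"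
        by (simp only: l_def blinfun.scaleR_left blinfun.sum_left)
      also have "\<dots> = u" using s[OF z] by (simp add: scaleR_left.sum[symmetric] s_def[symmetric])
      finally show ?thesis .
    qed
    \<comment> \<open>The projection with kernel \<open>A z (ker P)\<close>; its range serves as the
      fibre of the quotient bundle at \<open>z\<close>.\<close>
    define q where "q z = id_blinfun - (A z o\<^sub>L (id_blinfun - P) o\<^sub>L l z)" for z
    have q: "q z v = v - A z (l z v - P (l z v))" for z v
      by (simp add: q_def blinfun.diff_left)
    have qA: "q z (A z u) = 0" if "z \<in> C" "P u = 0" for z u
      using lA[OF that] that by (simp add: q)
    have Pd: "P (u - P u) = 0" for u by (simp add: blinfun.diff_right PP)
    have qq: "q z (q z v) = q z v" if z: "z \<in> C" for z v
      using qA[OF z Pd, of "l z v"] by (subst (2) q) (simp add: blinfun.diff_right)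
    have contq: "continuous_on C q" unfolding q_def
      by (intro continuous_intros contl contA bounded_bilinear.continuous_on[OF bounded_bilinear_blinfun_compose])
    \<comment> \<open>A projection closer than \<open>1 / 2\<close> to another one cannot annihilate
      a nonzero vector fixed by the other, so projecting from a fibre to a nearby fibre is
      injective.\<close>
    obtain \<delta> where \<delta>: "0 < \<delta>" "\<And>z z'. z \<in> C \<Longrightarrow> z' \<in> C \<Longrightarrow> dist z' z < \<delta> \<Longrightarrow> dist (q z') (q z) < 1 / 2"
      using compact_uniformly_continuous[OF contq C(1)] unfolding uniformly_continuous_on_def
      by (metis half_gt_zero_iff zero_less_one)
    obtain b where b: "\<And>z. z \<in> C \<Longrightarrow> norm z \<le> b" using compact_imp_bounded[OF C(1)] bounded_iff by metis
    obtain m0 :: nat where m0: "b / \<delta> < real m0" using reals_Archimedean2 by blast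
    define m where "m = Suc m0"
    have m: "0 < real m" "b / real m < \<delta>" using m0 \<delta>(1) by (auto simp: m_def field_simps)
    define w where "w k z = (real k / real m) *\<^sub>R z" for k and z :: 'x
    have wC: "w k z \<in> C" if "k \<le> m" "z \<in> C" for k z
      unfolding w_def by (rule C(3)) (use that m in auto)
    obtain d0 where d0: "d0 \<in> D" "dist d0 0 < \<rho> d0 / 2" using D(3) C(2) by auto
    define T0 where "T0 = A 0 + f d0"
    have T0: "T0 \<in> GL" unfolding T0_def using d0 D(1) C(2) \<rho>[of d0] by (intro fGL) (auto simp: dist_commute)
    \<comment> \<open>Transport of a frame of the fibre at \<open>0\<close> to the point
      \<open>z\<close>, in \<open>m\<close> steps along the ray through the points
      \<open>w k z\<close>.\<close>
    define S where "S = rec_nat (\<lambda>z. q 0 o\<^sub>L T0) (\<lambda>k Sk z. q (w (Suc k) z) o\<^sub>L Sk z)"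
    have S0: "S 0 z = q 0 o\<^sub>L T0" and SS: "S (Suc k) z = q (w (Suc k) z) o\<^sub>L S k z" for k z
      by (simp_all add: S_def)
    have contS: "continuous_on C (S k)" if "k \<le> m" for k using that
    proof (induction k)
      case (Suc k)
      have "continuous_on C (\<lambda>z. q (w (Suc k) z))"
      proof (rule continuous_on_compose2[OF contq])
        show "continuous_on C (w (Suc k))" unfolding w_def by (intro continuous_intros)
        show "w (Suc k) ` C \<subseteq> C" using wC Suc.prems by blast
      qed
      then show ?case using Suc unfolding SS
        by (intro bounded_bilinear.continuous_on[OF bounded_bilinear_blinfun_compose]) auto
    qed (simp add: S0)
    have Snz: "S k z y \<noteq> 0 \<and> q (w k z) (S k z y) = S k z y" if "k \<le> m" "z \<in> C" "P y = y" "y \<noteq> 0" for k z y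
      using that(1)
    proof (induction k)
      case 0
      \<comment> \<open>\<open>T0\<close> maps the kernel of \<open>P\<close> onto the kernel of
        \<open>q 0\<close>; being injective, it sends no other vector there.\<close>
      have "q 0 (T0 y) \<noteq> 0"
      proof
        assume "q 0 (T0 y) = 0"
        define u where "u = l 0 (T0 y) - P (l 0 (T0 y))"
        have Pu: "P u = 0" unfolding u_def by (rule Pd)
        have "T0 y = A 0 u" using \<open>q 0 (T0 y) = 0\<close> by (simp add: q u_def)
        also have "\<dots> = T0 u" using fP[OF d0(1) Pu] by (simp add: T0_def blinfun.add_left)
        finally have "y = u" using T0 by (metis blinfun_inv_left)
        then show False using Pu that by simp
      qed
      then show ?case using qq[OF C(2)] by (simp add: S0 w_def)
    next
      case (Suc k)
      let ?v = "S k z y"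
      have IH: "?v \<noteq> 0" "q (w k z) ?v = ?v" using Suc by auto
      have "dist (w (Suc k) z) (w k z) = norm z / real m"
      proof -
        have "w (Suc k) z - w k z = (1 / real m) *\<^sub>R z" by (simp add: w_def algebra_simps add_divide_distrib)
        then show ?thesis by (simp add: dist_norm)
      qed
      also have "\<dots> \<le> b / real m" using b[OF that(2)] m by (intro divide_right_mono) auto
      finally have "dist (q (w (Suc k) z)) (q (w k z)) < 1 / 2"
        using \<delta>(2)[of "w k z" "w (Suc k) z"] wC[of k z] wC[of "Suc k" z] Suc.prems that(2) m by auto
      then have "norm ((q (w (Suc k) z) - q (w k z)) ?v) \<le> 1 / 2 * norm ?v"
        by (intro order_trans[OF norm_blinfun] mult_right_mono) (auto simp: dist_norm)
      then have "norm (q (w (Suc k) z) ?v - ?v) \<le> 1 / 2 * norm ?v" using IH by (simp add: blinfun.diff_left)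
      then have "q (w (Suc k) z) ?v \<noteq> 0" using IH(1) by auto
      then show ?case using qq[OF wC[OF Suc.prems that(2)]] by (simp add: SS)
    qed
    \<comment> \<open>\<open>A z\<close> on the kernel of \<open>P\<close> and the transported frame
      on its range; applying \<open>q z\<close> separates the two contributions, which gives
      injectivity.\<close>
    define T where "T z = (A z o\<^sub>L (id_blinfun - P)) + (S m z o\<^sub>L P)" for z
    have T: "T z u = A z (u - P u) + S m z (P u)" for z u by (simp add: T_def blinfun.add_left blinfun.diff_left)
    have Tker: "T z u = A z u" if "P u = 0" for z u using that by (simp add: T blinfun.zero_right)
    have Tinj: "u = 0" if z: "z \<in> C" and u: "T z u = 0" for z u
    proof -
      have wm: "w m z = z" using m by (simp add: w_def)
      have "P u = 0"
      proof (rule ccontr)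
        assume Pu: "P u \<noteq> 0"
        have n: "S m z (P u) \<noteq> 0 \<and> q z (S m z (P u)) = S m z (P u)" using Snz[OF _ z PP Pu, of m] wm by simp
        have "q z (T z u) = S m z (P u)" using n qA[OF z Pd] by (simp add: T blinfun.add_right)
        then show False using n u by (simp add: blinfun.zero_right)
      qed
      then have "A z u = 0" using u Tker by simp
      then show ?thesis using lA[OF z \<open>P u = 0\<close>] by (simp add: blinfun.zero_right)
    qed
    have "T z \<in> GL" if z: "z \<in> C" for z
    proof -
      obtain d where d: "d \<in> D" "dist d z < \<rho> d / 2" using D(3) z by auto
      define B where "B = A z + f d"
      have B: "B \<in> GL" unfolding B_def using d D(1) z \<rho>[of d] by (intro fGL) (auto simp: dist_commute)
      \<comment> \<open>Injectivity suffices because \<open>B\<inverse> T z\<close> is the identity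
        on the kernel of \<open>P\<close>.\<close>
      have "blinfun_inv B o\<^sub>L T z \<in> GL"
      proof (rule finite_rank_inj_GL[OF PP finP])
        fix u assume "P u = 0"
        then have "T z u = B u" using fP[OF d(1)] by (simp add: Tker B_def blinfun.add_left)
        then show "(blinfun_inv B o\<^sub>L T z) u = u" using B by simp
      next
        fix u assume "(blinfun_inv B o\<^sub>L T z) u = 0"
        then have "B (blinfun_inv B (T z u)) = B 0" by simp
        then show "u = 0" using B Tinj[OF z] by (simp add: blinfun.zero_right)
      qed
      then have "B o\<^sub>L (blinfun_inv B o\<^sub>L T z) \<in> GL" using B by (rule GL_compose[rotated])
      moreover have "B o\<^sub>L (blinfun_inv B o\<^sub>L T z) = T z" using B by (intro blinfun_eqI) simp
      ultimately show ?thesis by simp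
    qed
    moreover have "continuous_on C T" unfolding T_def
      by (intro continuous_intros contS contA bounded_bilinear.continuous_on[OF bounded_bilinear_blinfun_compose]) auto
    ultimately show "\<exists>T. continuous_on C T \<and> T ` C \<subseteq> GL \<and> (\<forall>z\<in>C. \<forall>u. P u = 0 \<longrightarrow> T z u = A z u)"
      using Tker by (intro exI[of _ T]) auto
  qed
qed

subsection \<open>Isomorphisms fixing a subspace of finite codimension\<close>

text \<open>In the splitting into the kernel and the range of a projection \<open>P\<close>, such an
  operator is block triangular with the identity on the kernel. Its corner on the range of
  \<open>P\<close> carries what would be the determinant.\<close>

definition kernel_fixing :: "('u::real_normed_vector \<Rightarrow>\<^sub>L 'u) \<Rightarrow> ('u \<Rightarrow>\<^sub>L 'u) set" where
  "kernel_fixing P = {N. \<forall>u. P u = 0 \<longrightarrow> blinfun_apply N u = u}"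

section \<open>Rank-one perturbations of the identity and reflections\<close>

definition rank_one :: "('u::real_normed_vector \<Rightarrow>\<^sub>L real) \<Rightarrow> 'u \<Rightarrow> 'u \<Rightarrow>\<^sub>L 'u" where
  "rank_one \<phi> w = blinfun_scaleR_left w o\<^sub>L \<phi>"

lemma rank_one_apply [simp]: "rank_one \<phi> w u = \<phi> u *\<^sub>R w"
  by (simp add: rank_one_def)

lemma continuous_on_rank_one [continuous_intros]:
  assumes "continuous_on S f" "continuous_on S g"
  shows "continuous_on S (\<lambda>x. rank_one (f x) (g x))"
  unfolding rank_one_def
  by (intro bounded_bilinear.continuous_on[OF bounded_bilinear_blinfun_compose] assms
      bounded_linear.continuous_on[OF bounded_linear_blinfun_scaleR_left])

text \<open>The Sherman-Morrison formula supplies the inverse.\<close>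

lemma rank_one_GL:
  fixes \<phi> :: "'u::real_normed_vector \<Rightarrow>\<^sub>L real"
  assumes "1 + \<phi> w \<noteq> 0"
  shows "id_blinfun + rank_one \<phi> w \<in> GL"
  unfolding GL_def
proof (intro CollectI exI[of _ "id_blinfun - rank_one \<phi> ((1 / (1 + \<phi> w)) *\<^sub>R w)"] conjI blinfun_eqI)
  let ?c = "1 + \<phi> w"
  fix u
  have eq: "\<phi> u / ?c * ?c = \<phi> u" using assms by simp
  have "((id_blinfun + rank_one \<phi> w) o\<^sub>L (id_blinfun - rank_one \<phi> ((1 / ?c) *\<^sub>R w))) u
    = u + (\<phi> u - \<phi> u / ?c * ?c) *\<^sub>R w"
    by (simp add: blinfun.bilinear_simps algebra_simps add_divide_distrib)
  then show "((id_blinfun + rank_one \<phi> w) o\<^sub>L (id_blinfun - rank_one \<phi> ((1 / ?c) *\<^sub>R w))) u = id_blinfun u"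
    using eq by simp
  have "((id_blinfun - rank_one \<phi> ((1 / ?c) *\<^sub>R w)) o\<^sub>L (id_blinfun + rank_one \<phi> w)) u
    = u + (\<phi> u - \<phi> u / ?c * ?c) *\<^sub>R w"
    by (simp add: blinfun.bilinear_simps algebra_simps add_divide_distrib)
  then show "((id_blinfun - rank_one \<phi> ((1 / ?c) *\<^sub>R w)) o\<^sub>L (id_blinfun + rank_one \<phi> w)) u = id_blinfun u"
    using eq by simp
qed

lemma path_componentI:
  assumes "continuous_on {0..1::real} g" "\<And>t. t \<in> {0..1} \<Longrightarrow> g t \<in> S" "g 0 = x" "g 1 = y"
  shows "path_component S x y"
  unfolding path_component_def
  by (intro exI[of _ g]) (use assms in \<open>auto simp: path_def path_image_def pathstart_def pathfinish_def\<close>)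

lemma path_component_blinfun_compose:
  assumes "path_component (GL \<inter> kernel_fixing P) A B" "C \<in> GL \<inter> kernel_fixing P"
  shows "path_component (GL \<inter> kernel_fixing P) (A o\<^sub>L C) (B o\<^sub>L C)"
    and "path_component (GL \<inter> kernel_fixing P) (C o\<^sub>L A) (C o\<^sub>L B)"
proof -
  obtain g where g': "path g" "path_image g \<subseteq> GL \<inter> kernel_fixing P" "pathstart g = A" "pathfinish g = B"
    using assms(1) unfolding path_component_def by auto
  then have g: "continuous_on {0..1} g" "\<And>t. t \<in> {0..1} \<Longrightarrow> g t \<in> GL \<inter> kernel_fixing P" "g 0 = A" "g 1 = B"
    by (auto simp: path_def path_image_def pathstart_def pathfinish_def)
  show "path_component (GL \<inter> kernel_fixing P) (A o\<^sub>L C) (B o\<^sub>L C)"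
    by (rule path_componentI[where g = "\<lambda>t. g t o\<^sub>L C"])
      (use g assms(2) in \<open>auto intro!: bounded_bilinear.continuous_on[OF bounded_bilinear_blinfun_compose]
        continuous_intros GL_compose simp: kernel_fixing_def\<close>)
  show "path_component (GL \<inter> kernel_fixing P) (C o\<^sub>L A) (C o\<^sub>L B)"
    by (rule path_componentI[where g = "\<lambda>t. C o\<^sub>L g t"])
      (use g assms(2) in \<open>auto intro!: bounded_bilinear.continuous_on[OF bounded_bilinear_blinfun_compose]
        continuous_intros GL_compose simp: kernel_fixing_def\<close>)
qed

text \<open>For \<open>\<phi> w \<noteq> 0\<close> this is the oblique reflection that fixes the
  kernel of \<open>\<phi>\<close> and sends \<open>w\<close> to \<open>- w\<close>; nonzero scaling
  of either argument does not change it.\<close>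

definition refl_blinfun :: "('u::real_normed_vector \<Rightarrow>\<^sub>L real) \<Rightarrow> 'u \<Rightarrow> 'u \<Rightarrow>\<^sub>L 'u" where
  "refl_blinfun \<phi> w = id_blinfun + rank_one \<phi> ((- 2 / \<phi> w) *\<^sub>R w)"

lemma refl_blinfun_GL: "blinfun_apply \<phi> w \<noteq> 0 \<Longrightarrow> refl_blinfun \<phi> w \<in> GL"
  unfolding refl_blinfun_def by (rule rank_one_GL) (simp add: blinfun.bilinear_simps)

lemma refl_blinfun_kernel_fixing:
  "(\<And>u. blinfun_apply P u = 0 \<Longrightarrow> blinfun_apply \<phi> u = 0) \<Longrightarrow> refl_blinfun \<phi> w \<in> kernel_fixing P"
  by (simp add: refl_blinfun_def kernel_fixing_def blinfun.bilinear_simps)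

lemma refl_blinfun_involution: "blinfun_apply \<phi> w \<noteq> 0 \<Longrightarrow> refl_blinfun \<phi> w o\<^sub>L refl_blinfun \<phi> w = id_blinfun"
proof (rule blinfun_eqI)
  fix u assume nz: "\<phi> w \<noteq> 0"
  have r: "refl_blinfun \<phi> w u = u - (2 * \<phi> u / \<phi> w) *\<^sub>R w" for u
    by (simp add: refl_blinfun_def blinfun.bilinear_simps mult.commute)
  have "\<phi> (refl_blinfun \<phi> w u) = - \<phi> u" using nz by (simp add: r blinfun.bilinear_simps)
  then have "refl_blinfun \<phi> w (refl_blinfun \<phi> w u) = u" by (subst r) (simp add: r)
  then show "(refl_blinfun \<phi> w o\<^sub>L refl_blinfun \<phi> w) u = id_blinfun u" by simp
qed

lemma refl_blinfun_minus [simp]: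
  "refl_blinfun (- \<phi>) w = refl_blinfun \<phi> w" "refl_blinfun \<phi> (- w) = refl_blinfun \<phi> w"
  by (auto intro!: blinfun_eqI simp: refl_blinfun_def blinfun.bilinear_simps)

text \<open>\<open>w\<close> moves to \<open>x\<close>, then \<open>\<phi>\<close> to
  \<open>\<psi>\<close>, then \<open>x\<close> to \<open>v\<close>, always along segments; the
  pairing of functional and vector stays positive by convexity, so every reflection on the way is
  defined.\<close>

lemma path_component_refl_blinfun_common_pos:
  fixes P :: "'u::real_normed_vector \<Rightarrow>\<^sub>L 'u" and \<phi> \<psi> :: "'u \<Rightarrow>\<^sub>L real"
  assumes P: "\<And>u. P u = 0 \<Longrightarrow> \<phi> u = 0" "\<And>u. P u = 0 \<Longrightarrow> \<psi> u = 0"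
    and pos: "0 < \<phi> w" "0 < \<psi> v" "0 < \<phi> x" "0 < \<psi> x"
  shows "path_component (GL \<inter> kernel_fixing P) (refl_blinfun \<phi> w) (refl_blinfun \<psi> v)"
proof -
  have cp: "0 < (1 - t) * a + t * b" if "0 < a" "0 < b" "t \<in> {0..1}" for a b t :: real
    using that by (cases "t = 0") (auto intro: add_nonneg_pos)
  have 1: "path_component (GL \<inter> kernel_fixing P) (refl_blinfun \<chi>' a) (refl_blinfun \<chi>' b)"
    if "\<And>u. P u = 0 \<Longrightarrow> \<chi>' u = 0" "0 < \<chi>' a" "0 < \<chi>' b" for \<chi>' :: "'u \<Rightarrow>\<^sub>L real" and a b
  proof (rule path_componentI[where g = "\<lambda>t. refl_blinfun \<chi>' ((1 - t) *\<^sub>R a + t *\<^sub>R b)"])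
    have nz: "0 < \<chi>' ((1 - t) *\<^sub>R a + t *\<^sub>R b)" if "t \<in> {0..1}" for t
      using cp[OF \<open>0 < \<chi>' a\<close> \<open>0 < \<chi>' b\<close> that] by (simp add: blinfun.bilinear_simps)
    show "continuous_on {0..1} (\<lambda>t. refl_blinfun \<chi>' ((1 - t) *\<^sub>R a + t *\<^sub>R b))"
      unfolding refl_blinfun_def using nz by (intro continuous_intros) force
    fix t :: real assume "t \<in> {0..1}"
    then show "refl_blinfun \<chi>' ((1 - t) *\<^sub>R a + t *\<^sub>R b) \<in> GL \<inter> kernel_fixing P"
      using nz[of t] that(1) by (auto intro!: refl_blinfun_GL refl_blinfun_kernel_fixing)
  qed auto
  have 2: "path_component (GL \<inter> kernel_fixing P) (refl_blinfun \<phi> x) (refl_blinfun \<psi> x)"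
  proof (rule path_componentI[where g = "\<lambda>t. refl_blinfun ((1 - t) *\<^sub>R \<phi> + t *\<^sub>R \<psi>) x"])
    have nz: "0 < ((1 - t) *\<^sub>R \<phi> + t *\<^sub>R \<psi>) x" if "t \<in> {0..1}" for t
      using cp[OF pos(3,4) that] by (simp add: blinfun.bilinear_simps)
    show "continuous_on {0..1} (\<lambda>t. refl_blinfun ((1 - t) *\<^sub>R \<phi> + t *\<^sub>R \<psi>) x)"
      unfolding refl_blinfun_def using nz by (intro continuous_intros) force
    fix t :: real assume "t \<in> {0..1}"
    then show "refl_blinfun ((1 - t) *\<^sub>R \<phi> + t *\<^sub>R \<psi>) x \<in> GL \<inter> kernel_fixing P"
      using nz[of t] P by (auto intro!: refl_blinfun_GL refl_blinfun_kernel_fixing simp: blinfun.bilinear_simps)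
  qed auto
  show ?thesis using 1[OF P(1) pos(1,3)] 2 1[OF P(2) pos(4,2)] by (meson path_component_trans)
qed

text \<open>Both arguments may change sign without changing the reflection, so the positivity
  required before can be arranged once a vector \<open>x0\<close> outside both hyperplanes is
  found.\<close>

lemma path_component_refl_blinfun:
  fixes P :: "'u::real_normed_vector \<Rightarrow>\<^sub>L 'u" and \<phi> \<psi> :: "'u \<Rightarrow>\<^sub>L real"
  assumes P: "\<And>u. P u = 0 \<Longrightarrow> \<phi> u = 0" "\<And>u. P u = 0 \<Longrightarrow> \<psi> u = 0"
    and nz: "\<phi> w \<noteq> 0" "0 < \<psi> v"
  shows "path_component (GL \<inter> kernel_fixing P) (refl_blinfun \<phi> w) (refl_blinfun \<psi> v)"
proof -
  \<comment> \<open>Either \<open>v\<close> or \<open>w\<close> avoids both hyperplanes, or each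
    lies in the hyperplane of the other functional and then their sum avoids both.\<close>
  obtain x0 where x0: "\<phi> x0 \<noteq> 0" "\<psi> x0 \<noteq> 0"
  proof (cases "\<phi> v = 0 \<and> \<psi> w = 0")
    case True
    then show ?thesis using that[of "w + v"] nz by (simp add: blinfun.add_right)
  qed (use that nz in auto)
  define x where "x = (if 0 < \<psi> x0 then x0 else - x0)"
  have x: "\<phi> x \<noteq> 0" "0 < \<psi> x" using x0 by (auto simp: x_def blinfun.minus_right)
  define \<phi>' where "\<phi>' = (if 0 < \<phi> x then \<phi> else - \<phi>)"
  have p: "0 < \<phi>' x" using x by (auto simp: \<phi>'_def blinfun.minus_left)
  define w' where "w' = (if 0 < \<phi>' w then w else - w)"
  have w': "0 < \<phi>' w'" using nz by (auto simp: w'_def \<phi>'_def blinfun.bilinear_simps)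
  have "path_component (GL \<inter> kernel_fixing P) (refl_blinfun \<phi>' w') (refl_blinfun \<psi> v)"
    by (rule path_component_refl_blinfun_common_pos[where x = x]) (use P w' nz p x in \<open>auto simp: \<phi>'_def blinfun.minus_left\<close>)
  moreover have "refl_blinfun \<phi>' w' = refl_blinfun \<phi> w" by (simp add: \<phi>'_def w'_def)
  ultimately show ?thesis by simp
qed

text \<open>\<open>1 + \<phi> w\<close> plays the role of the determinant: if it is positive,
  \<open>w\<close> can be shrunk to \<open>0\<close>; if it is negative, \<open>w\<close> can be
  rescaled until the operator is a reflection.\<close>

lemma path_component_rank_one:
  fixes P :: "'u::real_normed_vector \<Rightarrow>\<^sub>L 'u" and \<phi> \<psi> :: "'u \<Rightarrow>\<^sub>L real"
  assumes P: "\<And>u. P u = 0 \<Longrightarrow> \<phi> u = 0" "\<And>u. P u = 0 \<Longrightarrow> \<psi> u = 0"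
    and nz: "1 + \<phi> w \<noteq> 0" "0 < \<psi> v"
  shows "path_component (GL \<inter> kernel_fixing P) (id_blinfun + rank_one \<phi> w) id_blinfun \<or>
    path_component (GL \<inter> kernel_fixing P) (id_blinfun + rank_one \<phi> w) (refl_blinfun \<psi> v)"
proof (cases "0 < 1 + \<phi> w")
  case True
  have "path_component (GL \<inter> kernel_fixing P) (id_blinfun + rank_one \<phi> w) id_blinfun"
  proof (rule path_componentI[where g = "\<lambda>t. id_blinfun + rank_one \<phi> ((1 - t) *\<^sub>R w)"])
    fix t :: real assume t: "t \<in> {0..1}"
    have "0 < (1 - t) * (1 + \<phi> w) + t" using True t by (cases "t = 1") (auto intro: add_pos_nonneg)
    then have "1 + \<phi> ((1 - t) *\<^sub>R w) \<noteq> 0" by (simp add: blinfun.bilinear_simps algebra_simps)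
    then show "id_blinfun + rank_one \<phi> ((1 - t) *\<^sub>R w) \<in> GL \<inter> kernel_fixing P"
      using P(1) by (auto intro!: rank_one_GL simp: kernel_fixing_def blinfun.bilinear_simps)
  qed (auto intro!: continuous_intros blinfun_eqI simp: blinfun.bilinear_simps)
  then show ?thesis by blast
next
  case False
  then have c: "1 + \<phi> w < 0" using nz by simp
  have "path_component (GL \<inter> kernel_fixing P) (id_blinfun + rank_one \<phi> w) (refl_blinfun \<phi> w)"
  proof (rule path_componentI[where g = "\<lambda>t. id_blinfun + rank_one \<phi> (((1 - t) + t * (- 2 / \<phi> w)) *\<^sub>R w)"])
    fix t :: real assume t: "t \<in> {0..1}"
    \<comment> \<open>Along the path the determinant runs linearly from \<open>1 + \<phi> w\<close>
      to \<open>- 1\<close>, both negative.\<close>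
    have "1 + \<phi> (((1 - t) + t * (- 2 / \<phi> w)) *\<^sub>R w) = (1 - t) * (1 + \<phi> w) - t"
      using c by (simp add: blinfun.bilinear_simps field_simps)
    also have "\<dots> < 0"
    proof (cases "t = 1")
      case False
      then have "(1 - t) * (1 + \<phi> w) < 0" using c t by (intro mult_pos_neg) auto
      then show ?thesis using t by simp
    qed simp
    finally show "id_blinfun + rank_one \<phi> (((1 - t) + t * (- 2 / \<phi> w)) *\<^sub>R w) \<in> GL \<inter> kernel_fixing P"
      using P(1) by (auto intro!: rank_one_GL simp: kernel_fixing_def blinfun.bilinear_simps)
  qed (use c in \<open>auto intro!: continuous_intros simp: refl_blinfun_def\<close>)
  moreover have "path_component (GL \<inter> kernel_fixing P) (refl_blinfun \<phi> w) (refl_blinfun \<psi> v)"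
    by (rule path_component_refl_blinfun) (use P nz c in auto)
  ultimately show ?thesis by (meson path_component_trans)
qed

text \<open>
  Gaussian elimination: multiplication by rank-one perturbations of the identity makes an operator
  fix the basis vectors one after the other.
\<close>

lemma kernel_fixing_path_component:
  fixes P M :: "'u::real_normed_vector \<Rightarrow>\<^sub>L 'u" and b :: "nat \<Rightarrow> 'u" and \<phi> :: "nat \<Rightarrow> 'u \<Rightarrow>\<^sub>L real"
  assumes b: "\<And>i j. i < n \<Longrightarrow> j < n \<Longrightarrow> \<phi> i (b j) = (if i = j then 1 else 0)"
    and P: "\<And>u. P u = (\<Sum>i<n. \<phi> i u *\<^sub>R b i)"
    and M: "M \<in> GL \<inter> kernel_fixing P"
  shows "path_component (GL \<inter> kernel_fixing P) M id_blinfun \<or>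
    0 < n \<and> path_component (GL \<inter> kernel_fixing P) M (refl_blinfun (\<phi> 0) (b 0))"
proof -
  let ?S = "GL \<inter> kernel_fixing P" and ?r = "refl_blinfun (\<phi> 0) (b 0)"
  have \<phi>P: "\<phi> j (P u) = \<phi> j u" if "j < n" for j u
  proof -
    have "\<phi> j (P u) = (\<Sum>i<n. if i = j then \<phi> j u else 0)"
      unfolding P blinfun.sum_right using b that by (intro sum.cong) (auto simp: blinfun.bilinear_simps)
    then show ?thesis using that by simp
  qed
  have Pd: "P (u - P u) = 0" for u
  proof -
    have "P (P u) = (\<Sum>i<n. \<phi> i (P u) *\<^sub>R b i)" by (rule P)
    also have "\<dots> = (\<Sum>i<n. \<phi> i u *\<^sub>R b i)" by (intro sum.cong refl) (simp add: \<phi>P)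
    also have "\<dots> = P u" by (rule P[symmetric])
    finally show ?thesis by (simp add: blinfun.diff_right)
  qed
  have \<phi>0: "\<phi> j u = 0" if "j < n" "P u = 0" for j u using \<phi>P[OF that(1), of u] that(2) by (simp add: blinfun.zero_right)
  \<comment> \<open>\<open>m\<close> counts the basis vectors not yet fixed; elimination proceeds
    from the low indices upwards.\<close>
  have "path_component ?S M id_blinfun \<or> 0 < n \<and> path_component ?S M ?r"
    if "m \<le> n" "M \<in> ?S" "\<And>j. j < n - m \<Longrightarrow> M (b j) = b j" for m M
    using that
  proof (induction m arbitrary: M)
    case 0
    have "M u = u" for u
    proof -
      have "P (u - P u) = 0" by (rule Pd)
      then have "M (u - P u) = u - P u" using 0(2) by (simp add: kernel_fixing_def)
      moreover have "M (P u) = P u" using 0(3) by (simp add: P blinfun.sum_right blinfun.scaleR_right)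
      ultimately show ?thesis by (simp add: blinfun.diff_right)
    qed
    then have "M = id_blinfun" by (intro blinfun_eqI) simp
    then show ?case using 0(2) by (auto simp: path_component_refl_eq)
  next
    case (Suc m)
    define i where "i = n - Suc m"
    have i: "i < n" "n - m = Suc i" using Suc.prems(1) by (auto simp: i_def)
    define x y where "x = b i" and "y = M x"
    have MG: "M \<in> GL" and MK: "\<And>u. P u = 0 \<Longrightarrow> M u = u" using Suc.prems(2) by (auto simp: kernel_fixing_def)
    have \<phi>x: "\<phi> j x = (if j = i then 1 else 0)" if "j < n" for j using b[OF that i(1)] by (simp add: x_def)
    \<comment> \<open>Otherwise \<open>P y\<close> would combine vectors already fixed, so
      \<open>M\<close> would fix \<open>y = M x\<close>, and injectivity would give
      \<open>y = x\<close>, whose coordinate \<open>i\<close> is \<open>1\<close>.\<close>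
    have "\<exists>j<n. i \<le> j \<and> \<phi> j y \<noteq> 0"
    proof (rule ccontr)
      assume neg: "\<not> ?thesis"
      have Py: "P y = (\<Sum>j<i. \<phi> j y *\<^sub>R b j)"
        unfolding P by (rule sum.mono_neutral_right) (use i neg in auto)
      have "P (y - P y) = 0" by (rule Pd)
      then have "M (y - P y) = y - P y" by (rule MK)
      moreover have "M (P y) = P y" unfolding Py using Suc.prems(3)
        by (simp add: blinfun.sum_right blinfun.scaleR_right i_def)
      ultimately have "M y = M x" by (simp add: blinfun.diff_right y_def)
      then have "y = x" using MG by (metis blinfun_inv_left)
      then show False using neg \<phi>x[OF i(1)] i(1) by auto
    qed
    then obtain j where j: "j < n" "i \<le> j" "\<phi> j y \<noteq> 0" by blast
    \<comment> \<open>Needed are \<open>\<psi> y = 1\<close>, \<open>\<psi> x \<noteq> 0\<close> and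
      \<open>\<psi> = 0\<close> on the earlier basis vectors. When coordinate \<open>i\<close> of
      \<open>y\<close> vanishes, the pivot \<open>j > i\<close> provides the first and the summand
      \<open>\<phi> i\<close> the second.\<close>
    define \<psi> where "\<psi> = (if \<phi> i y \<noteq> 0 then (1 / \<phi> i y) *\<^sub>R \<phi> i else (1 / \<phi> j y) *\<^sub>R \<phi> j + \<phi> i)"
    have \<psi>y: "\<psi> y = 1" using j by (auto simp: \<psi>_def blinfun.bilinear_simps)
    have \<psi>x: "\<psi> x \<noteq> 0" using j \<phi>x[OF i(1)] \<phi>x[OF j(1)] by (auto simp: \<psi>_def blinfun.bilinear_simps)
    have \<psi>0: "\<psi> u = 0" if "P u = 0" for u
      using \<phi>0[OF i(1) that] \<phi>0[OF j(1) that] by (simp add: \<psi>_def blinfun.bilinear_simps)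
    have \<psi>b: "\<psi> (b k) = 0" if "k < i" for k
      using b[OF i(1), of k] b[OF j(1), of k] that i j by (auto simp: \<psi>_def blinfun.bilinear_simps)
    \<comment> \<open>This factor carries \<open>y\<close> back to \<open>x\<close> and leaves the
      earlier basis vectors alone; \<open>1 + \<psi> (x - y) = \<psi> x\<close> makes it
      invertible.\<close>
    define s where "s = id_blinfun + rank_one \<psi> (x - y)"
    have s: "s u = u + \<psi> u *\<^sub>R (x - y)" for u by (simp add: s_def blinfun.bilinear_simps)
    have ne: "1 + \<psi> (x - y) \<noteq> 0" using \<psi>x \<psi>y by (simp add: blinfun.bilinear_simps)
    have sS: "s \<in> ?S" using rank_one_GL[OF ne] \<psi>0 by (auto simp: s kernel_fixing_def) (simp add: s_def)
    have sMS: "s o\<^sub>L M \<in> ?S" using sS Suc.prems(2) by (auto intro: GL_compose simp: kernel_fixing_def)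
    have "(s o\<^sub>L M) (b k) = b k" if "k < n - m" for k
    proof (cases "k = i")
      case True
      then show ?thesis using \<psi>y by (simp add: s x_def[symmetric] y_def[symmetric])
    next
      case False
      then have "k < i" using that i by simp
      then show ?thesis using Suc.prems(3)[of k] \<psi>b by (simp add: s i_def)
    qed
    then have IH: "path_component ?S (s o\<^sub>L M) id_blinfun \<or> 0 < n \<and> path_component ?S (s o\<^sub>L M) ?r"
      using Suc.IH[OF _ sMS] Suc.prems(1) by simp
    have n0: "0 < n" using i by simp
    have b0: "\<phi> 0 (b 0) = 1" using b[OF n0 n0] by simp
    have rS: "?r \<in> ?S" using b0 \<phi>0[OF n0] by (auto intro!: refl_blinfun_GL refl_blinfun_kernel_fixing)
    have idM: "id_blinfun o\<^sub>L M = M" by (intro blinfun_eqI) simp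
    have rr: "?r o\<^sub>L ?r = id_blinfun" using b0 by (intro refl_blinfun_involution) simp
    have rid: "?r o\<^sub>L id_blinfun = ?r" by (intro blinfun_eqI) simp
    have "path_component ?S s id_blinfun \<or> path_component ?S s ?r"
      unfolding s_def by (rule path_component_rank_one[OF \<psi>0 \<phi>0[OF n0] ne]) (use b0 in auto)
    then show ?case
    proof
      assume "path_component ?S s id_blinfun"
      then have "path_component ?S (s o\<^sub>L M) M" using path_component_blinfun_compose(1)[OF _ Suc.prems(2)] idM by metis
      then show ?thesis using IH by (meson path_component_sym path_component_trans)
    next
      assume "path_component ?S s ?r"
      then have 1: "path_component ?S (s o\<^sub>L M) (?r o\<^sub>L M)" by (rule path_component_blinfun_compose(1)[OF _ Suc.prems(2)])
      have rrM: "?r o\<^sub>L (?r o\<^sub>L M) = M"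
      proof (rule blinfun_eqI)
        fix u
        have "(?r o\<^sub>L ?r) (M u) = M u" unfolding rr by simp
        then show "(?r o\<^sub>L (?r o\<^sub>L M)) u = M u" by simp
      qed
      have 2: "path_component ?S M (?r o\<^sub>L (s o\<^sub>L M))"
        using path_component_blinfun_compose(2)[OF path_component_sym[OF 1] rS] rrM by simp
      from IH show ?thesis
      proof
        assume "path_component ?S (s o\<^sub>L M) id_blinfun"
        from path_component_blinfun_compose(2)[OF this rS] have "path_component ?S (?r o\<^sub>L (s o\<^sub>L M)) ?r" using rid by simp
        then show ?thesis using 2 n0 by (meson path_component_trans)
      next
        assume "0 < n \<and> path_component ?S (s o\<^sub>L M) ?r"
        then have "path_component ?S (?r o\<^sub>L (s o\<^sub>L M)) id_blinfun"
          using path_component_blinfun_compose(2)[OF _ rS, of "s o\<^sub>L M" ?r] rr by simp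
        then show ?thesis using 2 by (meson path_component_trans)
      qed
    qed
  qed
  from this[of n M] M show ?thesis by simp
qed

subsection \<open>Extension and analytic approximation\<close>

text \<open>Tent functions on a finite net give a partition of unity on \<open>K\<close> whose
  weights are defined on the whole space. It serves both the extension theorem and the polynomial
  approximation.\<close>

lemma compact_partition_approx:
  fixes f :: "'m::metric_space \<Rightarrow> 'b::real_normed_vector"
  assumes K: "compact K" and f: "continuous_on K f" and e: "0 < e"
  obtains D and w :: "'m \<Rightarrow> 'm \<Rightarrow> real" where "finite D" "D \<subseteq> K" "\<forall>d. continuous_on UNIV (w d)"
    "\<forall>d x. 0 \<le> w d x" "\<forall>x. (\<Sum>d\<in>D. w d x) \<le> 1"
    "\<forall>x\<in>K. norm (f x - (\<Sum>d\<in>D. w d x *\<^sub>R f d)) \<le> e"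
proof (cases "K = {}")
  case True
  then show ?thesis using that[of "{}" "\<lambda>_ _. 0"] by simp
next
  case False
  obtain \<delta> where \<delta>: "0 < \<delta>" "\<And>x y. x \<in> K \<Longrightarrow> y \<in> K \<Longrightarrow> dist y x < \<delta> \<Longrightarrow> dist (f y) (f x) < e"
    using compact_uniformly_continuous[OF f K] e unfolding uniformly_continuous_on_def by metis
  have "K \<subseteq> (\<Union>x\<in>K. ball x \<delta>)" using \<delta> by force
  then obtain D where D: "D \<subseteq> K" "finite D" "K \<subseteq> (\<Union>x\<in>D. ball x \<delta>)"
    by (rule compactE_image[where S = K and C = K and f = "\<lambda>x. ball x \<delta>", rotated 2]) (use K in auto)
  define \<beta> where "\<beta> d x = max 0 (\<delta> - dist x d)" for d x :: 'm
  define s where "s x = (\<Sum>d\<in>D. \<beta> d x)" for x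
  have cs: "continuous_on S s" for S unfolding s_def \<beta>_def by (intro continuous_intros)
  have s: "0 < s x" if x: "x \<in> K" for x
  proof -
    obtain d where "d \<in> D" "dist d x < \<delta>" using D(3) x by auto
    then show ?thesis unfolding s_def using D(2)
      by (intro sum_pos2[of _ d]) (auto simp: \<beta>_def dist_commute)
  qed
  obtain x0 where x0: "x0 \<in> K" "\<And>x. x \<in> K \<Longrightarrow> s x0 \<le> s x"
    using continuous_attains_inf[OF K False cs] by blast
  \<comment> \<open>The minimum of \<open>s\<close> on \<open>K\<close>. Dividing by
    \<open>max \<mu> (s x)\<close> equals dividing by \<open>s x\<close> on \<open>K\<close> and
    keeps the weights continuous, with sum at most \<open>1\<close>, where \<open>s\<close>
    vanishes.\<close>
  define \<mu> where "\<mu> = s x0"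
  have \<mu>: "0 < \<mu>" using s x0 by (simp add: \<mu>_def)
  define w where "w d x = \<beta> d x / max \<mu> (s x)" for d x
  have mx: "0 < max \<mu> (s x)" for x using \<mu> by simp
  have sw: "(\<Sum>d\<in>D. w d x) = s x / max \<mu> (s x)" for x by (simp add: w_def s_def sum_divide_distrib)
  have swK: "(\<Sum>d\<in>D. w d x) = 1" if "x \<in> K" for x
    using x0(2)[OF that] s[OF that] unfolding sw by (simp add: \<mu>_def max_def)
  have w0: "0 \<le> w d x" for d x using mx[of x] by (auto simp: w_def \<beta>_def)
  show ?thesis
  proof (rule that[of D w])
    show "\<forall>d. continuous_on UNIV (w d)"
      unfolding w_def \<beta>_def using mx by (intro allI continuous_intros cs) (metis less_irrefl)
    show "\<forall>d x. 0 \<le> w d x" using w0 by blast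
    show "\<forall>x. (\<Sum>d\<in>D. w d x) \<le> 1" unfolding sw using mx by (simp add: divide_le_eq)
    show "\<forall>x\<in>K. norm (f x - (\<Sum>d\<in>D. w d x *\<^sub>R f d)) \<le> e"
    proof
    fix x assume x: "x \<in> K"
    have "f x - (\<Sum>d\<in>D. w d x *\<^sub>R f d) = (\<Sum>d\<in>D. w d x *\<^sub>R (f x - f d))"
      using swK[OF x] by (simp add: scaleR_diff_right sum_subtractf scaleR_left.sum[symmetric])
    also have "norm \<dots> \<le> (\<Sum>d\<in>D. w d x * e)"
    proof (rule sum_norm_le)
      fix d assume d: "d \<in> D"
      show "norm (w d x *\<^sub>R (f x - f d)) \<le> w d x * e"
      proof (cases "dist x d < \<delta>")
        case True
        then have "norm (f x - f d) \<le> e" using \<delta>(2)[of d x] d D(1) x by (auto simp: dist_norm)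
        then show ?thesis using w0[of d x] by (simp add: mult_left_mono)
      qed (simp add: w_def \<beta>_def)
    qed
    also have "\<dots> = e" using swK[OF x] by (simp add: sum_distrib_right[symmetric])
    finally show "norm (f x - (\<Sum>d\<in>D. w d x *\<^sub>R f d)) \<le> e" .
    qed
  qed (use D in auto)
qed

lemma compact_Tietze_step:
  fixes f :: "'m::metric_space \<Rightarrow> 'b::real_normed_vector"
  assumes K: "compact K" and f: "continuous_on K f" and B: "0 < B" "\<And>x. x \<in> K \<Longrightarrow> norm (f x) \<le> B"
  obtains g where "continuous_on UNIV g" "\<And>x. norm (g x) \<le> B" "\<And>x. x \<in> K \<Longrightarrow> norm (f x - g x) \<le> B / 2"
proof -
  have pos: "0 < B / 2" using B by simp
  obtain D w where w: "finite D" "D \<subseteq> K" "\<forall>d. continuous_on UNIV (w d)"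
    "\<forall>d x. 0 \<le> w d x" "\<forall>x. (\<Sum>d\<in>D. w d x) \<le> 1"
    "\<forall>x\<in>K. norm (f x - (\<Sum>d\<in>D. w d x *\<^sub>R f d)) \<le> B / 2"
    using compact_partition_approx[OF K f pos] .
  show ?thesis
  proof (rule that[of "\<lambda>x. \<Sum>d\<in>D. w d x *\<^sub>R f d"])
    show "continuous_on UNIV (\<lambda>x. \<Sum>d\<in>D. w d x *\<^sub>R f d)" using w(3) by (intro continuous_intros) auto
    fix x
    have "norm (\<Sum>d\<in>D. w d x *\<^sub>R f d) \<le> (\<Sum>d\<in>D. w d x * B)"
      using w(2,4) B by (intro sum_norm_le) (auto intro!: mult_left_mono)
    also have "\<dots> \<le> 1 * B" unfolding sum_distrib_right[symmetric] using w(5) B by (intro mult_right_mono) auto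
    finally show "norm (\<Sum>d\<in>D. w d x *\<^sub>R f d) \<le> B" by simp
  qed (use w(6) in auto)
qed

text \<open>Each step leaves at most half of the error on \<open>K\<close>, by subtracting a
  globally defined map no larger than that error bound; the corrections therefore converge
  uniformly.\<close>

theorem compact_Tietze_banach:
  fixes f :: "'m::metric_space \<Rightarrow> 'b::banach"
  assumes K: "compact K" and f: "continuous_on K f"
  obtains g where "continuous_on UNIV g" "\<And>x. x \<in> K \<Longrightarrow> g x = f x"
proof -
  obtain B0 where B0: "\<And>x. x \<in> K \<Longrightarrow> norm (f x) \<le> B0"
    using compact_imp_bounded[OF compact_continuous_image[OF f K]] by (auto simp: bounded_iff)
  define B where "B = \<bar>B0\<bar> + 1"
  have B: "0 < B" "\<And>x. x \<in> K \<Longrightarrow> norm (f x) \<le> B" using B0 by (force simp: B_def)+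
  define ok where "ok n h \<longleftrightarrow> continuous_on K h \<and> (\<forall>x\<in>K. norm (h x) \<le> B / 2 ^ n)" for n :: nat and h :: "'m \<Rightarrow> 'b"
  have "\<exists>g. continuous_on UNIV g \<and> (\<forall>x. norm (g x) \<le> B / 2 ^ n) \<and> ok (Suc n) (\<lambda>x. h x - g x)" if h: "ok n h" for n h
  proof -
    obtain g where g: "continuous_on UNIV g" "\<And>x. norm (g x) \<le> B / 2 ^ n" "\<And>x. x \<in> K \<Longrightarrow> norm (h x - g x) \<le> B / 2 ^ n / 2"
      by (rule compact_Tietze_step[OF K, of h "B / 2 ^ n"]) (use h B in \<open>auto simp: ok_def\<close>)
    have "continuous_on K (\<lambda>x. h x - g x)"
      using h by (intro continuous_intros continuous_on_subset[OF g(1)]) (auto simp: ok_def)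
    then show ?thesis using g by (intro exI[of _ g]) (auto simp: ok_def field_simps)
  qed
  then obtain G where G: "\<And>n h. ok n h \<Longrightarrow> continuous_on UNIV (G n h) \<and> (\<forall>x. norm (G n h x) \<le> B / 2 ^ n) \<and> ok (Suc n) (\<lambda>x. h x - G n h x)"
    by metis
  define r where "r = rec_nat f (\<lambda>n h x. h x - G n h x)"
  have r0: "r 0 = f" and rS: "r (Suc n) = (\<lambda>x. r n x - G n (r n) x)" for n by (simp_all add: r_def)
  have okr: "ok n (r n)" for n
  proof (induction n)
    case 0 then show ?case using f B by (simp add: r0 ok_def)
  next
    case (Suc n) then show ?case unfolding rS using G by blast
  qed
  define g where "g n = G n (r n)" for n
  have g: "continuous_on UNIV (g n)" "\<And>x. norm (g n x) \<le> B * (1 / 2) ^ n" for n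
    using G[OF okr, of n] by (auto simp: g_def power_divide)
  have geo: "summable (\<lambda>n. B * (1 / 2) ^ n :: real)" by (intro summable_mult summable_geometric) simp
  have u: "uniform_limit UNIV (\<lambda>n x. \<Sum>i<n. g i x) (\<lambda>x. suminf (\<lambda>i. g i x)) sequentially"
    by (rule Weierstrass_m_test[OF _ geo]) (use g in auto)
  have c: "continuous_on UNIV (\<lambda>x. suminf (\<lambda>i. g i x))"
    by (rule uniform_limit_theorem[OF _ u]) (auto intro!: always_eventually continuous_on_sum g)
  have sum: "(\<Sum>i<n. g i x) = f x - r n x" for n x
    by (induction n) (auto simp: r0 rS g_def)
  have "suminf (\<lambda>i. g i x) = f x" if x: "x \<in> K" for x
  proof -
    have "(\<lambda>n. f x - r n x) \<longlonglongrightarrow> f x - 0"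
    proof (intro tendsto_diff tendsto_const)
      show "(\<lambda>n. r n x) \<longlonglongrightarrow> 0"
      proof (rule Lim_null_comparison)
        show "\<forall>\<^sub>F n in sequentially. norm (r n x) \<le> B * (1 / 2) ^ n"
          using okr x by (simp add: ok_def power_divide)
        show "(\<lambda>n. B * (1 / 2) ^ n :: real) \<longlonglongrightarrow> 0" by (intro tendsto_mult_right_zero LIMSEQ_power_zero) simp
      qed
    qed
    then have "(\<lambda>i. g i x) sums f x" unfolding sums_def sum by simp
    then show ?thesis by (rule sums_unique[symmetric])
  qed
  then show ?thesis using that c by blast
qed

section \<open>Polynomial approximation of operator paths\<close>

lemma poly_sums: "(\<lambda>k. poly.coeff p k * x ^ k) sums poly p (x::real)"
proof -
  have "(\<lambda>k. poly.coeff p k * x ^ k) sums (\<Sum>k\<le>Polynomial.degree p. poly.coeff p k * x ^ k)"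
    by (rule sums_finite) (auto simp: coeff_eq_0)
  then show ?thesis by (simp add: poly_altdef)
qed

lemma poly_combination_analytic:
  fixes B :: "'i \<Rightarrow> 'u::real_normed_vector \<Rightarrow>\<^sub>L 'v::real_normed_vector"
  shows "analytic_path (\<lambda>t. \<Sum>d\<in>D. poly (p d) t *\<^sub>R B d) a b"
  unfolding analytic_path_def
proof
  fix t0 :: real
  \<comment> \<open>Shifting the argument by \<open>t0\<close> turns the coefficients into those of
    the expansion at \<open>t0\<close>; only finitely many are nonzero.\<close>
  define Q where "Q d = pcompose (p d) [:t0, 1:]" for d
  have "(\<lambda>k. (t - t0) ^ k *\<^sub>R (\<Sum>d\<in>D. poly.coeff (Q d) k *\<^sub>R B d)) sums (\<Sum>d\<in>D. poly (p d) t *\<^sub>R B d)" for t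
  proof -
    have "(\<lambda>k. (poly.coeff (Q d) k * (t - t0) ^ k) *\<^sub>R B d) sums (poly (p d) t *\<^sub>R B d)" for d
    proof -
      have "poly (Q d) (t - t0) = poly (p d) t" by (simp add: Q_def poly_pcompose)
      then show ?thesis using sums_scaleR_left[OF poly_sums[of "Q d" "t - t0"], of "B d"] by simp
    qed
    then have "(\<lambda>k. \<Sum>d\<in>D. (poly.coeff (Q d) k * (t - t0) ^ k) *\<^sub>R B d) sums (\<Sum>d\<in>D. poly (p d) t *\<^sub>R B d)"
      by (intro sums_sum)
    then show ?thesis by (simp add: scaleR_sum_right mult.commute)
  qed
  then show "\<exists>A \<rho>. 0 < \<rho> \<and> (\<forall>t\<in>{a..b}. \<bar>t - t0\<bar> < \<rho> \<longrightarrow> (\<lambda>k. (t - t0) ^ k *\<^sub>R A k) sums (\<Sum>d\<in>D. poly (p d) t *\<^sub>R B d))"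
    by (intro exI[of _ "\<lambda>k. \<Sum>d\<in>D. poly.coeff (Q d) k *\<^sub>R B d"] exI[of _ 1]) auto
qed

lemma real_polynomial_function_poly:
  fixes f :: "real \<Rightarrow> real"
  assumes "real_polynomial_function f"
  obtains p where "\<And>x. f x = poly p x"
proof -
  obtain a n where f: "f = (\<lambda>x. \<Sum>i\<le>n. a i * x ^ i)" using assms unfolding real_polynomial_function_iff_sum by blast
  show ?thesis by (rule that[of "\<Sum>i\<le>n. Polynomial.monom (a i) i"]) (simp add: f poly_sum poly_monom)
qed

text \<open>The image of the path is compact in the open set \<open>GL\<close>, so some
  \<open>e\<close>-neighbourhood of it consists of isomorphisms. Replacing the weights of a
  partition of unity by polynomials stays within it, together with the segment to
  \<open>G t\<close>.\<close>

lemma GL_path_analytic_approx: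
  fixes G :: "real \<Rightarrow> 'u::banach \<Rightarrow>\<^sub>L 'v::banach"
  assumes G: "continuous_on {a..b} G" "G ` {a..b} \<subseteq> GL"
  obtains L\<omega> where "analytic_path L\<omega> a b" "continuous_on {a..b} L\<omega>"
    "\<And>t s. t \<in> {a..b} \<Longrightarrow> s \<in> {0..1} \<Longrightarrow> (1 - s) *\<^sub>R L\<omega> t + s *\<^sub>R G t \<in> GL"
proof -
  have "compact (G ` {a..b})" by (rule compact_continuous_image[OF G(1)]) simp
  then obtain e where e: "0 < e" "(\<Union>A\<in>G ` {a..b}. ball A e) \<subseteq> GL"
    using compact_subset_open_imp_ball_epsilon_subset[OF _ open_GL G(2)] by metis
  have pos: "0 < e / 3" using e(1) by simp
  obtain D w where w: "finite D" "D \<subseteq> {a..b}" "\<forall>d. continuous_on UNIV (w d)"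
    "\<forall>d x. 0 \<le> w d x" "\<forall>x. (\<Sum>d\<in>D. w d x) \<le> 1"
    "\<forall>x\<in>{a..b}. norm (G x - (\<Sum>d\<in>D. w d x *\<^sub>R G d)) \<le> e / 3"
    using compact_partition_approx[OF compact_Icc G(1) pos] .
  \<comment> \<open>Chosen so that polynomial errors below \<open>e / (3 * M)\<close> add up to at
    most \<open>e / 3\<close>; with the error of the partition the total stays below
    \<open>e\<close>.\<close>
  define M where "M = (\<Sum>d\<in>D. norm (G d)) + 1"
  have M: "0 < M" by (simp add: M_def sum_nonneg add_nonneg_pos)
  have "\<exists>p. \<forall>x\<in>{a..b}. \<bar>w d x - poly p x\<bar> < e / (3 * M)" for d
  proof -
    have "continuous_on {a..b} (w d)" using w(3) continuous_on_subset by blast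
    then obtain h where h: "real_polynomial_function h" "\<And>x. x \<in> {a..b} \<Longrightarrow> \<bar>w d x - h x\<bar> < e / (3 * M)"
      using Stone_Weierstrass_real_polynomial_function[OF compact_Icc, of a b "w d" "e / (3 * M)"] e(1) M by auto
    obtain p where "\<And>x. h x = poly p x" using real_polynomial_function_poly[OF h(1)] by blast
    then show ?thesis using h(2) by (intro exI[of _ p]) auto
  qed
  then obtain p where p: "\<And>d x. x \<in> {a..b} \<Longrightarrow> \<bar>w d x - poly (p d) x\<bar> < e / (3 * M)" by metis
  define L\<omega> where "L\<omega> t = (\<Sum>d\<in>D. poly (p d) t *\<^sub>R G d)" for t
  have near: "norm (G t - L\<omega> t) < e" if t: "t \<in> {a..b}" for t
  proof -
    have "(\<Sum>d\<in>D. w d t *\<^sub>R G d) - L\<omega> t = (\<Sum>d\<in>D. (w d t - poly (p d) t) *\<^sub>R G d)"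
      by (simp add: L\<omega>_def scaleR_diff_left sum_subtractf)
    also have "norm \<dots> \<le> (\<Sum>d\<in>D. e / (3 * M) * norm (G d))"
    proof (rule sum_norm_le)
      fix d
      have "\<bar>w d t - poly (p d) t\<bar> * norm (G d) \<le> e / (3 * M) * norm (G d)"
        using p[OF t, of d] by (intro mult_right_mono) auto
      then show "norm ((w d t - poly (p d) t) *\<^sub>R G d) \<le> e / (3 * M) * norm (G d)" by simp
    qed
    also have "\<dots> = e / (3 * M) * (M - 1)" by (simp add: M_def sum_distrib_left)
    also have "\<dots> \<le> e / (3 * M) * M" using e M by (intro mult_left_mono) auto
    also have "\<dots> = e / 3" using M by simp
    finally have "norm ((\<Sum>d\<in>D. w d t *\<^sub>R G d) - L\<omega> t) \<le> e / 3" .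
    moreover have "norm (G t - L\<omega> t) \<le> norm (G t - (\<Sum>d\<in>D. w d t *\<^sub>R G d)) + norm ((\<Sum>d\<in>D. w d t *\<^sub>R G d) - L\<omega> t)"
      using norm_triangle_ineq[of "G t - (\<Sum>d\<in>D. w d t *\<^sub>R G d)" "(\<Sum>d\<in>D. w d t *\<^sub>R G d) - L\<omega> t"] by simp
    ultimately show ?thesis using w(6)[rule_format, OF t] e(1) by linarith
  qed
  show ?thesis
  proof (rule that[of L\<omega>])
    show "analytic_path L\<omega> a b" unfolding L\<omega>_def[abs_def] by (rule poly_combination_analytic)
    show "continuous_on {a..b} L\<omega>" unfolding L\<omega>_def by (intro continuous_intros)
    fix t s :: real assume t: "t \<in> {a..b}" and s: "s \<in> {0..1}"
    have "G t - ((1 - s) *\<^sub>R L\<omega> t + s *\<^sub>R G t) = (1 - s) *\<^sub>R (G t - L\<omega> t)" by (simp add: algebra_simps)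
    then have "norm (G t - ((1 - s) *\<^sub>R L\<omega> t + s *\<^sub>R G t)) = (1 - s) * norm (G t - L\<omega> t)" using s by simp
    also have "\<dots> \<le> 1 * norm (G t - L\<omega> t)" using s by (intro mult_right_mono) auto
    finally have "(1 - s) *\<^sub>R L\<omega> t + s *\<^sub>R G t \<in> ball (G t) e" using near[OF t] by (simp add: dist_norm)
    then show "(1 - s) *\<^sub>R L\<omega> t + s *\<^sub>R G t \<in> GL" using e(2) t by blast
  qed
qed

subsection \<open>Finite-dimensional reduction\<close>

text \<open>Instead of splitting the target space, a full vector \<open>\<xi>\<close> is sought with
  \<open>F (l, x + (\<xi> - P \<xi>)) + Th (P \<xi>) = 0\<close>. At points of \<open>K\<close> the
  derivative in \<open>\<xi>\<close> is \<open>D\<close> on the kernel of \<open>P\<close> and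
  \<open>T\<close> on its range, that is \<open>T\<close>, so a contraction finds
  \<open>\<xi>\<close> nearby; the reduced equation is then \<open>P \<xi> = 0\<close>.\<close>

lemma finite_dim_reduction:
  fixes F :: "real \<times> 'u::banach \<Rightarrow> 'v::banach" and D :: "real \<times> 'u \<Rightarrow> 'u \<Rightarrow>\<^sub>L 'v" and P :: "'u \<Rightarrow>\<^sub>L 'u"
  assumes F: "continuous_on UNIV F" and D: "continuous_on UNIV D"
    and der: "\<And>l u. ((\<lambda>u. F (l, u)) has_derivative blinfun_apply (D (l, u))) (at u)"
    and K: "compact K" "\<And>z. z \<in> K \<Longrightarrow> F z = 0"
    and PP: "\<And>u. P (P u) = P u"
    and inj: "\<And>z z'. z \<in> K \<Longrightarrow> z' \<in> K \<Longrightarrow> fst z = fst z' \<Longrightarrow> P (snd z) = P (snd z') \<Longrightarrow> z = z'"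
    and T: "continuous_on K T" "T ` K \<subseteq> GL" "\<And>z u. z \<in> K \<Longrightarrow> P u = 0 \<Longrightarrow> T z u = D z u"
    and \<epsilon>: "0 < \<epsilon>"
  obtains \<Omega> Th \<xi> where "open \<Omega>" "\<forall>z\<in>K. (fst z, P (snd z)) \<in> \<Omega>" "continuous_on \<Omega> \<xi>" "continuous_on UNIV Th"
    "\<forall>z\<in>K. Th (fst z, P (snd z)) = T z"
    "\<forall>p\<in>\<Omega>. F (fst p, snd p + (\<xi> p - P (\<xi> p))) + blinfun_apply (Th p) (P (\<xi> p)) = 0"
    "\<forall>p\<in>\<Omega>. \<exists>z\<in>K. dist (fst p, snd p + (\<xi> p - P (\<xi> p))) z < \<epsilon>"
    "\<forall>z\<in>K. \<xi> (fst z, P (snd z)) = snd z - P (snd z)"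
proof -
  define \<kappa> where "\<kappa> z = (fst z, P (snd z))" for z :: "real \<times> 'u"
  have c\<kappa>: "continuous_on S \<kappa>" for S unfolding \<kappa>_def by (intro continuous_intros)
  have "inj_on \<kappa> K" using inj by (auto simp: inj_on_def \<kappa>_def)
  \<comment> \<open>The reduction is injective on the compact set \<open>K\<close>, so its inverse
    is continuous and data on \<open>K\<close> become functions of the reduced variable.\<close>
  define \<kappa>i where "\<kappa>i = inv_into K \<kappa>"
  have \<kappa>i: "\<kappa>i (\<kappa> z) = z" if "z \<in> K" for z using \<open>inj_on \<kappa> K\<close> that by (simp add: \<kappa>i_def)
  define K' where "K' = \<kappa> ` K"
  have K': "compact K'" unfolding K'_def by (rule compact_continuous_image[OF c\<kappa> K(1)])
  have c\<kappa>i: "continuous_on K' \<kappa>i" unfolding K'_def using continuous_on_inv[OF c\<kappa> K(1)] \<kappa>i by blast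
  have im: "\<kappa>i ` K' \<subseteq> K" using \<kappa>i by (auto simp: K'_def)
  have "continuous_on K' (\<lambda>p. snd (\<kappa>i p))" by (intro continuous_intros c\<kappa>i)
  \<comment> \<open>The data live on the reduced set only, but the reduced variable must range over
    an open set; hence the extension, here and for \<open>Th\<close> and \<open>Bh\<close>.\<close>
  then obtain c where c: "continuous_on UNIV c" "\<And>p. p \<in> K' \<Longrightarrow> c p = snd (\<kappa>i p)"
    using compact_Tietze_banach[OF K'] by blast
  have "continuous_on K' (\<lambda>p. T (\<kappa>i p))" using continuous_on_compose2[OF T(1) c\<kappa>i im] .
  then obtain Th where Th: "continuous_on UNIV Th" "\<And>p. p \<in> K' \<Longrightarrow> Th p = T (\<kappa>i p)"
    using compact_Tietze_banach[OF K'] by blast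
  have "continuous_on K' (\<lambda>p. blinfun_inv (T (\<kappa>i p)))"
    using continuous_on_compose2[OF continuous_on_inv_comp[OF T(1,2)] c\<kappa>i im] .
  then obtain Bh where Bh: "continuous_on UNIV Bh" "\<And>p. p \<in> K' \<Longrightarrow> Bh p = blinfun_inv (T (\<kappa>i p))"
    using compact_Tietze_banach[OF K'] by blast
  define b0 where "b0 p = c p - P (c p)" for p
  have Pb0: "P (b0 p) = 0" for p by (simp add: b0_def blinfun.diff_right PP)
  have atK: "c (\<kappa> z) = snd z" "Th (\<kappa> z) = T z" "Bh (\<kappa> z) = blinfun_inv (T z)" "b0 (\<kappa> z) = snd z - P (snd z)" if z: "z \<in> K" for z
  proof -
    have "\<kappa> z \<in> K'" using z by (simp add: K'_def)
    then show c: "c (\<kappa> z) = snd z" "Th (\<kappa> z) = T z" "Bh (\<kappa> z) = blinfun_inv (T z)"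
      using c(2) Th(2) Bh(2) \<kappa>i[OF z] by auto
    then show "b0 (\<kappa> z) = snd z - P (snd z)" by (simp add: b0_def)
  qed
  have cb0: "continuous_on UNIV b0" unfolding b0_def by (intro continuous_intros c(1))
  define mm where "mm p \<xi> = (fst p, snd p + (\<xi> - P \<xi>))" for p :: "real \<times> 'u" and \<xi> :: 'u
  define \<Gamma> where "\<Gamma> p \<xi> = F (mm p \<xi>) + Th p (P \<xi>)" for p \<xi>
  have fstc: "continuous_on S (\<lambda>y. f (fst y))" if "continuous_on UNIV f" for S and f :: "real \<times> 'u \<Rightarrow> 'w::topological_space"
    by (rule continuous_on_compose2[OF that]) (auto intro!: continuous_intros)
  define X where "X y = b0 (fst y) + snd y" for y
  have cX: "continuous_on UNIV X" unfolding X_def by (intro continuous_intros fstc cb0)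
  have cmm: "continuous_on UNIV (\<lambda>y. mm (fst y) (X y))" unfolding mm_def by (intro continuous_intros cX)
  \<comment> \<open>The derivative in \<open>\<eta>\<close> of the map iterated below; it vanishes
    at points coming from \<open>K\<close>, where \<open>Bh\<close> inverts
    \<open>T\<close>.\<close>
  define EE where "EE y = id_blinfun - (Bh (fst y) o\<^sub>L ((D (mm (fst y) (X y)) o\<^sub>L (id_blinfun - P)) + (Th (fst y) o\<^sub>L P)))" for y
  have cEE: "continuous_on UNIV EE" unfolding EE_def
    by (intro continuous_intros bounded_bilinear.continuous_on[OF bounded_bilinear_blinfun_compose]
        fstc Bh(1) Th(1) continuous_on_compose2[OF D cmm]) auto
  have mmK: "mm (\<kappa> z) (X (\<kappa> z, 0)) = z" if "z \<in> K" for z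
    using Pb0[of "\<kappa> z"] atK[OF that] by (simp add: mm_def X_def \<kappa>_def)
  have EEK: "EE (\<kappa> z, 0) = 0" if z: "z \<in> K" for z
  proof (rule blinfun_eqI)
    fix u
    have TG: "T z \<in> GL" using T(2) z by blast
    have "P (u - P u) = 0" by (simp add: blinfun.diff_right PP)
    then have "D z (u - P u) = T z (u - P u)" using T(3)[OF z] by simp
    then have "EE (\<kappa> z, 0) u = u - blinfun_inv (T z) (T z (u - P u) + T z (P u))"
      by (simp add: EE_def mmK[OF z] atK[OF z] blinfun.diff_left blinfun.add_left)
    also have "T z (u - P u) + T z (P u) = T z u" by (simp add: blinfun.diff_right)
    finally show "EE (\<kappa> z, 0) u = blinfun_apply 0 u" using TG by simp
  qed
  \<comment> \<open>Here the iteration contracts by \<open>1 / 2\<close>, the approximate inverse is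
    an isomorphism, and the argument of \<open>F\<close> stays within \<open>\<epsilon>\<close> of
    \<open>K\<close>. Openness and compactness turn this into a uniform radius.\<close>
  define A1 where "A1 = {y. norm (EE y) < 1 / 2} \<inter> {y. Bh (fst y) \<in> GL} \<inter> {y. mm (fst y) (X y) \<in> (\<Union>z\<in>K. ball z \<epsilon>)}"
  have "open A1" unfolding A1_def
  proof (intro open_Int)
    show "open {y. norm (EE y) < 1 / 2}" by (intro open_Collect_less continuous_on_norm cEE continuous_on_const)
    have "open ((\<lambda>y. Bh (fst y)) -` GL :: ((real \<times> 'u) \<times> 'u) set)" by (rule open_vimage[OF open_GL fstc[OF Bh(1)]])
    then show "open {y :: (real \<times> 'u) \<times> 'u. Bh (fst y) \<in> GL}" by (simp add: vimage_def)
    have "open ((\<lambda>y. mm (fst y) (X y)) -` (\<Union>z\<in>K. ball z \<epsilon>))" by (rule open_vimage[OF _ cmm]) auto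
    then show "open {y. mm (fst y) (X y) \<in> (\<Union>z\<in>K. ball z \<epsilon>)}" by (simp add: vimage_def)
  qed
  moreover have "K' \<times> {0} \<subseteq> A1"
  proof
    fix y :: "(real \<times> 'u) \<times> 'u" assume "y \<in> K' \<times> {0}"
    then obtain z where z: "z \<in> K" "y = (\<kappa> z, 0)" by (auto simp: K'_def)
    have "blinfun_inv (T z) \<in> GL" using T(2) z(1) by (intro blinfun_inv_GL) blast
    moreover have "z \<in> (\<Union>z\<in>K. ball z \<epsilon>)" using z(1) \<epsilon> by force
    ultimately show "y \<in> A1" using EEK[OF z(1)] mmK[OF z(1)] atK[OF z(1)] by (simp add: A1_def z(2))
  qed
  moreover have "compact (K' \<times> {0 :: 'u})" using K' by (simp add: compact_Times)
  ultimately obtain \<delta>1 where \<delta>1: "0 < \<delta>1" "(\<Union>y\<in>K' \<times> {0}. ball y \<delta>1) \<subseteq> A1"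
    using compact_subset_open_imp_ball_epsilon_subset by metis
  define r where "r = \<delta>1 / 3"
  have r: "0 < r" using \<delta>1 by (simp add: r_def)
  have A1: "(p, \<eta>) \<in> A1" if "p0 \<in> K'" "dist p p0 < r" "norm \<eta> \<le> r" for p p0 \<eta>
  proof -
    have "dist (p0, 0) (p, \<eta>) \<le> dist p0 p + dist 0 \<eta>"
      unfolding dist_Pair_Pair by (rule sqrt_sum_squares_le_sum) auto
    also have "\<dots> < \<delta>1" using that \<delta>1(1) by (auto simp: r_def dist_commute)
    finally show ?thesis using \<delta>1(2) that(1) by force
  qed
  \<comment> \<open>A residual below \<open>r / 2\<close> together with the contraction factor
    \<open>1 / 2\<close> keeps the ball of radius \<open>r\<close> invariant.\<close>
  define A2 where "A2 = {p. norm (Bh p (\<Gamma> p (b0 p))) < r / 2}"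
  have cG: "continuous_on UNIV (\<lambda>y. \<Gamma> (fst y) (snd y))" unfolding \<Gamma>_def mm_def
    by (intro continuous_intros fstc Th(1) continuous_on_compose2[OF F]) auto
  have cG': "continuous_on S (\<lambda>x. \<Gamma> (f x) (g x))" if "continuous_on S f" "continuous_on S g" for S f and g :: "'w::topological_space \<Rightarrow> 'u"
    using continuous_on_compose2[OF cG continuous_on_Pair[OF that]] by simp
  have "open A2" unfolding A2_def
    by (intro open_Collect_less continuous_intros cG' cb0 Bh(1))
  moreover have "K' \<subseteq> A2"
  proof
    fix p assume "p \<in> K'"
    then obtain z where z: "z \<in> K" "p = \<kappa> z" by (auto simp: K'_def)
    have "mm p (b0 p) = z" using mmK[OF z(1)] by (simp add: X_def z(2))
    then show "p \<in> A2" using K(2)[OF z(1)] r by (simp add: A2_def \<Gamma>_def Pb0 blinfun.zero_right)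
  qed
  ultimately obtain \<delta>2 where \<delta>2: "0 < \<delta>2" "(\<Union>p\<in>K'. ball p \<delta>2) \<subseteq> A2"
    using compact_subset_open_imp_ball_epsilon_subset[OF K'] by metis
  define \<Omega> where "\<Omega> = (\<Union>p\<in>K'. ball p (min r \<delta>2))"
  have \<Omega>: "open \<Omega>" unfolding \<Omega>_def by auto
  \<comment> \<open>Simplified Newton iteration around the guess \<open>b0 p\<close>, with
    \<open>Bh p\<close> as a fixed approximate inverse.\<close>
  define \<Phi> where "\<Phi> p \<eta> = \<eta> - Bh p (\<Gamma> p (b0 p + \<eta>))" for p \<eta>
  have inA1: "(p, \<eta>) \<in> A1" if p: "p \<in> \<Omega>" and \<eta>: "norm \<eta> \<le> r" for p \<eta>
  proof -
    obtain p0 where "p0 \<in> K'" "p \<in> ball p0 (min r \<delta>2)" using p unfolding \<Omega>_def by blast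
    then show ?thesis using \<eta> by (intro A1[of p0]) (auto simp: dist_commute)
  qed
  have \<Phi>contr: "norm (\<Phi> p \<eta> - \<Phi> p \<eta>') \<le> 1 / 2 * norm (\<eta> - \<eta>')" if p: "p \<in> \<Omega>" and \<eta>: "norm \<eta> \<le> r" "norm \<eta>' \<le> r" for p \<eta> \<eta>'
  proof (rule differentiable_bound[where S = "cball 0 r" and f' = "\<lambda>\<eta>. blinfun_apply (EE (p, \<eta>))"])
    fix \<eta> :: 'u assume \<eta>: "\<eta> \<in> cball 0 r"
    have d1: "((\<lambda>\<eta>. snd p + (b0 p + \<eta> - P (b0 p + \<eta>))) has_derivative (\<lambda>h. h - P h)) (at \<eta>)"
      by (auto intro!: derivative_eq_intros)
    have dP: "((\<lambda>\<eta>. Th p (P (b0 p + \<eta>))) has_derivative (\<lambda>h. Th p (P h))) (at \<eta>)"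
      by (auto intro!: derivative_eq_intros)
    have d2: "((\<lambda>\<eta>. F (mm p (b0 p + \<eta>))) has_derivative (\<lambda>h. D (mm p (b0 p + \<eta>)) (h - P h))) (at \<eta>)"
      unfolding mm_def using has_derivative_compose[OF d1 der] by simp
    have "(\<Phi> p has_derivative (\<lambda>h. h - Bh p (D (mm p (b0 p + \<eta>)) (h - P h) + Th p (P h)))) (at \<eta>)"
      unfolding \<Phi>_def \<Gamma>_def
      by (intro has_derivative_diff has_derivative_ident has_derivative_add d2 dP
          bounded_linear.has_derivative[OF blinfun.bounded_linear_right])
    also have "(\<lambda>h. h - Bh p (D (mm p (b0 p + \<eta>)) (h - P h) + Th p (P h))) = blinfun_apply (EE (p, \<eta>))"
      by (auto simp: EE_def X_def blinfun.diff_left blinfun.add_left fun_eq_iff)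
    finally show "(\<Phi> p has_derivative blinfun_apply (EE (p, \<eta>))) (at \<eta> within cball 0 r)"
      by (rule has_derivative_at_withinI)
    show "onorm (blinfun_apply (EE (p, \<eta>))) \<le> 1 / 2"
      using inA1[OF p, of \<eta>] \<eta> by (simp add: A1_def norm_blinfun.rep_eq)
  qed (use \<eta> in auto)
  have \<Phi>0: "norm (\<Phi> p 0) < r / 2" if p: "p \<in> \<Omega>" for p
  proof -
    have "p \<in> A2" using \<delta>2(2) p by (force simp: \<Omega>_def)
    then show ?thesis by (simp add: A2_def \<Phi>_def)
  qed
  have ex: "\<exists>!\<eta>\<in>cball 0 r. \<Phi> p \<eta> = \<eta>" if p: "p \<in> \<Omega>" for p
  proof (rule Banach_fix[where c = "1 / 2"])
    show "\<Phi> p ` cball 0 r \<subseteq> cball 0 r"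
    proof (rule image_subsetI)
      fix \<eta> :: 'u assume \<eta>: "\<eta> \<in> cball 0 r"
      have "norm (\<Phi> p \<eta> - \<Phi> p 0) \<le> 1 / 2 * norm (\<eta> - 0)" by (rule \<Phi>contr[OF p]) (use \<eta> r in auto)
      then have "norm (\<Phi> p \<eta>) \<le> 1 / 2 * norm \<eta> + norm (\<Phi> p 0)"
        using norm_triangle_sub[of "\<Phi> p \<eta>" "\<Phi> p 0"] by simp
      then show "\<Phi> p \<eta> \<in> cball 0 r" using \<Phi>0[OF p] \<eta> by simp
    qed
    show "dist (\<Phi> p x) (\<Phi> p y) \<le> 1 / 2 * dist x y" if "x \<in> cball 0 r" "y \<in> cball 0 r" for x y
      using \<Phi>contr[OF p, of x y] that by (simp add: dist_norm)
  qed (use r in \<open>auto simp: complete_eq_closed\<close>)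
  define \<eta> where "\<eta> p = (THE \<eta>. \<eta> \<in> cball 0 r \<and> \<Phi> p \<eta> = \<eta>)" for p
  have \<eta>: "norm (\<eta> p) \<le> r" "\<Phi> p (\<eta> p) = \<eta> p" if p: "p \<in> \<Omega>" for p
    using theI'[OF ex[OF p]] by (auto simp: \<eta>_def)
  have \<eta>_unique: "\<eta> p = e" if "p \<in> \<Omega>" "norm e \<le> r" "\<Phi> p e = e" for p e
    using ex[OF that(1)] \<eta>[OF that(1)] that by auto
  have c\<eta>: "continuous_on \<Omega> \<eta>" unfolding continuous_on_def
  proof
    fix p assume p: "p \<in> \<Omega>"
    have lim: "((\<lambda>q. \<Phi> q (\<eta> p)) \<longlongrightarrow> \<Phi> p (\<eta> p)) (at p within \<Omega>)"
    proof -
      have "continuous_on \<Omega> (\<lambda>q. \<Phi> q (\<eta> p))" unfolding \<Phi>_def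
        by (intro continuous_intros cG' continuous_on_subset[OF cb0] continuous_on_subset[OF Bh(1)]) auto
      then show ?thesis using p unfolding continuous_on_def by blast
    qed
    \<comment> \<open>Fixed points of a uniform contraction depend continuously on the parameter;
      the factor \<open>2\<close> comes from the contraction constant \<open>1 / 2\<close>.\<close>
    have bnd: "norm (\<eta> q - \<eta> p) \<le> 2 * norm (\<Phi> q (\<eta> p) - \<Phi> p (\<eta> p))" if q: "q \<in> \<Omega>" for q
    proof -
      have "norm (\<eta> q - \<eta> p) \<le> norm (\<Phi> q (\<eta> q) - \<Phi> q (\<eta> p)) + norm (\<Phi> q (\<eta> p) - \<Phi> p (\<eta> p))"
        using norm_triangle_ineq[of "\<Phi> q (\<eta> q) - \<Phi> q (\<eta> p)" "\<Phi> q (\<eta> p) - \<Phi> p (\<eta> p)"] \<eta>[OF p] \<eta>[OF q] by simp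
      also have "norm (\<Phi> q (\<eta> q) - \<Phi> q (\<eta> p)) \<le> 1 / 2 * norm (\<eta> q - \<eta> p)"
        by (rule \<Phi>contr[OF q]) (use \<eta> p q in auto)
      finally show ?thesis by simp
    qed
    have "((\<lambda>q. 2 * norm (\<Phi> q (\<eta> p) - \<Phi> p (\<eta> p))) \<longlongrightarrow> 0) (at p within \<Omega>)"
      using tendsto_mult_right_zero[OF tendsto_norm_zero[OF LIM_zero[OF lim]]] .
    then have "((\<lambda>q. \<eta> q - \<eta> p) \<longlongrightarrow> 0) (at p within \<Omega>)"
    proof (rule Lim_null_comparison[rotated])
      show "\<forall>\<^sub>F q in at p within \<Omega>. norm (\<eta> q - \<eta> p) \<le> 2 * norm (\<Phi> q (\<eta> p) - \<Phi> p (\<eta> p))"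
        using bnd by (simp add: eventually_at_filter)
    qed
    then show "(\<eta> \<longlongrightarrow> \<eta> p) (at p within \<Omega>)" by (rule LIM_zero_cancel)
  qed
  define \<xi> where "\<xi> p = b0 p + \<eta> p" for p
  have K\<Omega>: "\<kappa> z \<in> \<Omega>" if "z \<in> K" for z
  proof -
    have "\<kappa> z \<in> ball (\<kappa> z) (min r \<delta>2)" using r \<delta>2 by simp
    then show ?thesis using that unfolding \<Omega>_def K'_def by blast
  qed
  show ?thesis
  proof (rule that[of \<Omega> \<xi> Th])
    show "\<forall>z\<in>K. (fst z, P (snd z)) \<in> \<Omega>" using K\<Omega> by (simp add: \<kappa>_def)
    show "continuous_on \<Omega> \<xi>" unfolding \<xi>_def by (intro continuous_intros c\<eta> continuous_on_subset[OF cb0]) auto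
    show "\<forall>z\<in>K. Th (fst z, P (snd z)) = T z" using atK(2) by (simp add: \<kappa>_def)
    show "\<forall>p\<in>\<Omega>. F (fst p, snd p + (\<xi> p - P (\<xi> p))) + blinfun_apply (Th p) (P (\<xi> p)) = 0"
    proof
      fix p assume p: "p \<in> \<Omega>"
      have "Bh p \<in> GL" using inA1[OF p, of 0] r by (simp add: A1_def)
      moreover have "Bh p (\<Gamma> p (\<xi> p)) = 0" using \<eta>(2)[OF p] by (simp add: \<Phi>_def \<xi>_def)
      ultimately have "\<Gamma> p (\<xi> p) = 0" by (metis blinfun_inv_left blinfun.zero_right)
      then show "F (fst p, snd p + (\<xi> p - P (\<xi> p))) + blinfun_apply (Th p) (P (\<xi> p)) = 0"
        by (simp add: \<Gamma>_def mm_def)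
    qed
    show "\<forall>p\<in>\<Omega>. \<exists>z\<in>K. dist (fst p, snd p + (\<xi> p - P (\<xi> p))) z < \<epsilon>"
    proof
      fix p assume p: "p \<in> \<Omega>"
      have "mm p (\<xi> p) \<in> (\<Union>z\<in>K. ball z \<epsilon>)" using inA1[OF p \<eta>(1)[OF p]] by (simp add: A1_def X_def \<xi>_def)
      then show "\<exists>z\<in>K. dist (fst p, snd p + (\<xi> p - P (\<xi> p))) z < \<epsilon>" by (auto simp: mm_def dist_commute)
    qed
    show "\<forall>z\<in>K. \<xi> (fst z, P (snd z)) = snd z - P (snd z)"
    proof
      fix z assume z: "z \<in> K"
      have "mm (\<kappa> z) (b0 (\<kappa> z)) = z" using mmK[OF z] by (simp add: X_def)
      then have "\<Phi> (\<kappa> z) 0 = 0" using K(2)[OF z] by (simp add: \<Phi>_def \<Gamma>_def Pb0 blinfun.zero_right)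
      then have "\<eta> (\<kappa> z) = 0" using \<eta>_unique[OF K\<Omega>[OF z], of 0] r by simp
      then show "\<xi> (fst z, P (snd z)) = snd z - P (snd z)" using atK(4)[OF z] by (simp add: \<xi>_def \<kappa>_def)
    qed
  qed (use \<Omega> Th in auto)
qed

text \<open>At the trivial solution the reduced field \<open>- P \<xi>\<close> has the linear part
  \<open>P T0\<inverse> L\<close>, whose restriction to the range of \<open>P\<close> is the corner
  of \<open>T0\<inverse> L\<close> that decides its path component.\<close>

lemma reduction_linearization:
  fixes F :: "real \<times> 'u::banach \<Rightarrow> 'v::banach" and L T0 :: "'u \<Rightarrow>\<^sub>L 'v" and P :: "'u \<Rightarrow>\<^sub>L 'u"
  assumes der: "((\<lambda>u. F (l, u)) has_derivative blinfun_apply L) (at 0)" and F0: "F (l, 0) = 0"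
    and T0: "T0 \<in> GL" "\<And>u. P u = 0 \<Longrightarrow> T0 u = L u" and PP: "\<And>u. P (P u) = P u"
    and \<Omega>: "open \<Omega>" "(l, 0) \<in> \<Omega>" and \<xi>: "continuous_on \<Omega> \<xi>" "\<xi> (l, 0) = 0"
    and Th: "continuous_on UNIV Th" "Th (l, 0) = T0"
    and eq: "\<And>p. p \<in> \<Omega> \<Longrightarrow> F (fst p, snd p + (\<xi> p - P (\<xi> p))) + blinfun_apply (Th p) (P (\<xi> p)) = 0"
    and e: "0 < e"
  obtains d where "0 < d" "\<And>x. norm x < d \<Longrightarrow> (l, x) \<in> \<Omega> \<and>
    norm (P (\<xi> (l, x)) + P (blinfun_inv T0 (L x))) \<le> e * norm x"
proof -
  define a where "a = norm (blinfun_inv T0)"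
  define c where "c = norm P"
  define nn where "nn = norm (blinfun_inv T0 o\<^sub>L L)"
  define C where "C = 1 + (1 + 2 * c) * (2 * (nn + 1))"
  have nonneg: "0 \<le> a" "0 \<le> c" "0 \<le> nn" by (auto simp: a_def c_def nn_def)
  have C1: "1 \<le> C" using nonneg by (simp add: C_def)
  \<comment> \<open>The first bound lets half of \<open>norm s\<close> be absorbed on the left; the
    second brings the resulting error \<open>a * e1 * C * norm x\<close> below
    \<open>e * norm x\<close> after \<open>P\<close> is applied. The summands \<open>1\<close>
    exclude zero denominators.\<close>
  define e1 where "e1 = min (1 / (2 * (a + 1) * (1 + 2 * c))) (e / ((a + 1) * (c + 1) * C))"
  have e1: "0 < e1" using nonneg C1 e by (auto simp: e1_def)
  have e1a: "a * e1 * (1 + 2 * c) \<le> 1 / 2"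
  proof -
    have "a * e1 * (1 + 2 * c) \<le> (a + 1) * e1 * (1 + 2 * c)" using nonneg e1 by (intro mult_right_mono) auto
    also have "\<dots> \<le> (a + 1) * (1 / (2 * (a + 1) * (1 + 2 * c))) * (1 + 2 * c)"
      using nonneg by (intro mult_right_mono mult_left_mono) (auto simp: e1_def)
    also have "\<dots> = 1 / 2"
    proof -
      have "A * (1 / (2 * A * B)) * B = 1 / 2" if "A \<noteq> 0" "B \<noteq> 0" for A B :: real using that by simp
      from this[of "a + 1" "1 + 2 * c"] show ?thesis using nonneg by simp
    qed
    finally show ?thesis .
  qed
  have e1b: "c * (a * e1 * C) \<le> e"
  proof -
    have "c * (a * e1 * C) \<le> (c + 1) * ((a + 1) * e1 * C)" using nonneg e1 C1 by (intro mult_mono) auto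
    also have "\<dots> \<le> (c + 1) * ((a + 1) * (e / ((a + 1) * (c + 1) * C)) * C)"
      using nonneg C1 by (intro mult_left_mono mult_right_mono) (auto simp: e1_def)
    also have "\<dots> = e"
    proof -
      have "B * (A * (e / (A * B * C)) * C) = e" if "A \<noteq> 0" "B \<noteq> 0" "C \<noteq> 0" for A B C :: real using that by simp
      from this[of "a + 1" "c + 1" C] show ?thesis using nonneg C1 by simp
    qed
    finally show ?thesis .
  qed
  obtain d1 where d1: "0 < d1" "\<And>w. norm w < d1 \<Longrightarrow> norm (F (l, w) - L w) \<le> e1 * norm w"
    using der[unfolded has_derivative_at_alt] e1 F0 by auto
  have near: "\<forall>\<^sub>F p in nhds q. dist (g p) (g q) < e'" if "isCont g q" "0 < e'"
    for g :: "real \<times> 'u \<Rightarrow> 'w::real_normed_vector" and q e'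
    using that by (auto simp: continuous_at tendsto_at_iff_tendsto_nhds intro: tendstoD)
  have "continuous_on \<Omega> (\<lambda>p. snd p + (\<xi> p - P (\<xi> p)))" by (intro continuous_intros \<xi>(1))
  then have "isCont (\<lambda>p. snd p + (\<xi> p - P (\<xi> p))) (l, 0)" using \<Omega> continuous_on_eq_continuous_at by blast
  from near[OF this d1(1)] have "\<forall>\<^sub>F p in nhds (l, 0). dist (snd p + (\<xi> p - P (\<xi> p))) 0 < d1"
    using \<xi>(2) by (simp add: blinfun.zero_right)
  moreover have "isCont Th (l, 0)" using Th(1) by (simp add: continuous_on_eq_continuous_at)
  from near[OF this e1] have "\<forall>\<^sub>F p in nhds (l, 0). dist (Th p) T0 < e1" using Th(2) by simp
  moreover have "\<forall>\<^sub>F p in nhds (l, 0). p \<in> \<Omega>" using \<Omega> eventually_nhds_in_open by blast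
  ultimately have "\<forall>\<^sub>F p in nhds (l, 0). p \<in> \<Omega> \<and> dist (Th p) T0 < e1 \<and> dist (snd p + (\<xi> p - P (\<xi> p))) 0 < d1"
    by eventually_elim auto
  then obtain d where d: "0 < d" "\<And>p. dist p (l, 0) < d \<Longrightarrow> p \<in> \<Omega> \<and> dist (Th p) T0 < e1 \<and> dist (snd p + (\<xi> p - P (\<xi> p))) 0 < d1"
    unfolding eventually_nhds_metric by blast
  show ?thesis
  proof (rule that[OF d(1)])
    fix x :: 'u assume x: "norm x < d"
    define p where "p = (l, x)"
    have "dist p (l, 0) < d" using x by (simp add: p_def dist_Pair_Pair)
    note dp = d(2)[OF this]
    define s where "s = \<xi> p"
    define w where "w = x + (s - P s)"
    have wd: "norm w < d1" using dp by (simp add: w_def s_def p_def)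
    have Ps: "norm (P s) \<le> c * norm s" unfolding c_def by (rule norm_blinfun)
    have wn: "norm w \<le> norm x + (1 + c) * norm s"
    proof -
      have "norm w \<le> norm x + norm (s - P s)" unfolding w_def by (rule norm_triangle_ineq)
      also have "norm (s - P s) \<le> norm s + norm (P s)" by (rule norm_triangle_ineq4)
      finally show ?thesis using Ps by (simp add: algebra_simps)
    qed
    have e0: "F (l, w) + Th p (P s) = 0" using eq[of p] dp by (simp add: w_def s_def p_def)
    \<comment> \<open>The terms of higher order: the Taylor remainder of \<open>F\<close> and the
      variation of \<open>Th\<close>.\<close>
    define R where "R = (F (l, w) - L w) + (Th p - T0) (P s)"
    have "norm R \<le> e1 * norm w + e1 * (c * norm s)"
    proof -
      have "norm ((Th p - T0) (P s)) \<le> norm (Th p - T0) * norm (P s)" by (rule norm_blinfun)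
      also have "\<dots> \<le> e1 * (c * norm s)" using dp Ps e1 by (intro mult_mono) (auto simp: dist_norm)
      finally have "norm ((Th p - T0) (P s)) \<le> e1 * (c * norm s)" .
      then show ?thesis unfolding R_def
        using norm_triangle_ineq[of "F (l, w) - L w" "(Th p - T0) (P s)"] d1(2)[OF wd] by linarith
    qed
    also have "\<dots> \<le> e1 * (norm x + (1 + c) * norm s) + e1 * (c * norm s)" using wn e1 by simp
    finally have Rn: "norm R \<le> e1 * (norm x + (1 + 2 * c) * norm s)" by (simp add: algebra_simps)
    have "P (s - P s) = 0" by (simp add: blinfun.diff_right PP)
    then have "T0 (s - P s) = L (s - P s)" by (rule T0(2))
    \<comment> \<open>\<open>T0\<close> and \<open>L\<close> agree on \<open>s - P s\<close>, so the
      linear terms regroup exactly and only \<open>R\<close> is left to estimate.\<close>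
    then have "T0 s + L x = L w + T0 (P s)" by (simp add: w_def blinfun.diff_right blinfun.add_right diff_eq_eq)
    also have "\<dots> = - R" using e0 by (simp add: R_def blinfun.diff_left algebra_simps add_eq_0_iff)
    finally have "blinfun_inv T0 (T0 s + L x) = blinfun_inv T0 (- R)" by simp
    then have sN: "s + blinfun_inv T0 (L x) = - blinfun_inv T0 R"
      using T0(1) by (simp add: blinfun.add_right blinfun.minus_right)
    have "norm (blinfun_inv T0 R) \<le> a * norm R" unfolding a_def by (rule norm_blinfun)
    also have "\<dots> \<le> a * (e1 * (norm x + (1 + 2 * c) * norm s))" using Rn nonneg by (intro mult_left_mono)
    finally have bn: "norm (s + blinfun_inv T0 (L x)) \<le> a * e1 * (norm x + (1 + 2 * c) * norm s)"
      unfolding sN by (simp add: mult.assoc)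
    have nx: "norm (blinfun_inv T0 (L x)) \<le> nn * norm x"
      using norm_blinfun[of "blinfun_inv T0 o\<^sub>L L" x] by (simp add: nn_def)
    have "a * e1 \<le> 1 / 2"
    proof -
      have "a * e1 * 1 \<le> a * e1 * (1 + 2 * c)" using nonneg e1 by (intro mult_left_mono) auto
      then show ?thesis using e1a by simp
    qed
    then have ax: "a * e1 * norm x \<le> 1 / 2 * norm x" by (intro mult_right_mono) auto
    have as: "a * e1 * (1 + 2 * c) * norm s \<le> 1 / 2 * norm s" using e1a by (intro mult_right_mono) auto
    have "norm s \<le> norm (s + blinfun_inv T0 (L x)) + norm (blinfun_inv T0 (L x))"
      using norm_triangle_ineq4[of "s + blinfun_inv T0 (L x)" "blinfun_inv T0 (L x)"] by simp
    also have "\<dots> \<le> (a * e1 * norm x + a * e1 * (1 + 2 * c) * norm s) + nn * norm x"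
      using bn nx by (simp add: algebra_simps)
    finally have "norm s \<le> (1 / 2 * norm x + 1 / 2 * norm s) + nn * norm x" using ax as by linarith
    then have "norm s \<le> 2 * (nn * norm x) + 2 * norm x" using norm_ge_zero[of x] by linarith
    then have sx: "norm s \<le> 2 * (nn + 1) * norm x" by (simp add: algebra_simps)
    have "norm (s + blinfun_inv T0 (L x)) \<le> a * e1 * (norm x + (1 + 2 * c) * (2 * (nn + 1) * norm x))"
      by (rule order_trans[OF bn]) (use sx nonneg e1 in \<open>intro mult_left_mono add_left_mono; auto\<close>)
    also have "\<dots> = a * e1 * C * norm x" by (simp add: C_def algebra_simps)
    finally have fin: "norm (s + blinfun_inv T0 (L x)) \<le> a * e1 * C * norm x" .
    have "norm (P (s + blinfun_inv T0 (L x))) \<le> c * norm (s + blinfun_inv T0 (L x))"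
      unfolding c_def by (rule norm_blinfun)
    also have "\<dots> \<le> c * (a * e1 * C * norm x)" using fin nonneg by (intro mult_left_mono)
    also have "\<dots> = c * (a * e1 * C) * norm x" by simp
    also have "\<dots> \<le> e * norm x" using e1b by (intro mult_right_mono) auto
    finally show "(l, x) \<in> \<Omega> \<and> norm (P (\<xi> (l, x)) + P (blinfun_inv T0 (L x))) \<le> e * norm x"
      using dp by (simp add: s_def p_def blinfun.add_right)
  qed
qed

subsection \<open>Bifurcation\<close>

lemma projection_coordinates:
  fixes P :: "'u::real_normed_vector \<Rightarrow>\<^sub>L 'u"
  assumes PP: "\<And>u. P (P u) = P u" and fin: "finite_dim (range P)"
  obtains n and b :: "nat \<Rightarrow> 'u" and \<phi> :: "nat \<Rightarrow> 'u \<Rightarrow>\<^sub>L real" where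
    "\<forall>i<n. \<forall>j<n. \<phi> i (b j) = (if i = j then 1 else 0)" "\<forall>u. P u = (\<Sum>i<n. \<phi> i u *\<^sub>R b i)" "\<forall>i<n. P (b i) = b i"
proof -
  obtain B where B: "B \<subseteq> range P" "finite B" "independent B" "range P \<subseteq> span B" "card B = dim (range P)"
    using finite_dim_basis[OF fin] .
  obtain b where b: "bij_betw b {..<card B} B"
    using ex_bij_betw_nat_finite[OF B(2)] by (auto simp: lessThan_atLeast0)
  obtain \<phi>' :: "'u \<Rightarrow> 'u \<Rightarrow>\<^sub>L real" where \<phi>': "\<And>c d. c \<in> B \<Longrightarrow> d \<in> B \<Longrightarrow> \<phi>' c d = (if c = d then 1 else 0)"
    using dual_basis[OF B(2,3)] by blast
  have bB: "b i \<in> B" if "i < card B" for i using b that by (auto simp: bij_betw_def)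
  have Pb: "P (b i) = b i" if "i < card B" for i using bB[OF that] B(1) PP by auto
  \<comment> \<open>Precomposing with \<open>P\<close> makes the functionals vanish on its
    kernel.\<close>
  define \<phi> where "\<phi> i = \<phi>' (b i) o\<^sub>L P" for i
  have "b i = b j \<longleftrightarrow> i = j" if "i < card B" "j < card B" for i j
    using b that by (auto simp: bij_betw_def inj_on_def)
  then have 1: "\<forall>i<card B. \<forall>j<card B. \<phi> i (b j) = (if i = j then 1 else 0)"
    using \<phi>' bB Pb by (simp add: \<phi>_def)
  have "P u = (\<Sum>i<card B. \<phi> i u *\<^sub>R b i)" for u
  proof -
    have "P u \<in> span B" using B(4) by blast
    from dual_basis_expand[OF B(2) \<phi>' this] have "P u = (\<Sum>c\<in>B. \<phi>' c (P u) *\<^sub>R c)" .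
    also have "\<dots> = (\<Sum>i<card B. \<phi>' (b i) (P u) *\<^sub>R b i)" by (rule sum.reindex_bij_betw[OF b, symmetric])
    finally show ?thesis by (simp add: \<phi>_def)
  qed
  then show ?thesis using that[OF 1] Pb by blast
qed

text \<open>In block-triangular form the corner of the inverse is the inverse of the corner, because
  \<open>N\<inverse>\<close> fixes the kernel of \<open>P\<close> as well.\<close>

lemma kernel_fixing_inverse:
  fixes P N :: "'u::real_normed_vector \<Rightarrow>\<^sub>L 'u"
  assumes PP: "\<And>u. P (P u) = P u" and N: "N \<in> GL \<inter> kernel_fixing P" and x: "P x = x"
  shows "P (blinfun_inv N (P (N x))) = x"
proof -
  have G: "N \<in> GL" and fixk: "\<And>u. P u = 0 \<Longrightarrow> N u = u" using N by (auto simp: kernel_fixing_def)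
  define v where "v = N x - P (N x)"
  have Pv: "P v = 0" by (simp add: v_def blinfun.diff_right PP)
  have "blinfun_inv N v = v" using blinfun_inv_left[OF G, of v] fixk[OF Pv] by simp
  moreover have "P (N x) = N x - v" by (simp add: v_def)
  ultimately have "blinfun_inv N (P (N x)) = x - v" using G by (simp add: blinfun.diff_right)
  then show ?thesis using Pv x by (simp add: blinfun.diff_right)
qed

text \<open>Replacing \<open>N = T\<inverse> L\<close> by a path \<open>M\<close> of isomorphisms
  with the same ends turns \<open>L = T N\<close> into the path \<open>T M\<close> in
  \<open>GL\<close>. Both \<open>M\<close> and \<open>N\<close> fix the kernel of \<open>P\<close>,
  so the segment between them, multiplied by \<open>T\<close>, stays in \<open>Phi0\<close> and
  keeps its ends.\<close>

lemma deform_to_analytic_GL_path: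
  fixes L T :: "real \<Rightarrow> 'u::banach \<Rightarrow>\<^sub>L 'v::banach" and P :: "'u \<Rightarrow>\<^sub>L 'u"
  assumes ab: "a < b" and L: "continuous_on {a..b} L" "L a \<in> GL" "L b \<in> GL"
    and T: "continuous_on {a..b} T" "T ` {a..b} \<subseteq> GL" "\<And>t u. t \<in> {a..b} \<Longrightarrow> P u = 0 \<Longrightarrow> T t u = L t u"
    and PP: "\<And>u. P (P u) = P u" and fin: "finite_dim (range P)"
    and pc: "path_component (GL \<inter> kernel_fixing P) (blinfun_inv (T a) o\<^sub>L L a) (blinfun_inv (T b) o\<^sub>L L b)"
  obtains L\<omega> where "admissible_path L\<omega> a b" "analytic_path L\<omega> a b" "A_homotopic a b L\<omega> L" "Sigma_on {a..b} L\<omega> = {}"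
proof -
  let ?S = "GL \<inter> kernel_fixing P"
  define N where "N t = blinfun_inv (T t) o\<^sub>L L t" for t
  have TG: "T t \<in> GL" if "t \<in> {a..b}" for t using T(2) that by blast
  have TN: "T t o\<^sub>L N t = L t" if "t \<in> {a..b}" for t
    using TG[OF that] by (intro blinfun_eqI) (simp add: N_def)
  have Nk: "N t u = u" if "t \<in> {a..b}" "P u = 0" for t u
    using T(3)[OF that, symmetric] TG[OF that(1)] by (simp add: N_def)
  note compc = bounded_bilinear.continuous_on[OF bounded_bilinear_blinfun_compose]
  have cN: "continuous_on {a..b} N" unfolding N_def
    by (intro compc L(1) continuous_on_inv_comp T(1,2))
  obtain g where g': "path g" "path_image g \<subseteq> ?S" "pathstart g = N a" "pathfinish g = N b"
    using pc unfolding path_component_def N_def by auto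
  then have g: "continuous_on {0..1} g" "\<And>t. t \<in> {0..1} \<Longrightarrow> g t \<in> ?S" "g 0 = N a" "g 1 = N b"
    by (auto simp: path_def path_image_def pathstart_def pathfinish_def)
  define M where "M t = g ((t - a) / (b - a))" for t
  have par: "(t - a) / (b - a) \<in> {0..1}" if "t \<in> {a..b}" for t using that ab by (auto simp: divide_simps)
  have cM: "continuous_on {a..b} M" unfolding M_def
    by (rule continuous_on_compose2[OF g(1)]) (use ab par in \<open>auto intro!: continuous_intros\<close>)
  have MS: "M t \<in> ?S" if "t \<in> {a..b}" for t unfolding M_def by (rule g(2)[OF par[OF that]])
  have Mab: "M a = N a" "M b = N b" using g(3,4) ab by (auto simp: M_def)
  define G where "G t = T t o\<^sub>L M t" for t
  have cG: "continuous_on {a..b} G" unfolding G_def by (intro compc T(1) cM)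
  have GG: "G ` {a..b} \<subseteq> GL" using TG MS by (auto simp: G_def intro!: GL_compose)
  obtain L\<omega> where \<omega>: "analytic_path L\<omega> a b" "continuous_on {a..b} L\<omega>"
    "\<And>t s. t \<in> {a..b} \<Longrightarrow> s \<in> {0..1} \<Longrightarrow> (1 - s) *\<^sub>R L\<omega> t + s *\<^sub>R G t \<in> GL"
    using GL_path_analytic_approx[OF cG GG] by blast
  have \<omega>G: "L\<omega> t \<in> GL" if "t \<in> {a..b}" for t using \<omega>(3)[OF that, of 0] by simp
  let ?Q = "\<lambda>h :: real \<Rightarrow> 'u \<Rightarrow>\<^sub>L 'v. h a \<in> GL \<and> h b \<in> GL"
  have sndc: "continuous_on ({0..1::real} \<times> {a..b}) (\<lambda>y. f (snd y))" if "continuous_on {a..b} f" for f :: "real \<Rightarrow> 'w::topological_space"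
    by (rule continuous_on_compose2[OF that]) (auto intro!: continuous_intros)
  have aI: "a \<in> {a..b}" "b \<in> {a..b}" using ab by auto
  have h1: "homotopic_with_canon ?Q {a..b} Phi0 L\<omega> G"
  proof (rule homotopic_with_canonI[where h = "\<lambda>y. (1 - fst y) *\<^sub>R L\<omega> (snd y) + fst y *\<^sub>R G (snd y)"])
    show "continuous_on ({0..1} \<times> {a..b}) (\<lambda>y. (1 - fst y) *\<^sub>R L\<omega> (snd y) + fst y *\<^sub>R G (snd y))"
      by (intro continuous_intros sndc \<omega>(2) cG)
  qed (use \<omega>(3) aI in \<open>auto intro!: GL_imp_Phi0\<close>)
  have h2: "homotopic_with_canon ?Q {a..b} Phi0 G (\<lambda>t. T t o\<^sub>L N t)"
  proof (rule homotopic_with_canonI[where h = "\<lambda>y. T (snd y) o\<^sub>L ((1 - fst y) *\<^sub>R M (snd y) + fst y *\<^sub>R N (snd y))"])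
    show "continuous_on ({0..1} \<times> {a..b}) (\<lambda>y. T (snd y) o\<^sub>L ((1 - fst y) *\<^sub>R M (snd y) + fst y *\<^sub>R N (snd y)))"
      by (intro compc continuous_intros sndc T(1) cM cN)
    fix s t :: real assume st: "s \<in> {0..1}" "t \<in> {a..b}"
    have "T t o\<^sub>L ((1 - s) *\<^sub>R M t + s *\<^sub>R N t) \<in> Phi0"
    proof (rule finite_rank_Phi0[OF PP fin _ TG[OF st(2)]])
      fix u assume u: "P u = 0"
      have "M t u = u" using MS[OF st(2)] u by (simp add: kernel_fixing_def)
      then show "((1 - s) *\<^sub>R M t + s *\<^sub>R N t) u = u"
        using Nk[OF st(2) u] by (simp add: blinfun.add_left blinfun.scaleR_left flip: scaleR_left_distrib)
    qed
    then show "T (snd (s, t)) o\<^sub>L ((1 - fst (s, t)) *\<^sub>R M (snd (s, t)) + fst (s, t) *\<^sub>R N (snd (s, t))) \<in> Phi0" by simp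
  next
    fix s :: real assume "s \<in> {0..1}"
    have "(1 - s) *\<^sub>R M t + s *\<^sub>R N t = N t" if "M t = N t" for t using that by (simp flip: scaleR_left_distrib)
    then show "?Q (\<lambda>x. T (snd (s, x)) o\<^sub>L ((1 - fst (s, x)) *\<^sub>R M (snd (s, x)) + fst (s, x) *\<^sub>R N (snd (s, x))))"
      using Mab TN aI L(2,3) by simp
  qed (simp_all add: G_def)
  have "homotopic_with_canon ?Q {a..b} Phi0 L\<omega> (\<lambda>t. T t o\<^sub>L N t)" using h1 h2 by (rule homotopic_with_trans)
  then have "A_homotopic a b L\<omega> L" unfolding A_homotopic_def
    by (rule homotopic_with_eq) (use TN aI in auto)
  moreover have "admissible_path L\<omega> a b" unfolding admissible_path_def
    using \<omega>(2) \<omega>G aI by (auto intro: GL_imp_Phi0)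
  moreover have "Sigma_on {a..b} L\<omega> = {}" using \<omega>G by (auto simp: Sigma_on_def)
  ultimately show ?thesis using that \<omega>(1) by blast
qed

text \<open>
  The reduced equation \<open>Y = 0\<close> is completed by \<open>\<theta> = c\<close>, where \<open>\<theta>\<close> is the parameter near the trivial
  branch and vanishes away from it. Moving \<open>c\<close> from one end to the other is an admissible homotopy,
  and for the extreme values of \<open>c\<close> the only zeros are the two trivial ones.
\<close>

lemma bifurcation_same_component:
  fixes F :: "real \<times> 'u::banach \<Rightarrow> 'v::banach" and D :: "real \<times> 'u \<Rightarrow> 'u \<Rightarrow>\<^sub>L 'v" and P :: "'u \<Rightarrow>\<^sub>L 'u"
  assumes F: "continuous_on UNIV F" and D: "continuous_on UNIV D"
    and der: "\<And>l u. ((\<lambda>u. F (l, u)) has_derivative blinfun_apply (D (l, u))) (at u)"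
    and F0: "\<And>l. F (l, 0) = 0"
    and ab: "a < b" and GLab: "D (a, 0) \<in> GL" "D (b, 0) \<in> GL"
    and K: "compact K" "\<And>z. z \<in> K \<Longrightarrow> F z = 0"
    and PP: "\<And>u. P (P u) = P u" and fin: "finite_dim (range P)"
    and K': "K' = K \<union> {a..b} \<times> {0}"
    and \<epsilon>: "0 < \<epsilon>" "\<And>z y. F z = 0 \<Longrightarrow> y \<in> K' \<Longrightarrow> dist z y < \<epsilon> \<Longrightarrow> z \<in> K \<or> snd z = 0"
    and sep: "\<And>l u. (l, u) \<in> K \<Longrightarrow> l \<le> a \<or> b \<le> l \<Longrightarrow> P u \<noteq> 0"
    and inj: "\<And>z z'. z \<in> K' \<Longrightarrow> z' \<in> K' \<Longrightarrow> fst z = fst z' \<Longrightarrow> P (snd z) = P (snd z') \<Longrightarrow> z = z'"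
    and T: "continuous_on K' T" "T ` K' \<subseteq> GL" "\<And>z u. z \<in> K' \<Longrightarrow> P u = 0 \<Longrightarrow> T z u = D z u"
  shows "path_component (GL \<inter> kernel_fixing P) (blinfun_inv (T (a, 0)) o\<^sub>L D (a, 0)) (blinfun_inv (T (b, 0)) o\<^sub>L D (b, 0))"
proof (rule ccontr)
  let ?S = "GL \<inter> kernel_fixing P"
  assume neg: "\<not> ?thesis"
  have cK': "compact K'" unfolding K' using K(1) by (intro compact_Un compact_Times) auto
  have K'0: "F z = 0" if "z \<in> K'" for z using that K(2) F0 by (cases z) (auto simp: K')
  have "\<exists>\<Omega> \<xi> Th. open \<Omega> \<and> (\<forall>z\<in>K'. (fst z, P (snd z)) \<in> \<Omega>) \<and> continuous_on \<Omega> \<xi> \<and> continuous_on UNIV Th \<and>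
    (\<forall>z\<in>K'. Th (fst z, P (snd z)) = T z) \<and>
    (\<forall>p\<in>\<Omega>. F (fst p, snd p + (\<xi> p - P (\<xi> p))) + blinfun_apply (Th p) (P (\<xi> p)) = 0) \<and>
    (\<forall>p\<in>\<Omega>. \<exists>z\<in>K'. dist (fst p, snd p + (\<xi> p - P (\<xi> p))) z < \<epsilon>) \<and>
    (\<forall>z\<in>K'. \<xi> (fst z, P (snd z)) = snd z - P (snd z))"
    by (rule finite_dim_reduction[where F = F and D = D and K = K' and P = P and T = T and \<epsilon> = \<epsilon>];
      (fact F D der cK' K'0 PP inj T \<epsilon>(1))?) (intro exI conjI; assumption)
  then obtain \<Omega> \<xi> Th where \<Omega>: "open \<Omega>" "\<forall>z\<in>K'. (fst z, P (snd z)) \<in> \<Omega>" and \<xi>: "continuous_on \<Omega> \<xi>"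
    and Th: "continuous_on UNIV Th" "\<forall>z\<in>K'. Th (fst z, P (snd z)) = T z"
    and eq: "\<forall>p\<in>\<Omega>. F (fst p, snd p + (\<xi> p - P (\<xi> p))) + blinfun_apply (Th p) (P (\<xi> p)) = 0"
    and near: "\<forall>p\<in>\<Omega>. \<exists>z\<in>K'. dist (fst p, snd p + (\<xi> p - P (\<xi> p))) z < \<epsilon>"
    and \<xi>K: "\<forall>z\<in>K'. \<xi> (fst z, P (snd z)) = snd z - P (snd z)" by (elim exE conjE) (rule that)
  \<comment> \<open>The ends are indexed by the values \<open>0\<close> and \<open>1\<close> of the
    homotopy parameter, so that both are treated at once.\<close>
  define e :: "real \<Rightarrow> real" where "e i = (if i = 0 then a else b)" for i
  have eK: "(e i, 0) \<in> K'" for i using ab by (auto simp: K' e_def)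
  define N where "N i = blinfun_inv (T (e i, 0)) o\<^sub>L D (e i, 0)" for i
  have TG: "T (e i, 0) \<in> GL" for i using T(2) eK by blast
  have DG: "D (e i, 0) \<in> GL" for i using GLab by (simp add: e_def)
  have NS: "N i \<in> ?S" for i
  proof
    show "N i \<in> GL" unfolding N_def by (intro GL_compose blinfun_inv_GL TG DG)
    show "N i \<in> kernel_fixing P"
      using T(3)[OF eK[of i], symmetric] TG[of i] by (simp add: N_def kernel_fixing_def)
  qed
  have "\<exists>n (b' :: nat \<Rightarrow> 'u) (\<phi> :: nat \<Rightarrow> 'u \<Rightarrow>\<^sub>L real).
    (\<forall>i<n. \<forall>j<n. \<phi> i (b' j) = (if i = j then 1 else 0)) \<and> (\<forall>u. P u = (\<Sum>i<n. \<phi> i u *\<^sub>R b' i)) \<and> (\<forall>i<n. P (b' i) = b' i)"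
    by (rule projection_coordinates[OF PP fin]) (intro exI conjI; assumption)
  then obtain n b' and \<phi> :: "nat \<Rightarrow> 'u \<Rightarrow>\<^sub>L real" where
    b1: "\<forall>i<n. \<forall>j<n. \<phi> i (b' j) = (if i = j then 1 else 0)" and
    b2: "\<forall>u. P u = (\<Sum>i<n. \<phi> i u *\<^sub>R b' i)" and b3: "\<forall>i<n. P (b' i) = b' i"
    by (elim exE conjE) (rule that)
  define rf where "rf = refl_blinfun (\<phi> 0) (b' 0)"
  have cl: "path_component ?S (N i) id_blinfun \<or> 0 < n \<and> path_component ?S (N i) rf" for i
    unfolding rf_def by (rule kernel_fixing_path_component) (use b1 b2 NS in auto)
  have neg': "\<not> path_component ?S (N 0) (N 1)" using neg by (simp add: N_def e_def)
  have n: "0 < n"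
  proof (rule ccontr)
    assume "\<not> 0 < n"
    then have "path_component ?S (N 0) id_blinfun" "path_component ?S (N 1) id_blinfun" using cl by auto
    then show False using neg' by (meson path_component_sym path_component_trans)
  qed
  have "\<exists>w. (path_component ?S (N 0) (w 0) \<and> path_component ?S (N 1) (w (1::real))) \<and> (w 0 = id_blinfun \<and> w 1 = rf \<or> w 0 = rf \<and> w 1 = id_blinfun)"
  proof -
    \<comment> \<open>There are at most two components and the ends lie in different ones, so one
      end is joined to the identity and the other to the reflection.\<close>
    consider "path_component ?S (N 0) id_blinfun" "path_component ?S (N 1) rf" |
      "path_component ?S (N 0) rf" "path_component ?S (N 1) id_blinfun"
      using cl[of 0] cl[of 1] neg' by (meson path_component_sym path_component_trans)
    then show ?thesis
    proof cases
      case 1 then show ?thesis by (intro exI[of _ "\<lambda>i. if i = 0 then id_blinfun else rf"]) auto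
    next
      case 2 then show ?thesis by (intro exI[of _ "\<lambda>i. if i = 0 then rf else id_blinfun"]) auto
    qed
  qed
  then obtain w where w: "path_component ?S (N 0) (w 0)" "path_component ?S (N 1) (w (1::real))"
    "w 0 = id_blinfun \<and> w 1 = rf \<or> w 0 = rf \<and> w 1 = id_blinfun" by blast
  have "\<exists>g. continuous_on {0..1::real} g \<and> (\<forall>t\<in>{0..1}. g t \<in> ?S) \<and> g 0 = N i \<and> g 1 = w i" if i: "i \<in> {0, 1}" for i
  proof -
    have "path_component ?S (N i) (w i)" using w i by auto
    then obtain g where "path g" "path_image g \<subseteq> ?S" "pathstart g = N i" "pathfinish g = w i"
      unfolding path_component_def by auto
    then show ?thesis
      by (intro exI[of _ g]) (auto simp: path_def path_image_def pathstart_def pathfinish_def)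
  qed
  then obtain g where g: "\<And>i. i \<in> {0, 1} \<Longrightarrow> continuous_on {0..1::real} (g i)"
    "\<And>i t. i \<in> {0, 1} \<Longrightarrow> t \<in> {0..1} \<Longrightarrow> g i t \<in> ?S" "\<And>i. i \<in> {0, 1} \<Longrightarrow> g i 0 = N i" "\<And>i. i \<in> {0, 1} \<Longrightarrow> g i 1 = w i"
    by metis
  \<comment> \<open>Parameter and range of \<open>P\<close> together: the space of the reduced
    problem, of dimension \<open>n + 1\<close>.\<close>
  define E where "E = (UNIV :: real set) \<times> range (blinfun_apply P)"
  have E: "subspace E" unfolding E_def by (intro subspace_Times) (auto simp: linear_subspace_image)
  have EP: "P (snd p) = snd p" if "p \<in> E" for p using that PP by (auto simp: E_def)
  have EI: "(l, P u) \<in> E" for l u by (simp add: E_def)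
  have EI': "(l, u) \<in> E" if "P u = u" for l u using EI[of l u] that by simp
  \<comment> \<open>By compactness and \<open>sep\<close>, solutions of \<open>K\<close> over
    parameters outside the open interval keep a positive distance from the axis, measured through
    \<open>P\<close>.\<close>
  obtain \<rho> where \<rho>: "0 < \<rho>" "\<And>l u. (l, u) \<in> K \<Longrightarrow> l \<le> a \<or> b \<le> l \<Longrightarrow> \<rho> \<le> norm (P u)"
  proof -
    define K2 where "K2 = K \<inter> ({z. fst z \<le> a} \<union> {z. b \<le> fst z})"
    have "compact K2" unfolding K2_def
      by (intro compact_Int_closed K(1) closed_Un closed_Collect_le continuous_intros)
    show ?thesis
    proof (cases "K2 = {}")
      case True
      then show ?thesis by (intro that[of 1]) (force simp: K2_def)+
    next
      case False
      have "continuous_on K2 (\<lambda>z. norm (P (snd z)))" by (intro continuous_intros)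
      from continuous_attains_inf[OF \<open>compact K2\<close> False this]
      obtain z0 where z0: "z0 \<in> K2" "\<And>z. z \<in> K2 \<Longrightarrow> norm (P (snd z0)) \<le> norm (P (snd z))" by auto
      have "P (snd z0) \<noteq> 0" using sep[of "fst z0" "snd z0"] z0(1) by (auto simp: K2_def)
      moreover have "norm (P (snd z0)) \<le> norm (P u)" if lu: "(l, u) \<in> K" "l \<le> a \<or> b \<le> l" for l u
        using z0(2)[of "(l, u)"] lu by (simp add: K2_def)
      ultimately show ?thesis using that[of "norm (P (snd z0))"] by simp
    qed
  qed
  define m where "m = (a + b) / 2"
  define h where "h = (b - a) / 2"
  have h: "0 < h" "a - m = - h" "b - m = h" using ab by (auto simp: h_def m_def field_simps)
  define cut where "cut t = max 0 (min 1 (2 - 2 * t / \<rho>))" for t :: real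
  have cut: "0 \<le> cut t" "cut t \<le> 1" "\<rho> \<le> t \<Longrightarrow> cut t = 0" "t \<le> \<rho> / 2 \<Longrightarrow> cut t = 1" for t
    using \<rho>(1) by (auto simp: cut_def field_simps)
  \<comment> \<open>Cutting off at \<open>\<rho>\<close> makes \<open>\<theta>\<close> vanish at the
    reduced image of every point of \<open>K\<close> whose parameter lies outside the open interval,
    so such points never produce the values \<open>- h\<close> and \<open>h\<close>.\<close>
  define \<theta> where "\<theta> p = (fst p - m) * cut (norm (snd p))" for p :: "real \<times> 'u"
  have c\<theta>: "continuous_on X \<theta>" for X unfolding \<theta>_def cut_def using \<rho>(1) by (intro continuous_intros) auto
  define Y where "Y p = - P (\<xi> p)" for p
  have cY: "continuous_on \<Omega> Y" unfolding Y_def by (intro continuous_intros \<xi>)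
  define \<kappa> where "\<kappa> z = (fst z, P (snd z))" for z :: "real \<times> 'u"
  have c\<kappa>: "compact (\<kappa> ` K')" unfolding \<kappa>_def by (intro compact_continuous_image continuous_intros cK')
  have \<kappa>\<Omega>: "\<kappa> ` K' \<subseteq> \<Omega> \<inter> E" using \<Omega>(2) EI by (auto simp: \<kappa>_def)
  \<comment> \<open>A compact set containing every zero met while \<open>c\<close> runs through
    \<open>{0..1}\<close>, since \<open>\<theta>\<close> is then confined to
    \<open>{- h..h}\<close>.\<close>
  define Z where "Z = \<kappa> ` K' \<inter> (\<lambda>p. (Y p, \<theta> p)) -` ({0} \<times> {- h..h})"
  have "continuous_on (\<kappa> ` K') (\<lambda>p. (Y p, \<theta> p))"
    using \<kappa>\<Omega> by (intro continuous_intros c\<theta> continuous_on_subset[OF cY]) auto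
  then have "closedin (top_of_set (\<kappa> ` K')) Z" unfolding Z_def
    by (intro continuous_closedin_preimage closed_Times) auto
  then have cZ: "compact Z" using c\<kappa> closedin_compact by blast
  have ZE: "Z \<subseteq> \<Omega> \<inter> E" using \<kappa>\<Omega> by (auto simp: Z_def)
  \<comment> \<open>Where \<open>P \<xi>\<close> vanishes, \<open>z\<close> solves the original
    equation near \<open>K'\<close>, hence lies in \<open>K\<close> or on the axis; on the axis the
    bound on \<open>\<theta>\<close> puts the parameter into \<open>{a..b}\<close>.\<close>
  have zeros: "\<exists>z. z \<in> K' \<and> p = \<kappa> z \<and> (z \<in> K \<or> snd p = 0 \<and> \<theta> p = fst p - m)"
    if p: "p \<in> \<Omega> \<inter> E" "Y p = 0" "\<theta> p \<in> {- h..h}" for p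
  proof -
    have P0: "P (\<xi> p) = 0" using p(2) by (simp add: Y_def)
    define z where "z = (fst p, snd p + \<xi> p)"
    have Fz: "F z = 0" using eq p(1) P0 by (auto simp: z_def blinfun.zero_right)
    have nz: "\<exists>y\<in>K'. dist z y < \<epsilon>" using bspec[OF near, of p] p(1) P0 by (simp add: z_def)
    have pz: "p = \<kappa> z" using P0 EP[of p] p(1) by (simp add: \<kappa>_def z_def blinfun.add_right)
    show ?thesis
    proof (cases "z \<in> K")
      case True then show ?thesis using pz by (intro exI[of _ z]) (auto simp: K')
    next
      case False
      then have s0: "snd z = 0" using \<epsilon>(2)[OF Fz] nz by blast
      then have sp: "snd p = 0" using pz by (simp add: \<kappa>_def blinfun.zero_right)
      have \<theta>p: "\<theta> p = fst p - m" using cut(4)[of 0] \<rho>(1) sp by (simp add: \<theta>_def)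
      then have "fst p \<in> {a..b}" using p(3) h by auto
      then have "z \<in> K'" using s0 by (cases z) (auto simp: K' z_def)
      then show ?thesis using pz sp \<theta>p by (intro exI[of _ z]) auto
    qed
  qed
  define H where "H y = (\<theta> (snd y) - (2 * fst y - 1) * h, Y (snd y))" for y :: "real \<times> (real \<times> 'u)"
  \<comment> \<open>On \<open>E\<close> the summand \<open>x - P x\<close> is zero; off
    \<open>E\<close> it makes the end of \<open>G i\<close> the function \<open>id\<close> itself,
    not just its restriction, when \<open>w i\<close> is the identity.\<close>
  define G where "G i y = (fst (snd y), (snd (snd y) - P (snd (snd y))) + P (g i (fst y) (snd (snd y))))"
    for i :: real and y :: "real \<times> (real \<times> 'u)"
  define r where "r p = (fst p, (snd p - P (snd p)) + P (rf (snd p)))" for p :: "real \<times> 'u"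
  define z where "z i = (e i, 0 :: 'u)" for i
  have HZ: "p \<in> Z" if c: "c \<in> {0..1}" and p: "p \<in> \<Omega> \<inter> E" and H0: "H (c, p) = 0" for c p
  proof -
    have Yp: "Y p = 0" and \<theta>p: "\<theta> p = (2 * c - 1) * h" using H0 by (auto simp: H_def zero_prod_def)
    have "- h \<le> (2 * c - 1) * h" "(2 * c - 1) * h \<le> h"
      using c h(1) mult_right_mono[of "-1" "2 * c - 1" h] mult_right_mono[of "2 * c - 1" 1 h] by auto
    then have "\<theta> p \<in> {- h..h}" using \<theta>p by simp
    then show ?thesis using zeros[OF p Yp] Yp by (auto simp: Z_def)
  qed
  have zK: "z i \<in> K'" "\<kappa> (z i) = z i" for i using eK by (auto simp: z_def \<kappa>_def blinfun.zero_right)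
  have \<xi>z: "\<xi> (z i) = 0" for i using \<xi>K zK(1)[of i] by (auto simp: z_def blinfun.zero_right)
  have \<theta>z: "\<theta> (z i) = e i - m" for i using cut(4)[of 0] \<rho>(1) by (simp add: \<theta>_def z_def)
  have zZ: "z i \<in> Z" for i
  proof -
    have "z i \<in> \<kappa> ` K'" using zK(1)[of i] zK(2)[of i] by (metis imageI)
    moreover have "Y (z i) = 0" by (simp add: Y_def \<xi>z blinfun.zero_right)
    moreover have "\<theta> (z i) \<in> {- h..h}" using h by (simp add: \<theta>z e_def)
    ultimately show ?thesis by (simp add: Z_def)
  qed
  \<comment> \<open>At the extreme values \<open>\<theta>\<close> is \<open>- h\<close> or
    \<open>h\<close>. A point of \<open>K\<close> over the open interval has a smaller absolute
    value, one outside has \<open>\<theta> = 0\<close>, so only the trivial end remains.\<close>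
  have uniq: "p = z i" if i: "i \<in> {0, 1}" and p: "p \<in> \<Omega> \<inter> E" and H0: "H (i, p) = 0" for i p
  proof -
    have Yp: "Y p = 0" and \<theta>p: "\<theta> p = (2 * i - 1) * h" using H0 by (auto simp: H_def zero_prod_def)
    have \<theta>e: "\<theta> p = e i - m" using \<theta>p i h by (auto simp: e_def)
    have "\<theta> p \<in> {- h..h}" using \<theta>p i h by auto
    from zeros[OF p Yp this] obtain y where y: "y \<in> K'" "p = \<kappa> y" "y \<in> K \<or> snd p = 0 \<and> \<theta> p = fst p - m" by blast
    show ?thesis
    proof (cases "y \<in> K")
      case True
      have "\<not> (fst y \<le> a \<or> b \<le> fst y)"
      proof
        assume "fst y \<le> a \<or> b \<le> fst y"
        then have "\<rho> \<le> norm (snd p)" using \<rho>(2)[of "fst y" "snd y"] True y(2) by (simp add: \<kappa>_def)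
        then have "\<theta> p = 0" using cut(3) by (simp add: \<theta>_def)
        then show False using \<theta>p i h by auto
      qed
      then have "- h < fst p - m" "fst p - m < h" using y(2) h by (auto simp: \<kappa>_def)
      then have "\<bar>\<theta> p\<bar> < h"
        unfolding \<theta>_def abs_mult using cut(1,2)[of "norm (snd p)"] mult_left_le[of "cut (norm (snd p))" "\<bar>fst p - m\<bar>"]
        by auto
      then show ?thesis using \<theta>p i by auto
    next
      case False
      then show ?thesis using y(3) \<theta>e by (intro prod_eqI) (auto simp: z_def)
    qed
  qed
  have d: "\<exists>d>0. ball (z i) d \<subseteq> \<Omega> \<and> (\<forall>p s. p \<in> ball (z i) d \<inter> E \<longrightarrow> s \<in> {0..1} \<longrightarrow>
      (1 - s) *\<^sub>R H (i, p) + s *\<^sub>R G i (0, p - z i) = 0 \<longrightarrow> p = z i)" if i: "i \<in> {0, 1}" for i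
  proof -
    \<comment> \<open>\<open>q\<close> bounds the inverse of the corner of \<open>N i\<close> on the
      range of \<open>P\<close>; the linearization error \<open>e'\<close> satisfies
      \<open>q * e' < 1\<close>, so the linear part dominates along the whole segment in
      \<open>s\<close>.\<close>
    define q where "q = norm (P o\<^sub>L blinfun_inv (N i))"
    define e' where "e' = 1 / (2 * (q + 1))"
    have q0: "0 \<le> q" by (simp add: q_def)
    have e': "0 < e'" "q * e' < 1" using q0 by (auto simp: e'_def field_simps)
    have zO: "z i \<in> \<Omega>" using zZ ZE by blast
    obtain d1 where d1: "0 < d1" "\<And>x. norm x < d1 \<Longrightarrow> (e i, x) \<in> \<Omega> \<and>
        norm (P (\<xi> (e i, x)) + P (blinfun_inv (T (e i, 0)) (D (e i, 0) x))) \<le> e' * norm x"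
    proof (rule reduction_linearization[where F = F and l = "e i" and L = "D (e i, 0)" and ?T0.0 = "T (e i, 0)"
          and P = P and \<Omega> = \<Omega> and \<xi> = \<xi> and Th = Th and e = e'])
      show "Th (e i, 0) = T (e i, 0)" using Th(2) eK[of i] by (auto simp: blinfun.zero_right)
      show "\<xi> (e i, 0) = 0" using \<xi>z[of i] by (simp add: z_def)
      show "(e i, 0) \<in> \<Omega>" using zO by (simp add: z_def)
    qed (use der F0 TG T(3)[OF eK] PP \<Omega> \<xi> Th eq e' in auto)
    obtain d2 where d2: "0 < d2" "ball (z i) d2 \<subseteq> \<Omega>" using \<Omega>(1) zO openE by blast
    \<comment> \<open>Within \<open>\<rho> / 2\<close> the cutoff is \<open>1\<close>, so the first
      component is affine and forces \<open>fst p = e i\<close>.\<close>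
    define d where "d = min (min d1 d2) (\<rho> / 2)"
    show ?thesis
    proof (intro exI[of _ d] conjI allI impI)
      show "0 < d" using d1 d2 \<rho> by (simp add: d_def)
      show "ball (z i) d \<subseteq> \<Omega>" using d2 by (auto simp: d_def)
      fix p s assume p: "p \<in> ball (z i) d \<inter> E" and s: "s \<in> {0..1}"
        and 0: "(1 - s) *\<^sub>R H (i, p) + s *\<^sub>R G i (0, p - z i) = 0"
      define x where "x = snd p"
      have Px: "P x = x" using EP p by (simp add: x_def)
      have "dist (z i) p < d" using p by simp
      then have nx: "norm x < d"
        using dist_snd_le[of "z i" p] by (simp add: z_def x_def)
      have \<theta>p: "\<theta> p = fst p - m" using cut(4)[of "norm x"] nx by (simp add: \<theta>_def x_def d_def)
      have em: "e i - m = (2 * i - 1) * h" using i h by (auto simp: e_def)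
      have "(1 - s) * (fst p - m - (2 * i - 1) * h) + s * (fst p - e i) = 0"
        using arg_cong[OF 0, of fst] \<theta>p by (simp add: H_def G_def z_def)
      then have "(1 - s) * (fst p - e i) + s * (fst p - e i) = 0" unfolding em[symmetric] by simp
      then have fp: "fst p = e i" by (simp add: algebra_simps)
      have "(1 - s) *\<^sub>R Y p + s *\<^sub>R P (N i x) = 0"
        using arg_cong[OF 0, of snd] Px g(3)[OF i] by (simp add: H_def G_def z_def x_def)
      then have "P (N i x) = (1 - s) *\<^sub>R (P (N i x) - Y p)" by (simp add: algebra_simps add_eq_0_iff)
      also have "P (N i x) - Y p = P (\<xi> (e i, x)) + P (blinfun_inv (T (e i, 0)) (D (e i, 0) x))"
        using fp by (simp add: N_def Y_def x_def) (metis prod.collapse add.commute)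
      finally have "norm (P (N i x)) \<le> 1 * norm (P (\<xi> (e i, x)) + P (blinfun_inv (T (e i, 0)) (D (e i, 0) x)))"
        using s by (metis (no_types, lifting) norm_scaleR mult_right_mono norm_ge_zero abs_of_nonneg atLeastAtMost_iff diff_ge_0_iff_ge diff_le_eq le_add_same_cancel1)
      also have "\<dots> \<le> e' * norm x" using d1(2)[of x] nx by (simp add: d_def)
      finally have PN: "norm (P (N i x)) \<le> e' * norm x" .
      have "x = (P o\<^sub>L blinfun_inv (N i)) (P (N i x))" using kernel_fixing_inverse[OF PP NS Px] by simp
      then have "norm x \<le> q * norm (P (N i x))" unfolding q_def by (metis norm_blinfun)
      also have "\<dots> \<le> q * (e' * norm x)" using PN q0 by (intro mult_left_mono)
      finally have "norm x * (1 - q * e') \<le> 0" by (simp add: algebra_simps)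
      then have "x = 0" using e'(2) by (simp add: mult_le_0_iff)
      then show "p = z i" using fp by (intro prod_eqI) (auto simp: z_def x_def)
    qed
  qed
  obtain d0 where d0: "0 < d0" "ball (z 0) d0 \<subseteq> \<Omega>" "\<And>p s. p \<in> ball (z 0) d0 \<inter> E \<Longrightarrow> s \<in> {0..1} \<Longrightarrow>
      (1 - s) *\<^sub>R H (0, p) + s *\<^sub>R G 0 (0, p - z 0) = 0 \<Longrightarrow> p = z 0" using d[of 0] by auto
  obtain d1 where d1: "0 < d1" "ball (z 1) d1 \<subseteq> \<Omega>" "\<And>p s. p \<in> ball (z 1) d1 \<inter> E \<Longrightarrow> s \<in> {0..1} \<Longrightarrow>
      (1 - s) *\<^sub>R H (1, p) + s *\<^sub>R G 1 (0, p - z 1) = 0 \<Longrightarrow> p = z 1" using d[of 1] by auto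
  \<comment> \<open>The parameter takes the last index \<open>n\<close>, so that coordinate
    \<open>0\<close>, where the reflection acts, belongs to the range of \<open>P\<close>.\<close>
  define k where "k p i = (if i < n then \<phi> i (snd p) else if i = n then fst p else 0)" for p :: "real \<times> 'u" and i
  define J where "J s = (s n, \<Sum>i<n. s i *\<^sub>R b' i)" for s :: "nat \<Rightarrow> real"
  have b0: "\<phi> 0 (b' 0) = 1" using b1 n by auto
  have rfx: "rf x = x - (2 * \<phi> 0 x) *\<^sub>R b' 0" for x
    by (simp add: rf_def refl_blinfun_def blinfun.bilinear_simps b0 mult.commute)
  have \<phi>rf: "\<phi> i (rf x) = (if i = 0 then - \<phi> i x else \<phi> i x)" if "i < n" for i x
    using b1 n that by (auto simp: rfx blinfun.bilinear_simps)
  have Prf: "P (rf x) = rf x" if "P x = x" for x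
    using that b3 n by (simp add: rfx blinfun.bilinear_simps)
  have \<phi>sum: "\<phi> j (\<Sum>i<n. s i *\<^sub>R b' i) = s j" if "j < n" for j and s :: "nat \<Rightarrow> real"
  proof -
    have "\<phi> j (\<Sum>i<n. s i *\<^sub>R b' i) = (\<Sum>i<n. if i = j then s j else 0)"
      unfolding blinfun.sum_right using b1 that by (intro sum.cong) (auto simp: blinfun.scaleR_right)
    then show ?thesis using that by simp
  qed
  show False
  proof (rule linear_isos_same_degree[where E = E and \<Omega> = \<Omega> and Z = Z and H = H and z = z and d = "min d0 d1"
        and G = G and k = k and N = n and J = J and r = r])
    show "continuous_on ({0..1} \<times> (\<Omega> \<inter> E)) H" unfolding H_def
    proof (intro continuous_intros)
      show "continuous_on ({0..1} \<times> (\<Omega> \<inter> E)) (\<lambda>y. \<theta> (snd y))"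
        by (rule continuous_on_compose2[OF c\<theta>[of UNIV]]) (auto intro!: continuous_intros)
      show "continuous_on ({0..1} \<times> (\<Omega> \<inter> E)) (\<lambda>y. Y (snd y))"
        by (rule continuous_on_compose2[OF cY]) (auto intro!: continuous_intros)
    qed
    show "H (c, p) \<in> E" if "c \<in> {0..1}" "p \<in> \<Omega> \<inter> E" for c p
      by (simp add: H_def Y_def E_def flip: blinfun.minus_right)
    show "p \<in> Z" if "c \<in> {0..1}" "p \<in> \<Omega> \<inter> E" "H (c, p) = 0" for c p using HZ that by blast
    show "z i \<in> Z" for i by (rule zZ)
    show "ball (z i) (min d0 d1) \<subseteq> \<Omega>" if "i \<in> {0, 1}" for i using that d0(2) d1(2) by auto
    show "p = z i" if "i \<in> {0, 1}" "p \<in> \<Omega> \<inter> E" "H (i, p) = 0" for i p using uniq that by blast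
    show "p = z i" if "i \<in> {0, 1}" "p \<in> ball (z i) (min d0 d1) \<inter> E" "s \<in> {0..1}"
      "(1 - s) *\<^sub>R H (i, p) + s *\<^sub>R G i (0, p - z i) = 0" for i p s
      using that(1) d0(3)[of p s] d1(3)[of p s] that(2-4) by auto
    show "continuous_on ({0..1} \<times> E) (G i)" if i: "i \<in> {0, 1}" for i
    proof -
      have "continuous_on ({0..1::real} \<times> E) (\<lambda>y. g i (fst y))"
        by (rule continuous_on_compose2[OF g(1)[OF i]]) (auto intro!: continuous_intros)
      then show ?thesis unfolding G_def by (intro continuous_intros)
    qed
    show "G i (t, p) \<in> E" if "p \<in> E" for i t p
      using EP[OF that] EI by (simp add: G_def)
    show "p = 0" if i: "i \<in> {0, 1}" and t: "t \<in> {0..1}" and p: "p \<in> E" and 0: "G i (t, p) = 0" for i t p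
    proof -
      have "fst p = 0" "P (g i t (snd p)) = 0" using 0 EP[OF p] by (auto simp: G_def zero_prod_def)
      moreover have "snd p = 0"
        using kernel_fixing_inverse[OF PP g(2)[OF i t] EP[OF p]] calculation(2) by (simp add: blinfun.zero_right)
      ultimately show ?thesis by (simp add: prod_eq_iff)
    qed
    have "(\<lambda>p. G i (1, p)) = (\<lambda>p. (fst p, (snd p - P (snd p)) + P (w i (snd p))))" if "i \<in> {0, 1}" for i
      using g(4)[OF that] by (simp add: G_def)
    then show "{\<lambda>p. G 0 (1, p), \<lambda>p. G 1 (1, p)} = {id, r}"
      using w(3) by (auto simp: r_def[abs_def] id_def insert_commute)
    show "continuous_on E (\<lambda>p. k p i)" for i
      unfolding k_def by (cases "i < n"; cases "i = n") (auto intro!: continuous_intros)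
    show "k p i = 0" if "n < i" for p i using that by (simp add: k_def)
    show "k (t *\<^sub>R p) i = t * k p i" for t p i by (simp add: k_def blinfun.scaleR_right)
    show "p = 0" if p: "p \<in> E" and 0: "\<And>i. i \<le> n \<Longrightarrow> k p i = 0" for p
    proof -
      have "fst p = 0" using 0[of n] by (simp add: k_def)
      moreover have "\<phi> i (snd p) = 0" if "i < n" for i using 0[of i] that by (simp add: k_def)
      then have "P (snd p) = 0" using b2 by simp
      ultimately show ?thesis using EP[OF p] by (simp add: prod_eq_iff)
    qed
    show "continuous_map (nsphere n) (top_of_set E) J"
    proof -
      have pr: "continuous_map (nsphere n) euclidean (\<lambda>s. s i)" for i :: nat
        by (rule continuous_map_nsphere_projection)
      have "continuous_map (nsphere n) euclidean (\<lambda>s. \<Sum>i<n. s i *\<^sub>R b' i)"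
      proof (rule continuous_map_sum)
        fix i
        have "continuous_map euclidean euclidean (\<lambda>c::real. c *\<^sub>R b' i)" by (auto intro!: continuous_intros)
        from continuous_map_compose[OF pr[of i] this]
        show "continuous_map (nsphere n) euclidean (\<lambda>s. s i *\<^sub>R b' i)" by (simp add: o_def)
      qed simp
      with pr[of n] have "continuous_map (nsphere n) (prod_topology euclidean euclidean) J"
        unfolding J_def by (rule continuous_map_pairedI)
      moreover have "J s \<in> E" for s
      proof -
        have "P (\<Sum>i<n. s i *\<^sub>R b' i) = (\<Sum>i<n. s i *\<^sub>R b' i)"
          using b3 by (simp add: blinfun.sum_right blinfun.scaleR_right)
        then show ?thesis unfolding J_def by (rule EI')
      qed
      ultimately show ?thesis by (auto simp: continuous_map_in_subtopology)
    qed
    show "k (J s) = s" if "s \<in> topspace (nsphere n)" for s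
      using that \<phi>sum by (auto simp: k_def J_def nsphere fun_eq_iff)
    show "continuous_on E r" unfolding r_def by (intro continuous_intros)
    show "r p \<in> E" if "p \<in> E" for p using EP[OF that] EI by (simp add: r_def)
    show "k (r p) i = (if i = 0 then - k p i else k p i)" if "p \<in> E" for p i
      using EP[OF that] n \<phi>rf Prf by (auto simp: k_def r_def)
  qed (use E \<Omega> cZ ZE d0 d1 in auto)
qed

text \<open>Near \<open>z0\<close> the difference of \<open>F (l, u)\<close> and
  \<open>D z0 u\<close> has Lipschitz constant \<open>1 / (2 * c)\<close> in \<open>u\<close>, too
  small to compensate the expansion of \<open>D z0\<close> by at least \<open>1 / c\<close> on the
  kernel of \<open>P\<close>.\<close>

lemma slice_injective:
  fixes F :: "real \<times> 'u::real_normed_vector \<Rightarrow> 'v::real_normed_vector" and D :: "real \<times> 'u \<Rightarrow> 'u \<Rightarrow>\<^sub>L 'v"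
    and P :: "'u \<Rightarrow>\<^sub>L 'u"
  assumes D: "continuous_on UNIV D" and der: "\<And>l u. ((\<lambda>u. F (l, u)) has_derivative blinfun_apply (D (l, u))) (at u)"
    and c: "0 < c" "\<And>w. P w = 0 \<Longrightarrow> norm w \<le> c * norm (D z0 w)"
  obtains d where "0 < d" "\<And>l u v. (l, u) \<in> ball z0 d \<Longrightarrow> (l, v) \<in> ball z0 d \<Longrightarrow> F (l, u) = F (l, v) \<Longrightarrow> P (u - v) = 0 \<Longrightarrow> u = v"
proof -
  have "0 < 1 / (2 * c)" using c by simp
  then obtain d where d: "0 < d" "\<And>y. dist y z0 < d \<Longrightarrow> dist (D y) (D z0) < 1 / (2 * c)"
    using D unfolding continuous_on_iff by (metis UNIV_I)
  show ?thesis
  proof (rule that[OF d(1)])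
    fix l u v
    assume uv: "(l, u) \<in> ball z0 d" "(l, v) \<in> ball z0 d" and eq: "F (l, u) = F (l, v)" and P: "P (u - v) = 0"
    define S where "S = {w. (l, w) \<in> ball z0 d}"
    have "convex S" unfolding S_def convex_alt
    proof (intro ballI allI impI)
      fix x y t assume xy: "x \<in> {w. (l, w) \<in> ball z0 d}" "y \<in> {w. (l, w) \<in> ball z0 d}" "0 \<le> t \<and> t \<le> (1::real)"
      have "(1 - t) *\<^sub>R (l, x) + t *\<^sub>R (l, y) \<in> ball z0 d"
        using convex_ball[of z0 d] xy unfolding convex_alt by blast
      then show "(1 - t) *\<^sub>R x + t *\<^sub>R y \<in> {w. (l, w) \<in> ball z0 d}" by (simp add: algebra_simps)
    qed
    define g where "g w = F (l, w) - D z0 w" for w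
    have "norm (g u - g v) \<le> 1 / (2 * c) * norm (u - v)"
    proof (rule differentiable_bound[OF \<open>convex S\<close>, where f' = "\<lambda>w. blinfun_apply (D (l, w) - D z0)"])
      fix w assume w: "w \<in> S"
      have "(g has_derivative (\<lambda>h. D (l, w) h - D z0 h)) (at w)" unfolding g_def
        by (intro has_derivative_diff der bounded_linear.has_derivative[OF blinfun.bounded_linear_right] has_derivative_ident)
      then show "(g has_derivative blinfun_apply (D (l, w) - D z0)) (at w within S)"
        by (simp add: blinfun.diff_left[abs_def] has_derivative_at_withinI minus_blinfun.rep_eq)
      have "dist (D (l, w)) (D z0) < 1 / (2 * c)" using w by (intro d(2)) (simp add: S_def dist_commute)
      then show "onorm (blinfun_apply (D (l, w) - D z0)) \<le> 1 / (2 * c)"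
        by (simp add: dist_norm norm_blinfun.rep_eq)
    qed (use uv in \<open>auto simp: S_def\<close>)
    moreover have "g u - g v = - D z0 (u - v)" using eq by (simp add: g_def blinfun.diff_right)
    ultimately have "norm (D z0 (u - v)) \<le> 1 / (2 * c) * norm (u - v)" by simp
    then have "c * norm (D z0 (u - v)) \<le> c * (1 / (2 * c) * norm (u - v))" using c(1) by (intro mult_left_mono) auto
    also have "\<dots> = norm (u - v) / 2" using c(1) by simp
    finally have "norm (u - v) \<le> norm (u - v) / 2" using c(2)[OF P] by linarith
    then show "u = v" by simp
  qed
qed

lemma GL_bounded_below:
  assumes "A \<in> GL"
  obtains c where "0 < c" "\<And>w. norm w \<le> c * norm (blinfun_apply A w)"
proof
  show "0 < norm (blinfun_inv A) + 1" by (simp add: add_nonneg_pos)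
  fix w
  have "norm w \<le> norm (blinfun_inv A) * norm (A w)"
    using norm_blinfun[of "blinfun_inv A" "A w"] assms by simp
  also have "\<dots> \<le> (norm (blinfun_inv A) + 1) * norm (A w)" by (intro mult_right_mono) auto
  finally show "norm w \<le> (norm (blinfun_inv A) + 1) * norm (A w)" .
qed

lemma partial_derivative:
  fixes F :: "real \<times> 'u::real_normed_vector \<Rightarrow> 'v::real_normed_vector"
  assumes "C1_map F"
  shows "continuous_on UNIV F" "continuous_on UNIV (D_u F)"
    "((\<lambda>u. F (l, u)) has_derivative blinfun_apply (D_u F (l, u))) (at u)"
proof -
  obtain DF where DF: "\<And>z. (F has_derivative blinfun_apply (DF z)) (at z)" "continuous_on UNIV DF"
    using assms unfolding C1_map_def by blast
  have "isCont F z" for z by (rule has_derivative_continuous[OF DF(1)])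
  then show "continuous_on UNIV F" by (simp add: continuous_at_imp_continuous_on)
  have bl: "bounded_linear (\<lambda>u::'u. (0::real, u))" by (intro bounded_linear_Pair bounded_linear_zero bounded_linear_ident)
  define \<iota> where "\<iota> = Blinfun (\<lambda>u::'u. (0::real, u))"
  have \<iota>: "\<iota> u = (0, u)" for u by (simp add: \<iota>_def bounded_linear_Blinfun_apply[OF bl])
  have der: "((\<lambda>u. F (l, u)) has_derivative blinfun_apply (DF (l, u) o\<^sub>L \<iota>)) (at u)" for l u
  proof -
    have "((\<lambda>u. (l, u)) has_derivative (\<lambda>h. (0, h))) (at u)" by (auto intro!: derivative_eq_intros)
    from has_derivative_compose[OF this DF(1)] show ?thesis by (simp add: \<iota> o_def blinfun_compose.rep_eq)
  qed
  have eq: "D_u F (l, u) = DF (l, u) o\<^sub>L \<iota>" for l u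
    by (simp add: D_u_def frechet_derivative_at[OF der, symmetric] blinfun_apply_inverse)
  then show "((\<lambda>u. F (l, u)) has_derivative blinfun_apply (D_u F (l, u))) (at u)" using der by simp
  have "D_u F = (\<lambda>z. DF z o\<^sub>L \<iota>)" using eq by auto
  then show "continuous_on UNIV (D_u F)"
    using DF(2) by (auto intro!: bounded_bilinear.continuous_on[OF bounded_bilinear_blinfun_compose] continuous_intros)
qed

subsection \<open>Admissible families of intervals\<close>

lemma gap_index_imp:
  assumes "n \<in> gap_index r s"
  shows "n \<in> family_index r s" "n - 1 \<in> family_index r s"
  using assms unfolding gap_index_def family_index_def
  by (cases r; cases s; auto simp: one_extended_def)+

lemma family_index_step:
  assumes "k \<in> family_index r s" "k + 1 \<in> family_index r s"
  shows "k + 1 \<in> gap_index r s"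
  using assms unfolding gap_index_def family_index_def
  by (cases r; cases s; auto simp: one_extended_def)

lemma family_index_convex:
  assumes "k \<in> family_index r s" "k' \<in> family_index r s" "k \<le> j" "j \<le> k'"
  shows "j \<in> family_index r s"
  using assms unfolding family_index_def by (cases r; cases s; auto)

context
  fixes \<Sigma> :: "real set" and r s :: "int extended" and J :: "int \<Rightarrow> real set"
  assumes adm: "admissible_family \<Sigma> r s J"
begin

lemma J_open: "k \<in> family_index r s \<Longrightarrow> open (J k)"
  and J_ne: "k \<in> family_index r s \<Longrightarrow> J k \<noteq> {}"
  and J_interval: "k \<in> family_index r s \<Longrightarrow> is_interval (J k)"
  and J_disjoint: "k \<in> family_index r s \<Longrightarrow> J k \<inter> \<Sigma> = {}"
  using adm unfolding admissible_family_def by auto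

lemma J_step: "k \<in> gap_index r s \<Longrightarrow> \<forall>x\<in>J (k - 1). \<forall>y\<in>J k. x < y"
  using adm unfolding admissible_family_def by simp

text \<open>The definition compares neighbouring intervals only; induction over the indices in
  between, whose intervals are nonempty, gives the rest.\<close>

lemma J_less:
  assumes "k \<in> family_index r s" "k' \<in> family_index r s" "k < k'" "x \<in> J k" "y \<in> J k'"
  shows "x < y"
proof -
  have "\<forall>x\<in>J k. \<forall>y\<in>J (k + 1 + int j). x < y" if "k + 1 + int j \<in> family_index r s" for j
    using that
  proof (induction j)
    case 0
    then have "k + 1 \<in> gap_index r s" using family_index_step assms(1) by simp
    from J_step[OF this] show ?case by simp
  next
    case (Suc j)
    have eqS: "k + 1 + int (Suc j) = k + 1 + int j + 1" by simp
    have mem: "k + 1 + int j \<in> family_index r s"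
      using family_index_convex[OF assms(1) Suc.prems] by simp
    have "k + 1 + int j + 1 \<in> gap_index r s"
      using family_index_step[OF mem] Suc.prems by (simp only: eqS)
    from J_step[OF this] have lt: "\<forall>x\<in>J (k + 1 + int j). \<forall>y\<in>J (k + 1 + int j + 1). x < y"
      by (simp only: add_diff_cancel_right')
    obtain w where "w \<in> J (k + 1 + int j)" using J_ne[OF mem] by blast
    then have "\<forall>x\<in>J k. \<forall>y\<in>J (k + 1 + int j + 1). x < y" using Suc.IH[OF mem] lt by (meson less_trans)
    then show ?case by (simp only: eqS)
  qed
  from this[of "nat (k' - k - 1)"] show ?thesis using assms by simp
qed

lemma J_between:
  assumes "k \<in> family_index r s" "x \<in> J k" "y \<in> J k" "x \<le> t" "t \<le> y"
  shows "t \<in> J k"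
  using J_interval[OF assms(1)] assms unfolding is_interval_1 by blast

lemma J_no_max: "k \<in> family_index r s \<Longrightarrow> x \<in> J k \<Longrightarrow> \<exists>y\<in>J k. x < y"
  and J_no_min: "k \<in> family_index r s \<Longrightarrow> x \<in> J k \<Longrightarrow> \<exists>y\<in>J k. y < x"
proof -
  assume k: "k \<in> family_index r s" and x: "x \<in> J k"
  obtain e where "0 < e" "ball x e \<subseteq> J k" using J_open[OF k] x openE by blast
  moreover have "x + e / 2 \<in> ball x e" "x - e / 2 \<in> ball x e" using \<open>0 < e\<close> by (auto simp: dist_real_def)
  ultimately have "x + e / 2 \<in> J k" "x - e / 2 \<in> J k" "x < x + e / 2" "x - e / 2 < x" by auto
  then show "\<exists>y\<in>J k. x < y" "\<exists>y\<in>J k. y < x" by blast+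
qed

context
  fixes n :: int
  assumes n: "n \<in> gap_index r s"
begin

lemma J_prev_less_Sup: "x \<in> J (n - 1) \<Longrightarrow> x < Sup (J (n - 1))"
  and Inf_less_J: "y \<in> J n \<Longrightarrow> Inf (J n) < y"
  and Sup_le_Inf: "Sup (J (n - 1)) \<le> Inf (J n)"
proof -
  note nI = gap_index_imp[OF n]
  have lt: "x < y" if "x \<in> J (n - 1)" "y \<in> J n" for x y using J_less[OF nI(2,1)] that by simp
  obtain x0 y0 where x0: "x0 \<in> J (n - 1)" and y0: "y0 \<in> J n" using J_ne nI by blast
  have ba: "bdd_above (J (n - 1))" using lt[OF _ y0] by (meson bdd_aboveI less_imp_le)
  have bb: "bdd_below (J n)" using lt[OF x0] by (meson bdd_belowI less_imp_le)
  show "x < Sup (J (n - 1))" if "x \<in> J (n - 1)" for x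
    using J_no_max[OF nI(2) that] cSup_upper[OF _ ba] by (meson less_le_trans)
  show "Inf (J n) < y" if "y \<in> J n" for y
    using J_no_min[OF nI(1) that] cInf_lower[OF _ bb] by (meson le_less_trans)
  show "Sup (J (n - 1)) \<le> Inf (J n)"
    using lt x0 y0 by (intro cSup_least cInf_greatest) (auto intro: less_imp_le)
qed

lemma gap_cases:
  assumes "x \<in> J (n - 1)" "y \<in> J n" "x < t" "t < y"
  shows "t \<in> J (n - 1) \<or> t \<in> gap J n \<or> t \<in> J n"
proof -
  note nI = gap_index_imp[OF n]
  consider "t < Sup (J (n - 1))" | "Inf (J n) < t" | "t \<in> gap J n" unfolding gap_def by force
  then show ?thesis
  proof cases
    case 1
    then obtain w where "w \<in> J (n - 1)" "t < w" using less_cSupE J_ne[OF nI(2)] by blast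
    then show ?thesis using J_between[OF nI(2) assms(1)] assms by auto
  next
    case 2
    then obtain w where "w \<in> J n" "w < t" using cInf_lessD J_ne[OF nI(1)] by blast
    then show ?thesis using J_between[OF nI(1) _ assms(2)] assms by auto
  qed simp
qed

lemma gap_disjoint:
  assumes "t \<in> gap J n" "k \<in> family_index r s"
  shows "t \<notin> J k"
proof
  assume t: "t \<in> J k"
  note nI = gap_index_imp[OF n]
  obtain x0 y0 where x0: "x0 \<in> J (n - 1)" and y0: "y0 \<in> J n" using J_ne nI by blast
  have tt: "Sup (J (n - 1)) \<le> t" "t \<le> Inf (J n)" using assms(1) by (auto simp: gap_def)
  consider "k < n - 1" | "k = n - 1" | "k = n" | "n < k" by linarith
  then show False
  proof cases
    case 1 then show ?thesis using J_less[OF assms(2) nI(2) _ t x0] J_prev_less_Sup[OF x0] tt by simp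
  next
    case 2 then show ?thesis using J_prev_less_Sup t tt by force
  next
    case 3 then show ?thesis using Inf_less_J t tt by force
  next
    case 4 then show ?thesis using J_less[OF nI(1) assms(2) _ y0 t] Inf_less_J[OF y0] tt by simp
  qed
qed

text \<open>The complement is open although the gap is closed: the union \<open>V\<close> of open
  intervals reaching from \<open>J (n - 1)\<close> to \<open>J n\<close> contains the gap and
  otherwise only points of these two intervals.\<close>

lemma closed_other_axis:
  "closed {t. t \<notin> (\<Union>k\<in>family_index r s. J k) \<and> t \<notin> gap J n}"
proof -
  note nI = gap_index_imp[OF n]
  define V where "V = (\<Union>x\<in>J (n - 1). \<Union>y\<in>J n. {x<..<y})"
  have gV: "gap J n \<subseteq> V"
  proof
    fix t assume t: "t \<in> gap J n"
    obtain x0 y0 where x0: "x0 \<in> J (n - 1)" and y0: "y0 \<in> J n" using J_ne nI by blast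
    then have "x0 < t" "t < y0" using J_prev_less_Sup[OF x0] Inf_less_J[OF y0] t by (auto simp: gap_def)
    then show "t \<in> V" using x0 y0 by (auto simp: V_def)
  qed
  have "V \<subseteq> (\<Union>k\<in>family_index r s. J k) \<union> gap J n"
    unfolding V_def using gap_cases nI by fastforce
  then have "- {t. t \<notin> (\<Union>k\<in>family_index r s. J k) \<and> t \<notin> gap J n} = (\<Union>k\<in>family_index r s. J k) \<union> V"
    using gV by auto
  moreover have "open ((\<Union>k\<in>family_index r s. J k) \<union> V)"
    unfolding V_def by (intro open_Un open_UN ballI J_open open_greaterThanLessThan)
  ultimately show ?thesis by (simp add: closed_def)
qed

end

text \<open>If there are intervals on both sides of \<open>t\<close>, the side has to change between
  two neighbouring indices, and \<open>t\<close> lies in the gap between them. Otherwise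
  \<open>t\<close> belongs to an unbounded end of the axis.\<close>

lemma axis_trichotomy:
  assumes t: "t \<notin> (\<Union>k\<in>family_index r s. J k)"
  shows "(\<exists>m\<in>gap_index r s. t \<in> gap J m) \<or> {..t} \<inter> (\<Union>k\<in>family_index r s. J k) = {} \<or>
    {t..} \<inter> (\<Union>k\<in>family_index r s. J k) = {}"
proof (rule ccontr)
  assume neg: "\<not> ?thesis"
  let ?I = "family_index r s"
  have side: "(\<forall>x\<in>J k. x < t) \<or> (\<forall>x\<in>J k. t < x)" if k: "k \<in> ?I" for k
  proof (rule ccontr)
    assume "\<not> ?thesis"
    then obtain x y where "x \<in> J k" "y \<in> J k" "t \<le> x" "y \<le> t" by (meson not_less)
    then show False using J_between[OF k] t k by blast
  qed
  obtain k1 x1 where k1: "k1 \<in> ?I" "x1 \<in> J k1" "x1 \<le> t" using neg by auto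
  obtain k2 x2 where k2: "k2 \<in> ?I" "x2 \<in> J k2" "t \<le> x2" using neg by auto
  have s1: "\<forall>x\<in>J k1. x < t" using side[OF k1(1)] k1 by force
  have s2: "\<forall>x\<in>J k2. t < x" using side[OF k2(1)] k2 by force
  have "k1 < k2"
  proof (rule ccontr)
    assume "\<not> k1 < k2"
    then consider "k1 = k2" | "k2 < k1" by linarith
    then show False
    proof cases
      case 1 then show ?thesis using s1 s2 k1 by force
    next
      case 2 then show ?thesis using J_less[OF k2(1) k1(1) _ k2(2) k1(2)] s1 s2 k1 k2 by force
    qed
  qed
  have mem: "k1 + int j \<in> ?I" if "k1 + int j \<le> k2" for j
    using family_index_convex[OF k1(1) k2(1) _ that] by simp
  \<comment> \<open>As no gap contains \<open>t\<close>, the side never changes, and every interval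
    up to \<open>k2\<close> would lie below \<open>t\<close>.\<close>
  have "\<forall>x\<in>J (k1 + int j). x < t" if "k1 + int j \<le> k2" for j
    using that
  proof (induction j)
    case 0 then show ?case using s1 by simp
  next
    case (Suc j)
    then have IH: "\<forall>x\<in>J (k1 + int j). x < t" by simp
    let ?m = "k1 + int j + 1"
    have eqS: "k1 + int (Suc j) = ?m" by simp
    have m: "k1 + int j \<in> ?I" "?m \<in> ?I" using mem[of j] mem[of "Suc j"] Suc.prems unfolding eqS by auto
    then have g: "?m \<in> gap_index r s" by (rule family_index_step)
    show ?case unfolding eqS
    proof (rule ccontr)
      assume "\<not> (\<forall>x\<in>J ?m. x < t)"
      then have "\<forall>x\<in>J ?m. t < x" using side[OF m(2)] by blast
      then have "t \<le> Inf (J ?m)" using J_ne[OF m(2)] by (intro cInf_greatest) (auto intro: less_imp_le)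
      moreover have "Sup (J (k1 + int j)) \<le> t" using J_ne[OF m(1)] IH by (intro cSup_least) (auto intro: less_imp_le)
      ultimately have "t \<in> gap J ?m" unfolding gap_def add_diff_cancel_right' by simp
      then show False using neg g by blast
    qed
  qed
  from this[of "nat (k2 - k1)"] have "\<forall>x\<in>J k2. x < t" using \<open>k1 < k2\<close> by simp
  then show False using s2 k2 by force
qed

end

subsection \<open>Isolated compact sets of solutions\<close>

text \<open>Two demands on \<open>P\<close> are met by one finite set of functionals: those of the
  trivialization make \<open>T\<close> possible and separate solutions close together on a slice;
  distant solutions are separated by Hahn-Banach and compactness.\<close>

lemma separating_parametrix:
  fixes F :: "real \<times> 'u::banach \<Rightarrow> 'v::banach" and D :: "real \<times> 'u \<Rightarrow> 'u \<Rightarrow>\<^sub>L 'v"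
  assumes D: "continuous_on UNIV D" and der: "\<And>l u. ((\<lambda>u. F (l, u)) has_derivative blinfun_apply (D (l, u))) (at u)"
    and Phi0: "\<And>z. D z \<in> Phi0"
    and Z: "compact Z" "Z \<noteq> {}" "\<And>z. z \<in> Z \<Longrightarrow> F z = 0"
  obtains P :: "'u \<Rightarrow>\<^sub>L 'u" and T where "\<forall>u. P (P u) = P u" "finite_dim (range (blinfun_apply P))"
    "\<forall>z\<in>Z. \<forall>z'\<in>Z. fst z = fst z' \<longrightarrow> P (snd z) = P (snd z') \<longrightarrow> z = z'"
    "continuous_on Z T" "T ` Z \<subseteq> GL" "\<forall>z\<in>Z. \<forall>u. P u = 0 \<longrightarrow> blinfun_apply (T z) u = D z u"
proof -
  \<comment> \<open>The cone over \<open>Z\<close> from the origin is compact and star-shaped, as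
    the trivialization requires.\<close>
  define C where "C = (\<lambda>y. fst y *\<^sub>R snd y) ` ({0..1::real} \<times> Z)"
  have cC: "compact C" unfolding C_def
    by (intro compact_continuous_image continuous_intros compact_Times Z(1)) auto
  obtain z1 where z1: "z1 \<in> Z" using Z(2) by blast
  have C0: "0 \<in> C" unfolding C_def using z1 by (auto intro!: image_eqI[of _ _ "(0, z1)"])
  have Cs: "t *\<^sub>R z \<in> C" if zC: "z \<in> C" and t: "t \<in> {0..1}" for z t
  proof -
    obtain s y where sy: "z = s *\<^sub>R y" "s \<in> {0..1}" "y \<in> Z" using zC unfolding C_def by force
    then have "t *\<^sub>R z = (t * s) *\<^sub>R y" "t * s \<in> {0..1}" using t by (auto intro: mult_le_one)
    then show ?thesis unfolding C_def using sy(3) by (auto intro!: image_eqI[of _ _ "(t * s, y)"])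
  qed
  have ZC: "Z \<subseteq> C" unfolding C_def by (auto intro!: image_eqI[of _ _ "(1, _)"])
  have contD: "continuous_on C D" using D continuous_on_subset by blast
  have "\<exists>\<Psi> :: ('u \<Rightarrow>\<^sub>L real) set. finite \<Psi> \<and> (\<forall>P :: 'u \<Rightarrow>\<^sub>L 'u. (\<forall>u. P (P u) = P u) \<longrightarrow> finite_dim (range P) \<longrightarrow>
      (\<forall>u. P u = 0 \<longrightarrow> (\<forall>\<psi>\<in>\<Psi>. blinfun_apply \<psi> u = 0)) \<longrightarrow>
      (\<exists>T. continuous_on C T \<and> T ` C \<subseteq> GL \<and> (\<forall>z\<in>C. \<forall>u. P u = 0 \<longrightarrow> blinfun_apply (T z) u = D z u)))"
  proof (rule fredholm_trivialization[where C = C and A = D])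
    fix \<Psi> :: "('u \<Rightarrow>\<^sub>L real) set"
    assume fin: "finite \<Psi>" and *: "\<And>P :: 'u \<Rightarrow>\<^sub>L 'u. (\<And>u. P (P u) = P u) \<Longrightarrow> finite_dim (range P) \<Longrightarrow>
      (\<And>u \<psi>. P u = 0 \<Longrightarrow> \<psi> \<in> \<Psi> \<Longrightarrow> \<psi> u = 0) \<Longrightarrow>
      \<exists>T. continuous_on C T \<and> T ` C \<subseteq> GL \<and> (\<forall>z\<in>C. \<forall>u. P u = 0 \<longrightarrow> T z u = D z u)"
    show ?thesis by (intro exI[of _ \<Psi>] conjI fin allI impI *) auto
  qed (use cC C0 Cs contD Phi0 in auto)
  then obtain \<Psi> :: "('u \<Rightarrow>\<^sub>L real) set" where \<Psi>: "finite \<Psi>"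
    "\<forall>P :: 'u \<Rightarrow>\<^sub>L 'u. (\<forall>u. P (P u) = P u) \<longrightarrow> finite_dim (range P) \<longrightarrow>
      (\<forall>u. P u = 0 \<longrightarrow> (\<forall>\<psi>\<in>\<Psi>. blinfun_apply \<psi> u = 0)) \<longrightarrow>
      (\<exists>T. continuous_on C T \<and> T ` C \<subseteq> GL \<and> (\<forall>z\<in>C. \<forall>u. P u = 0 \<longrightarrow> blinfun_apply (T z) u = D z u))" by blast
  obtain P0 :: "'u \<Rightarrow>\<^sub>L 'u" where P0: "P0 o\<^sub>L P0 = P0" "finite_dim (range P0)"
    "\<And>u. P0 u = 0 \<longleftrightarrow> (\<forall>\<psi>\<in>\<Psi>. \<psi> u = 0)" using finite_codim_projection[OF \<Psi>(1)] by blast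
  have PP0: "P0 (P0 u) = P0 u" for u using P0(1) by (metis blinfun_apply_blinfun_compose)
  obtain T0 where T0: "T0 ` C \<subseteq> GL" "\<forall>z\<in>C. \<forall>u. P0 u = 0 \<longrightarrow> T0 z u = D z u"
  proof -
    have "\<forall>u. P0 u = 0 \<longrightarrow> (\<forall>\<psi>\<in>\<Psi>. blinfun_apply \<psi> u = 0)" using P0(3) by simp
    then have "\<exists>T. continuous_on C T \<and> T ` C \<subseteq> GL \<and> (\<forall>z\<in>C. \<forall>u. P0 u = 0 \<longrightarrow> blinfun_apply (T z) u = D z u)"
      using \<Psi>(2) PP0 P0(2) by simp
    then show ?thesis by (elim exE conjE) (rule that)
  qed
  define good where "good z d \<longleftrightarrow> 0 < d \<and> (\<forall>l u v. (l, u) \<in> ball z d \<longrightarrow> (l, v) \<in> ball z d \<longrightarrow> F (l, u) = F (l, v) \<longrightarrow> P0 (u - v) = 0 \<longrightarrow> u = v)" for z d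
  have "\<exists>d. good z d" if z: "z \<in> Z" for z
  proof -
    have zC: "z \<in> C" using z ZC by blast
    have "T0 z \<in> GL" using T0(1) zC by blast
    then obtain c where c: "0 < c" "\<And>w. norm w \<le> c * norm (T0 z w)" using GL_bounded_below by blast
    have "norm w \<le> c * norm (D z w)" if "P0 w = 0" for w using c(2)[of w] T0(2) zC that by simp
    then obtain d where "0 < d" "\<And>l u v. (l, u) \<in> ball z d \<Longrightarrow> (l, v) \<in> ball z d \<Longrightarrow> F (l, u) = F (l, v) \<Longrightarrow> P0 (u - v) = 0 \<Longrightarrow> u = v"
      using slice_injective[OF D der c(1), where P = P0 and ?z0.0 = z] by blast
    then show ?thesis unfolding good_def by blast
  qed
  then obtain d where d: "\<And>z. z \<in> Z \<Longrightarrow> good z (d z)" by metis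
  \<comment> \<open>A Lebesgue number for the balls of local injectivity: solutions on one slice at
    distance below \<open>e\<close> are separated by \<open>P0\<close>.\<close>
  obtain e where e: "0 < e" "\<And>x. x \<in> Z \<Longrightarrow> \<exists>G\<in>(\<lambda>z. ball z (d z)) ` Z. ball x e \<subseteq> G"
  proof (rule Heine_Borel_lemma[OF Z(1)])
    show "Z \<subseteq> \<Union>((\<lambda>z. ball z (d z)) ` Z)" using d by (force simp: good_def)
  qed (use that in auto)
  have close: "u = v" if uv: "(l, u) \<in> Z" "(l, v) \<in> Z" "dist u v < e" "P0 (u - v) = 0" for l u v
  proof -
    obtain z where z: "z \<in> Z" "ball (l, u) e \<subseteq> ball z (d z)" using e(2)[OF uv(1)] by blast
    have "(l, u) \<in> ball (l, u) e" "(l, v) \<in> ball (l, u) e" using e(1) uv(3) by (auto simp: dist_Pair_Pair)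
    then have "(l, u) \<in> ball z (d z)" "(l, v) \<in> ball z (d z)" using z(2) by blast+
    moreover have "F (l, u) = F (l, v)" using Z(3) uv(1,2) by simp
    ultimately show ?thesis using d[OF z(1)] uv(4) unfolding good_def by blast
  qed
  \<comment> \<open>The pairs not handled by local injectivity; compactness leaves finitely many
    functionals to separate them.\<close>
  define Q where "Q = (Z \<times> Z) \<inter> ({y. fst (fst y) = fst (snd y)} \<inter> {y. e \<le> dist (snd (fst y)) (snd (snd y))})"
  have cQ: "compact Q" unfolding Q_def
    by (intro compact_Int_closed closed_Int compact_Times Z(1) closed_Collect_eq closed_Collect_le continuous_intros)
  have "\<exists>\<psi> :: 'u \<Rightarrow>\<^sub>L real. \<psi> (snd (fst y) - snd (snd y)) \<noteq> 0" if y: "y \<in> Q" for y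
  proof -
    have "snd (fst y) - snd (snd y) \<noteq> 0" using y e(1) by (auto simp: Q_def)
    then obtain \<psi> :: "'u \<Rightarrow>\<^sub>L real" where "\<psi> (snd (fst y) - snd (snd y)) \<noteq> 0" by (rule Hahn_Banach_nonzero)
    then show ?thesis by blast
  qed
  then have "\<forall>y\<in>Q. \<exists>\<psi> :: 'u \<Rightarrow>\<^sub>L real. blinfun_apply \<psi> (snd (fst y) - snd (snd y)) \<noteq> 0" by simp
  then obtain \<eta> :: "(real \<times> 'u) \<times> real \<times> 'u \<Rightarrow> 'u \<Rightarrow>\<^sub>L real"
    where \<eta>: "\<forall>y\<in>Q. blinfun_apply (\<eta> y) (snd (fst y) - snd (snd y)) \<noteq> 0" by (rule bchoice[THEN exE])
  define W where "W y = {x :: (real \<times> 'u) \<times> real \<times> 'u. \<eta> y (snd (fst x) - snd (snd x)) \<noteq> 0}" for y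
  have W: "open (W y)" for y unfolding W_def by (intro open_Collect_neq continuous_intros)
  have "Q \<subseteq> (\<Union>y\<in>Q. W y)" using \<eta> by (auto simp: W_def)
  then obtain Q' where Q': "Q' \<subseteq> Q" "finite Q'" "Q \<subseteq> (\<Union>y\<in>Q'. W y)"
    by (rule compactE_image[where S = Q and C = Q and f = W, rotated 2]) (use cQ W in auto)
  have "finite (\<Psi> \<union> \<eta> ` Q')" using \<Psi>(1) Q'(2) by simp
  then have "\<exists>P :: 'u \<Rightarrow>\<^sub>L 'u. P o\<^sub>L P = P \<and> finite_dim (range P) \<and> (\<forall>u. P u = 0 \<longleftrightarrow> (\<forall>\<psi>\<in>\<Psi> \<union> \<eta> ` Q'. \<psi> u = 0))"
    by (rule finite_codim_projection) (intro exI conjI allI; assumption)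
  then obtain P :: "'u \<Rightarrow>\<^sub>L 'u" where P: "P o\<^sub>L P = P" "finite_dim (range P)"
    "\<forall>u. P u = 0 \<longleftrightarrow> (\<forall>\<psi>\<in>\<Psi> \<union> \<eta> ` Q'. \<psi> u = 0)" by (elim exE conjE) (rule that)
  have PP: "P (P u) = P u" for u using P(1) by (metis blinfun_apply_blinfun_compose)
  obtain T where T: "continuous_on C T" "T ` C \<subseteq> GL" "\<forall>z\<in>C. \<forall>u. P u = 0 \<longrightarrow> T z u = D z u"
  proof -
    have "\<forall>u. P u = 0 \<longrightarrow> (\<forall>\<psi>\<in>\<Psi>. blinfun_apply \<psi> u = 0)" using P(3) by simp
    then have "\<exists>T. continuous_on C T \<and> T ` C \<subseteq> GL \<and> (\<forall>z\<in>C. \<forall>u. P u = 0 \<longrightarrow> blinfun_apply (T z) u = D z u)"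
      using \<Psi>(2) PP P(2) by simp
    then show ?thesis by (elim exE conjE) (rule that)
  qed
  have inj: "z = z'" if z: "z \<in> Z" "z' \<in> Z" "fst z = fst z'" "P (snd z) = P (snd z')" for z z'
  proof -
    have "P (snd z - snd z') = 0" using z(4) by (simp add: blinfun.diff_right)
    then have van: "\<forall>\<psi>\<in>\<Psi> \<union> \<eta> ` Q'. \<psi> (snd z - snd z') = 0" using P(3) by simp
    then have p0: "P0 (snd z - snd z') = 0" using P0(3) by simp
    have dl: "dist (snd z) (snd z') < e"
    proof (rule ccontr)
      assume "\<not> ?thesis"
      then have "(z, z') \<in> Q" using z by (simp add: Q_def)
      then obtain y where "y \<in> Q'" "(z, z') \<in> W y" using Q'(3) by blast
      then show False using van by (simp add: W_def)
    qed
    have s: "(fst z, snd z) \<in> Z" "(fst z, snd z') \<in> Z" using z(1,2) by (simp, simp add: z(3))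
    have "snd z = snd z'" by (rule close[OF s dl p0])
    then show ?thesis using z(3) by (simp add: prod_eq_iff)
  qed
  show ?thesis
  proof (rule that[of P T])
    show "continuous_on Z T" using T(1) ZC continuous_on_subset by blast
    show "T ` Z \<subseteq> GL" using T(2) ZC by blast
    show "\<forall>z\<in>Z. \<forall>u. P u = 0 \<longrightarrow> T z u = D z u" using T(3) ZC by auto
    show "\<forall>z\<in>Z. \<forall>z'\<in>Z. fst z = fst z' \<longrightarrow> P (snd z) = P (snd z') \<longrightarrow> z = z'" using inj by simp
  qed (simp_all add: PP P(2))
qed

text \<open>The danger is nontrivial solutions accumulating at a point of some
  \<open>J k \<times> {0}\<close>. There \<open>D_u F\<close> is invertible, and
  \<open>slice_injective\<close> with \<open>P = 0\<close> leaves only the trivial solution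
  nearby.\<close>

lemma closed_nontrivial_solutions:
  fixes F :: "real \<times> 'u::banach \<Rightarrow> 'v::banach"
  assumes C1: "C1_map F" and F0: "\<And>t. F (t, 0) = 0"
    and J: "admissible_family (Sigma_on UNIV (\<lambda>t. D_u F (t, 0))) r s J"
  shows "closed (nontrivial_solutions F r s J)"
  unfolding closed_def open_dist
proof
  let ?S = "nontrivial_solutions F r s J" and ?O = "\<Union>k\<in>family_index r s. J k"
  note F = partial_derivative[OF C1]
  fix z assume "z \<in> - ?S"
  then have zS: "z \<notin> ?S" by simp
  have Smem: "y \<in> ?S \<longleftrightarrow> F y = 0 \<and> snd y \<noteq> 0 \<or> fst y \<notin> ?O \<and> snd y = 0" for y
    by (cases y) (auto simp: nontrivial_solutions_def)
  show "\<exists>e>0. \<forall>y. dist y z < e \<longrightarrow> y \<in> - ?S"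
  proof (cases "F z = 0")
    case False
    have "open {y. F y \<noteq> 0}" by (intro open_Collect_neq F(1) continuous_on_const)
    then obtain e where "0 < e" "\<forall>y. dist y z < e \<longrightarrow> F y \<noteq> 0" using False unfolding open_dist by blast
    moreover have "F y = 0" if "y \<in> ?S" for y using that F0 Smem[of y] by (cases y) auto
    ultimately show ?thesis by blast
  next
    case True
    then have z0: "snd z = 0" "fst z \<in> ?O" using zS Smem by auto
    then obtain k where k: "k \<in> family_index r s" "fst z \<in> J k" by blast
    have "D_u F (fst z, 0) \<in> GL" using J_disjoint[OF J k(1)] k(2) by (auto simp: Sigma_on_def)
    then have "D_u F z \<in> GL" using z0(1) by (cases z) simp
    then obtain c where c: "0 < c" "\<And>w. norm w \<le> c * norm (D_u F z w)" using GL_bounded_below by blast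
    obtain d where d: "0 < d" "\<And>l u v. (l, u) \<in> ball z d \<Longrightarrow> (l, v) \<in> ball z d \<Longrightarrow> F (l, u) = F (l, v) \<Longrightarrow> blinfun_apply (0 :: 'u \<Rightarrow>\<^sub>L 'u) (u - v) = 0 \<Longrightarrow> u = v"
      using slice_injective[OF F(2,3) c(1), where P = 0 and ?z0.0 = z] c(2) by blast
    obtain d' where d': "0 < d'" "ball (fst z) d' \<subseteq> J k" using J_open[OF J k(1)] k(2) openE by blast
    show ?thesis
    proof (intro exI[of _ "min d d'"] conjI allI impI)
      show "0 < min d d'" using d d' by simp
      fix y assume y: "dist y z < min d d'"
      have dl: "dist (fst y) (fst z) < min d d'" using y dist_fst_le[of y z] by linarith
      then have "fst y \<in> J k" using d'(2) by (auto simp: dist_commute)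
      moreover have "snd y = 0" if Fy: "F y = 0"
      proof -
        have "dist (fst y, 0) z < d" using dl z0(1) by (cases z) (simp add: dist_Pair_Pair)
        then show ?thesis using d(2)[of "fst y" "snd y" 0] y Fy F0 by (simp add: dist_commute)
      qed
      ultimately show "y \<in> - ?S" using k(1) Smem[of y] by auto
    qed
  qed
qed

text \<open>The gap is connected, so a single component \<open>C\<close> contains it, and
  \<open>C\<close> is bounded and meets the axis nowhere else. In a compact space, closed sets met
  by no common connected set are separated by a clopen splitting; here the gap is split from the
  rest of the axis and from the boundary of a large ball.\<close>

lemma isolating_compact:
  fixes F :: "real \<times> 'u::banach \<Rightarrow> 'v::banach"
  assumes C1: "C1_map F" and F0: "\<And>t. F (t, 0) = 0" and proper: "proper_on_bounded_closed F"
    and J: "admissible_family (Sigma_on UNIV (\<lambda>t. D_u F (t, 0))) r s J" and n: "n \<in> gap_index r s"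
    and neg: "\<And>C. C \<in> components (nontrivial_solutions F r s J) \<Longrightarrow> C \<inter> gap J n \<times> {0} \<noteq> {} \<Longrightarrow>
      bounded C \<and> (\<forall>m\<in>gap_index r s. m \<noteq> n \<longrightarrow> C \<inter> gap J m \<times> {0} = {})"
  obtains K where "compact K" "K \<subseteq> nontrivial_solutions F r s J" "closed (nontrivial_solutions F r s J - K)"
    "gap J n \<times> {0} \<subseteq> K" "\<forall>t. (t, 0) \<in> K \<longrightarrow> t \<in> gap J n"
proof -
  let ?S = "nontrivial_solutions F r s J" and ?O = "\<Union>k\<in>family_index r s. J k"
  have clS: "closed ?S" by (rule closed_nontrivial_solutions[OF C1 F0 J])
  have axS: "(t, 0) \<in> ?S \<longleftrightarrow> t \<notin> ?O" for t by (auto simp: nontrivial_solutions_def)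
  have SF: "F y = 0" if "y \<in> ?S" for y using that F0 by (auto simp: nontrivial_solutions_def)
  define A where "A = Sup (J (n - 1))"
  have A: "A \<in> gap J n" using Sup_le_Inf[OF J n] by (simp add: gap_def A_def)
  have gS: "gap J n \<times> {0} \<subseteq> ?S" using gap_disjoint[OF J n] axS by auto
  define C where "C = connected_component_set ?S (A, 0)"
  have AS: "(A, 0) \<in> ?S" using A gS by blast
  then have Ccomp: "C \<in> components ?S" by (auto simp: C_def components_def)
  have gconn: "connected (gap J n \<times> {0 :: 'u})" unfolding gap_def by (intro connected_Times) auto
  have gC: "gap J n \<times> {0} \<subseteq> C" unfolding C_def
    by (rule connected_component_maximal) (use A gconn gS in auto)
  have ne: "C \<inter> gap J n \<times> {0} \<noteq> {}" using gC A by blast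
  have Cb: "bounded C" and Cm: "\<And>m. m \<in> gap_index r s \<Longrightarrow> m \<noteq> n \<Longrightarrow> C \<inter> gap J m \<times> {0} = {}"
    using neg[OF Ccomp ne] by auto
  have Cmax: "X \<subseteq> C" if "connected X" "X \<subseteq> ?S" "X \<inter> C \<noteq> {}" for X
    using components_maximal[OF Ccomp that(1,2)] that(3) by (simp add: Int_commute)
  have nb: "\<not> bounded ({..t} \<times> {0 :: 'u})" "\<not> bounded ({t..} \<times> {0 :: 'u})" for t :: real
  proof -
    show "\<not> bounded ({..t} \<times> {0 :: 'u})"
    proof
      assume "bounded ({..t} \<times> {0 :: 'u})"
      then have "bounded (fst ` ({..t} \<times> {0 :: 'u}))" by (rule bounded_fst)
      then obtain a where "\<And>x. x \<le> t \<Longrightarrow> \<bar>x\<bar> \<le> a" by (auto simp: bounded_iff)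
      from this[of "min t (- a - 1)"] show False by auto
    qed
    show "\<not> bounded ({t..} \<times> {0 :: 'u})"
    proof
      assume "bounded ({t..} \<times> {0 :: 'u})"
      then have "bounded (fst ` ({t..} \<times> {0 :: 'u}))" by (rule bounded_fst)
      then obtain a where "\<And>x. t \<le> x \<Longrightarrow> \<bar>x\<bar> \<le> a" by (auto simp: bounded_iff)
      from this[of "max t (\<bar>a\<bar> + 1)"] show False by auto
    qed
  qed
  \<comment> \<open>Other gaps are excluded by \<open>neg\<close>; in an unbounded end of the axis
    \<open>C\<close> would contain a half-line and be unbounded.\<close>
  have Cax: "t \<in> gap J n" if tC: "(t, 0) \<in> C" for t
  proof -
    have tO: "t \<notin> ?O" using tC axS in_components_subset[OF Ccomp] by blast
    consider (gap) "\<exists>m\<in>gap_index r s. t \<in> gap J m" | (left) "{..t} \<inter> ?O = {}" | (right) "{t..} \<inter> ?O = {}"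
      using axis_trichotomy[OF J tO] by (elim disjE) (rule that, assumption)+
    then show ?thesis
    proof cases
      case gap
      then obtain m where m: "m \<in> gap_index r s" "t \<in> gap J m" by blast
      have "(t, 0) \<in> C \<inter> gap J m \<times> {0}" using tC m(2) by simp
      then have "m = n" using Cm[OF m(1)] by (metis empty_iff)
      then show ?thesis using m(2) by simp
    next
      case left
      have "{..t} \<times> {0} \<subseteq> C"
      proof (rule Cmax)
        show "connected ({..t} \<times> {0 :: 'u})" by (intro connected_Times) auto
        show "{..t} \<times> {0} \<subseteq> ?S" using left axS by (simp add: subset_iff disjoint_iff)
        have "(t, 0) \<in> {..t} \<times> {0} \<inter> C" using tC by simp
        then show "{..t} \<times> {0} \<inter> C \<noteq> {}" by (metis empty_iff)
      qed
      then show ?thesis using bounded_subset[OF Cb] nb(1) by (metis (no_types))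
    next
      case right
      have "{t..} \<times> {0} \<subseteq> C"
      proof (rule Cmax)
        show "connected ({t..} \<times> {0 :: 'u})" by (intro connected_Times) auto
        show "{t..} \<times> {0} \<subseteq> ?S" using right axS by (simp add: subset_iff disjoint_iff)
        have "(t, 0) \<in> {t..} \<times> {0} \<inter> C" using tC by simp
        then show "{t..} \<times> {0} \<inter> C \<noteq> {}" by (metis empty_iff)
      qed
      then show ?thesis using bounded_subset[OF Cb] nb(2) by (metis (no_types))
    qed
  qed
  obtain R where R: "C \<subseteq> ball 0 R" using Cb bounded_subset_ballD by blast
  \<comment> \<open>Properness, applied to the compact set \<open>{0}\<close>, makes the bounded
    part of the solution set compact.\<close>
  define X where "X = ?S \<inter> cball 0 R"
  have "compact (cball 0 R \<inter> F -` {0})" using proper unfolding proper_on_bounded_closed_def by auto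
  moreover have "closed X" unfolding X_def by (intro closed_Int clS closed_cball)
  moreover have "X = (cball 0 R \<inter> F -` {0}) \<inter> X" using SF by (auto simp: X_def)
  ultimately have cX: "compact X" using compact_Int_closed by metis
  define Ax where "Ax = {t. t \<notin> ?O \<and> t \<notin> gap J n} \<times> {0 :: 'u}"
  have clAx: "closed Ax" unfolding Ax_def by (intro closed_Times closed_other_axis[OF J n]) auto
  \<comment> \<open>\<open>B\<close> contains all points of \<open>X\<close> outside the open ball,
    so a piece \<open>K\<close> avoiding \<open>B\<close> stays inside the ball and remains isolated
    in the full solution set.\<close>
  define B where "B = X \<inter> (Ax \<union> - ball 0 R)"
  have clB: "closedin (top_of_set X) B" unfolding B_def
    by (intro closedin_closed_Int closed_Un clAx) (simp add: closed_Compl)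
  have "separated_between (top_of_set X) (gap J n \<times> {0}) B"
  proof (rule cut_wire_fence_theorem_gen)
    show "compact_space (top_of_set X)" using cX by (simp add: compact_space_subtopology)
    show "Hausdorff_space (top_of_set X) \<or> regular_space (top_of_set X) \<or> normal_space (top_of_set X)"
      by (simp add: Hausdorff_space_subtopology)
    have "gap J n \<times> {0} \<subseteq> X" using gC R gS by (force simp: X_def)
    moreover have "compact (gap J n \<times> {0 :: 'u})" unfolding gap_def by (intro compact_Times) auto
    ultimately show "compactin (top_of_set X) (gap J n \<times> {0})" by (simp add: compactin_subtopology)
    show "closedin (top_of_set X) B" by (rule clB)
    fix E assume "connectedin (top_of_set X) E"
    then have E: "connected E" "E \<subseteq> X" by (auto simp: connectedin_subtopology)
    show "disjnt E (gap J n \<times> {0}) \<or> disjnt E B"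
    proof (rule ccontr)
      assume "\<not> ?thesis"
      then obtain x y where xy: "x \<in> E" "x \<in> gap J n \<times> {0}" "y \<in> E" "y \<in> B" by (auto simp: disjnt_iff)
      have "E \<subseteq> C" by (rule Cmax) (use E xy gC in \<open>auto simp: X_def\<close>)
      then have "y \<in> C" using xy by blast
      then have "y \<in> ball 0 R" "y \<notin> Ax" using R Cax by (auto simp: Ax_def)
      then show False using xy(4) by (simp add: B_def)
    qed
  qed
  then obtain K V where KV: "openin (top_of_set X) K" "openin (top_of_set X) V" "K \<union> V = X" "disjnt K V"
    "gap J n \<times> {0} \<subseteq> K" "B \<subseteq> V" unfolding separated_between_def by auto
  have "K = X - V" "V = X - K" using KV(3,4) by (auto simp: disjnt_iff)
  then have cl: "closedin (top_of_set X) K" "closedin (top_of_set X) V"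
    using KV(1,2) by (metis closedin_def closedin_diff closedin_topspace topspace_euclidean_subtopology)+
  have cK: "compact K" "compact V" using cl cX closedin_compact by blast+
  show ?thesis
  proof (rule that[of K])
    show "compact K" by (rule cK)
    show KS: "K \<subseteq> ?S" using KV(3) by (auto simp: X_def)
    have KB: "K \<inter> B = {}" using KV(4,6) by (auto simp: disjnt_iff)
    have "?S - K = V \<union> (?S \<inter> - ball 0 R)"
      using KB KV(3,4) by (auto simp: X_def B_def disjnt_iff)
    moreover have "closed (V \<union> (?S \<inter> - ball 0 R))"
      by (intro closed_Un closed_Int clS compact_imp_closed cK closed_Compl) simp
    ultimately show "closed (?S - K)" by simp
    show "gap J n \<times> {0} \<subseteq> K" by (rule KV)
    show "\<forall>t. (t, 0) \<in> K \<longrightarrow> t \<in> gap J n"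
    proof (intro allI impI)
      fix t assume tK: "(t, 0) \<in> K"
      then have "(t, 0) \<in> ?S" "(t, 0) \<in> X" using KS KV(3) by auto
      then show "t \<in> gap J n" using KB tK axS by (auto simp: B_def Ax_def)
    qed
  qed
qed

theorem theorem5p12:
  fixes F :: "real \<times> 'u::banach \<Rightarrow> 'v::banach"
    and L :: "real \<Rightarrow> 'u \<Rightarrow>\<^sub>L 'v"
    and J :: "int \<Rightarrow> real set"
    and r s :: "int extended"
    and n :: int
  assumes C1: "C1_map F"
    and F1: "orientable_on UNIV (D_u F)"
    and F2: "\<forall>t. F (t, 0) = 0"
    and F3: "\<forall>z. D_u F z \<in> Phi0"
    and F4: "proper_on_bounded_closed F"
    and L: "L = (\<lambda>t. D_u F (t, 0))"
    and J: "admissible_family (Sigma_on UNIV L) r s J"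
    and n: "n \<in> gap_index r s"
    and odd_chi: "\<forall>\<^sub>F \<delta> in at_right 0.
      \<forall>L\<omega> :: real \<Rightarrow> 'u \<Rightarrow>\<^sub>L 'v.
        admissible_path L\<omega> (Inf (gap J n) - \<delta>) (Sup (gap J n) + \<delta>) \<and>
        analytic_path L\<omega> (Inf (gap J n) - \<delta>) (Sup (gap J n) + \<delta>) \<and>
        A_homotopic (Inf (gap J n) - \<delta>) (Sup (gap J n) + \<delta>) L\<omega> L \<longrightarrow>
        odd (chi_total L\<omega> (Inf (gap J n) - \<delta>) (Sup (gap J n) + \<delta>))"
  shows "\<exists>C \<in> components (nontrivial_solutions F r s J).
           C \<inter> gap J n \<times> {0} \<noteq> {} \<and>
           (\<not> bounded C \<or>
            (\<exists>m \<in> gap_index r s. m \<noteq> n \<and> C \<inter> gap J m \<times> {0} \<noteq> {}))"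
proof (rule ccontr)
  assume neg: "\<not> ?thesis"
  let ?S = "nontrivial_solutions F r s J" and ?O = "\<Union>k\<in>family_index r s. J k"
  have F0: "F (t, 0) = 0" for t using F2 by simp
  have J': "admissible_family (Sigma_on UNIV (\<lambda>t. D_u F (t, 0))) r s J" using J L by simp
  note F = partial_derivative[OF C1] and nI = gap_index_imp[OF n]
  have "\<exists>K. compact K \<and> K \<subseteq> ?S \<and> closed (?S - K) \<and> gap J n \<times> {0} \<subseteq> K \<and> (\<forall>t. (t, 0) \<in> K \<longrightarrow> t \<in> gap J n)"
    by (rule isolating_compact[OF C1 F0 F4 J' n]) (use neg in blast)+
  then obtain K where K: "compact K" "K \<subseteq> ?S" "closed (?S - K)" "gap J n \<times> {0} \<subseteq> K"
    "\<forall>t. (t, 0) \<in> K \<longrightarrow> t \<in> gap J n" by blast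
  have KF: "F z = 0" if "z \<in> K" for z using that K(2) F0 by (auto simp: nontrivial_solutions_def)
  define A B where "A = Sup (J (n - 1))" and "B = Inf (J n)"
  have AB: "A \<le> B" using Sup_le_Inf[OF J n] by (simp add: A_def B_def)
  have gap: "gap J n = {A..B}" by (simp add: gap_def A_def B_def)
  have IS: "Inf (gap J n) = A" "Sup (gap J n) = B" using AB by (simp_all add: gap)
  have JA: "x < A" if "x \<in> J (n - 1)" for x using J_prev_less_Sup[OF J n that] by (simp add: A_def)
  have JB: "B < x" if "x \<in> J n" for x using Inf_less_J[OF J n that] by (simp add: B_def)
  obtain x0 y0 where x0: "x0 \<in> J (n - 1)" and y0: "y0 \<in> J n" using J_ne[OF J] nI by blast
  obtain d where d: "0 < d" and chi: "\<forall>\<delta>>0. \<delta> < d \<longrightarrow> (\<forall>L\<omega> :: real \<Rightarrow> 'u \<Rightarrow>\<^sub>L 'v.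
      admissible_path L\<omega> (A - \<delta>) (B + \<delta>) \<and> analytic_path L\<omega> (A - \<delta>) (B + \<delta>) \<and>
      A_homotopic (A - \<delta>) (B + \<delta>) L\<omega> L \<longrightarrow> odd (chi_total L\<omega> (A - \<delta>) (B + \<delta>)))"
    using odd_chi unfolding IS eventually_at_right_field by blast
  \<comment> \<open>Small enough for the oddness hypothesis and for the ends \<open>a\<close> and
    \<open>b\<close> to lie in the two neighbouring intervals, where the linearization is
    invertible.\<close>
  define \<delta> where "\<delta> = min (d / 2) (min ((A - x0) / 2) ((y0 - B) / 2))"
  have \<delta>: "0 < \<delta>" "\<delta> < d" "\<delta> < A - x0" "\<delta> < y0 - B"
    using d JA[OF x0] JB[OF y0] by (simp_all add: \<delta>_def min_less_iff_disj)
  define a b where "a = A - \<delta>" and "b = B + \<delta>"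
  have ab: "a < A" "B < b" "a < b" "x0 < a" "b < y0" using \<delta> AB by (simp_all add: a_def b_def)
  have cases: "t \<in> J (n - 1) \<or> t \<in> {A..B} \<or> t \<in> J n" if "a \<le> t" "t \<le> b" for t
    using gap_cases[OF J n x0 y0, of t] ab that unfolding gap by linarith
  have "a \<in> J (n - 1)" using cases[of a] JB[of a] ab AB by auto
  moreover have "b \<in> J n" using cases[of b] JA[of b] ab AB by auto
  ultimately have GLab: "D_u F (a, 0) \<in> GL" "D_u F (b, 0) \<in> GL"
    using J_disjoint[OF J' nI(1)] J_disjoint[OF J' nI(2)] by (auto simp: Sigma_on_def)
  define K' where "K' = K \<union> {a..b} \<times> {0}"
  have cK': "compact K'" unfolding K'_def by (intro compact_Un compact_Times K(1)) auto
  have "K' \<inter> (?S - K) = {}"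
  proof -
    have "(t, 0) \<in> K" if t: "(t, 0) \<in> ?S" "a \<le> t" "t \<le> b" for t
    proof -
      have "t \<notin> ?O" using t(1) by (auto simp: nontrivial_solutions_def)
      then have "t \<in> {A..B}" using cases[OF t(2,3)] nI by blast
      then show ?thesis using K(4) gap by auto
    qed
    then show ?thesis by (auto simp: K'_def)
  qed
  then have "K' \<subseteq> \<Union>{- (?S - K)}" by blast
  \<comment> \<open>A Lebesgue number for the cover by a single open set, which amounts to a uniform
    distance from \<open>K'\<close> to the remaining nontrivial solutions.\<close>
  then have "\<exists>\<epsilon>>0. \<forall>y\<in>K'. \<exists>G\<in>{- (?S - K)}. ball y \<epsilon> \<subseteq> G"
  proof (rule Heine_Borel_lemma[OF cK'])
    show "open G" if "G \<in> {- (?S - K)}" for G using that open_Compl[OF K(3)] by simp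
  qed blast
  then obtain \<epsilon> where \<epsilon>: "0 < \<epsilon>" "\<forall>y\<in>K'. ball y \<epsilon> \<subseteq> - (?S - K)" by blast
  have near: "z \<in> K \<or> snd z = 0" if z: "F z = 0" "y \<in> K'" "dist z y < \<epsilon>" for z y
  proof (rule ccontr)
    assume "\<not> ?thesis"
    then have "z \<in> ?S - K" using z(1) by (cases z) (simp add: nontrivial_solutions_def)
    moreover have "z \<in> ball y \<epsilon>" using z(3) by (simp add: dist_commute)
    ultimately show False using \<epsilon>(2) z(2) by blast
  qed
  obtain R0 where R0: "\<And>z. z \<in> K \<Longrightarrow> norm z \<le> R0" using compact_imp_bounded[OF K(1)] by (auto simp: bounded_iff)
  \<comment> \<open>Large enough that for every \<open>(l, u)\<close> in \<open>K\<close> the axis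
    point \<open>(l, 0)\<close> is in \<open>Z\<close>; injectivity of \<open>P\<close> on slices of
    \<open>Z\<close> then compares solutions with the trivial one.\<close>
  define R where "R = max R0 (max \<bar>a\<bar> \<bar>b\<bar>)"
  define Z where "Z = K \<union> {- R..R} \<times> {0}"
  have KZ: "K' \<subseteq> Z" unfolding K'_def Z_def R_def by auto
  have axZ: "(l, 0) \<in> Z" if "(l, u) \<in> K" for l u
  proof -
    have "\<bar>l\<bar> \<le> R" using R0[OF that] norm_fst_le[of l u] by (simp add: R_def)
    then show ?thesis by (auto simp: Z_def)
  qed
  have Z: "compact Z" "Z \<noteq> {}" "\<And>z. z \<in> Z \<Longrightarrow> F z = 0"
  proof -
    show "compact Z" unfolding Z_def by (intro compact_Un compact_Times K(1)) auto
    show "Z \<noteq> {}" using KZ ab(3) by (auto simp: K'_def)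
    show "F z = 0" if "z \<in> Z" for z using that KF F0 by (cases z) (auto simp: Z_def)
  qed
  have F3': "D_u F z \<in> Phi0" for z using F3 by blast
  have "\<exists>(P :: 'u \<Rightarrow>\<^sub>L 'u) T. (\<forall>u. P (P u) = P u) \<and> finite_dim (range P) \<and>
    (\<forall>z\<in>Z. \<forall>z'\<in>Z. fst z = fst z' \<longrightarrow> P (snd z) = P (snd z') \<longrightarrow> z = z') \<and>
    continuous_on Z T \<and> T ` Z \<subseteq> GL \<and> (\<forall>z\<in>Z. \<forall>u. P u = 0 \<longrightarrow> blinfun_apply (T z) u = D_u F z u)"
    by (rule separating_parametrix[where F = F and D = "D_u F" and Z = Z]; (fact F(2,3) F3' Z)?)
      (intro exI conjI; assumption)
  then obtain P :: "'u \<Rightarrow>\<^sub>L 'u" and T where PP: "\<forall>u. P (P u) = P u" and fin: "finite_dim (range P)"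
    and inj: "\<forall>z\<in>Z. \<forall>z'\<in>Z. fst z = fst z' \<longrightarrow> P (snd z) = P (snd z') \<longrightarrow> z = z'"
    and T: "continuous_on Z T" "T ` Z \<subseteq> GL" "\<forall>z\<in>Z. \<forall>u. P u = 0 \<longrightarrow> blinfun_apply (T z) u = D_u F z u"
    by (elim exE conjE) (rule that)
  \<comment> \<open>If \<open>P u = 0\<close>, injectivity gives \<open>u = 0\<close>, so
    \<open>l\<close> would lie in the gap and hence strictly between \<open>a\<close> and
    \<open>b\<close>.\<close>
  have sep: "P u \<noteq> 0" if K0: "(l, u) \<in> K" "l \<le> a \<or> b \<le> l" for l u
  proof
    assume "P u = 0"
    moreover have "(l, u) \<in> Z" using K0(1) by (simp add: Z_def)
    ultimately have "(l, u) = (l, 0)" using inj[rule_format, of "(l, u)" "(l, 0)"] axZ[OF K0(1)] by simp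
    then have "l \<in> gap J n" using K0(1) K(5) by simp
    then show False using K0(2) ab gap by auto
  qed
  have PP': "P (P u) = P u" for u using PP by simp
  have inj': "z = z'" if "z \<in> K'" "z' \<in> K'" "fst z = fst z'" "P (snd z) = P (snd z')" for z z'
    by (rule inj[rule_format, OF subsetD[OF KZ that(1)] subsetD[OF KZ that(2)] that(3,4)])
  have T': "continuous_on K' T" "T ` K' \<subseteq> GL" using T(1,2) KZ continuous_on_subset by blast+
  have TD: "T z u = D_u F z u" if "z \<in> K'" "P u = 0" for z u by (rule T(3)[rule_format, OF subsetD[OF KZ that(1)] that(2)])
  have pc: "path_component (GL \<inter> kernel_fixing P) (blinfun_inv (T (a, 0)) o\<^sub>L D_u F (a, 0))
      (blinfun_inv (T (b, 0)) o\<^sub>L D_u F (b, 0))"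
    by (rule bifurcation_same_component[where F = F and K = K and K' = K' and \<epsilon> = \<epsilon>];
      fact F F0 ab(3) GLab K(1) KF PP' fin K'_def \<epsilon>(1) near sep inj' T' TD)
  have axK: "(t, 0) \<in> K'" if "t \<in> {a..b}" for t using that by (simp add: K'_def)
  have "\<exists>L\<omega>. admissible_path L\<omega> a b \<and> analytic_path L\<omega> a b \<and> A_homotopic a b L\<omega> L \<and> Sigma_on {a..b} L\<omega> = {}"
  proof (rule deform_to_analytic_GL_path[where L = L and T = "\<lambda>t. T (t, 0)" and P = P and a = a and b = b])
    show "continuous_on {a..b} L" unfolding L
      by (rule continuous_on_compose2[OF F(2)]) (auto intro!: continuous_intros)
    show "L a \<in> GL" "L b \<in> GL" using GLab by (simp_all add: L)
    show "continuous_on {a..b} (\<lambda>t. T (t, 0))"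
      by (rule continuous_on_compose2[OF T'(1)]) (use axK in \<open>auto intro!: continuous_intros\<close>)
    show "(\<lambda>t. T (t, 0)) ` {a..b} \<subseteq> GL" using T'(2) axK by blast
    show "T (t, 0) u = L t u" if "t \<in> {a..b}" "P u = 0" for t u using TD[OF axK[OF that(1)] that(2)] by (simp add: L)
    show "path_component (GL \<inter> kernel_fixing P) (blinfun_inv (T (a, 0)) o\<^sub>L L a) (blinfun_inv (T (b, 0)) o\<^sub>L L b)"
      using pc by (simp add: L)
    show "a < b" by fact
    show "P (P u) = P u" for u by fact
    show "finite_dim (range P)" by fact
  qed (intro exI conjI; assumption)
  then obtain L\<omega> where L\<omega>: "admissible_path L\<omega> a b" "analytic_path L\<omega> a b" "A_homotopic a b L\<omega> L"
    "Sigma_on {a..b} L\<omega> = {}" by blast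
  then have "odd (chi_total L\<omega> a b)" using chi[rule_format, OF \<delta>(1,2), folded a_def b_def] by blast
  then show False using L\<omega>(4) by (simp add: chi_total_def)
qed

end
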